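(* Given an $r$-regular graph $G$ with $r\geq 3$, it is NP-complete to decide whether $\chi_{i}(G)=r$. That is, the following decision problem is NP-complete: the instance is an $r$-regular graph $G$ with $r\ge 3$, and the question is whether $\chi_i(G)=r$.
   Context: All graphs are finite and simple. An injective $k$-coloring function of a graph $G$ is a function $f:V(G)\to\{1,\dots,k\}$ such that no vertex $v$ is adjacent to two distinct vertices $u$ and $w$ with $f(u)=f(w)$ (adjacent vertices may receive the same color). The injective chromatic number $\chi_i(G)$ is the minimum $k$ for which $G$ admits an injective $k$-coloring function. *)

theory Defs
  imports "HOL-Computational_Algebra.Polynomial"
begin

section \<open>Simple graphs and injective colouring\<close>

definition sgraph :: "'a set \<Rightarrow> 'a set set \<Rightarrow> bool" where
  "sgraph V E \<longleftrightarrow> finite V \<and> (\<forall>e\<in>E. e \<subseteq> V \<and> card e = 2)"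

definition regular :: "nat \<Rightarrow> 'a set \<Rightarrow> 'a set set \<Rightarrow> bool" where
  "regular r V E \<longleftrightarrow> (\<forall>v\<in>V. card {u \<in> V. {v, u} \<in> E} = r)"

definition injective_coloring ::
    "nat \<Rightarrow> 'a set \<Rightarrow> 'a set set \<Rightarrow> ('a \<Rightarrow> nat) \<Rightarrow> bool" where
  "injective_coloring k V E f \<longleftrightarrow>
     f ` V \<subseteq> {1..k} \<and>
     \<not> (\<exists>v\<in>V. \<exists>u\<in>V. \<exists>w\<in>V. {v, u} \<in> E \<and> {v, w} \<in> E \<and> u \<noteq> w \<and> f u = f w)"

definition injective_chromatic_number :: "'a set \<Rightarrow> 'a set set \<Rightarrow> nat" where
  "injective_chromatic_number V E = (LEAST k. \<exists>f. injective_coloring k V E f)"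


section \<open>Deterministic multi-tape Turing machines\<close>

text \<open>
  A machine has a finite number of tapes, infinite in both directions, and works over the
  tape alphabet \<open>{..<symbols M}\<close>, where 0 is the blank and 1 and 2 are the bits
  \<open>False\<close> and \<open>True\<close>.  The working states are \<open>{..<states M}\<close>, the start state is 0, and
  the number \<open>states M\<close> itself is the halting state.  The transition function maps a
  working state and the list of scanned symbols to the next state and, for each tape, the
  symbol to be written and the head movement (\<open>-1\<close>, \<open>0\<close> or \<open>1\<close>).
\<close>

record tm =
  tapes :: nat
  states :: nat
  symbols :: nat
  trans :: "nat \<Rightarrow> nat list \<Rightarrow> nat \<times> (nat \<times> int) list"

definition wf_tm :: "tm \<Rightarrow> bool" where
  "wf_tm M \<longleftrightarrow> tapes M \<ge> 2 \<and> symbols M \<ge> 3 \<and>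
     (\<forall>q < states M. \<forall>xs. length xs = tapes M \<and> set xs \<subseteq> {..<symbols M} \<longrightarrow>
        (case trans M q xs of (q', acts) \<Rightarrow>
           q' \<le> states M \<and> length acts = tapes M \<and>
           set acts \<subseteq> {..<symbols M} \<times> {-1, 0, 1}))"

text \<open>A tape is given by its contents and its head position.\<close>

type_synonym tape = "(int \<Rightarrow> nat) \<times> int"
type_synonym config = "nat \<times> tape list"

definition scanned :: "tape \<Rightarrow> nat" where
  "scanned t = fst t (snd t)"

definition act :: "tape \<Rightarrow> nat \<times> int \<Rightarrow> tape" where
  "act t a = ((fst t)(snd t := fst a), snd t + snd a)"

definition step :: "tm \<Rightarrow> config \<Rightarrow> config" where
  "step M c = (case c of (q, ts) \<Rightarrow>
     if q < states M
     then (case trans M q (map scanned ts) of (q', acts) \<Rightarrow> (q', map2 act ts acts))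
     else (q, ts))"

definition contents :: "bool list \<Rightarrow> int \<Rightarrow> nat" where
  "contents x i =
     (if 0 \<le> i \<and> i < int (length x) then (if x ! nat i then 2 else 1) else 0)"

text \<open>The input is written on tape 0, all other tapes are blank.\<close>

definition init :: "tm \<Rightarrow> bool list \<Rightarrow> config" where
  "init M x = (0, (contents x, 0) # replicate (tapes M - 1) (contents [], 0))"

text \<open>
  The output is read off tape 1.  Since halting configurations are fixed points of
  \<open>step\<close>, being in the halting state after \<open>T n\<close> steps means having halted within
  \<open>T n\<close> steps.
\<close>

definition computes_in_time ::
    "tm \<Rightarrow> (bool list \<Rightarrow> bool list) \<Rightarrow> (nat \<Rightarrow> nat) \<Rightarrow> bool" where
  "computes_in_time M f T \<longleftrightarrow>
     (\<forall>x. case (step M ^^ T (length x)) (init M x) of (q, ts) \<Rightarrow>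
        q = states M \<and> fst (ts ! 1) = contents (f x))"

definition polytime :: "(bool list \<Rightarrow> bool list) \<Rightarrow> bool" where
  "polytime f \<longleftrightarrow> (\<exists>M (p :: nat poly). wf_tm M \<and> computes_in_time M f (poly p))"


section \<open>NP-completeness\<close>

type_synonym language = "bool list set"

definition class_P :: "language set" where
  "class_P = {L. polytime (\<lambda>x. [x \<in> L])}"

text \<open>
  Pairs of words are encoded by doubling every bit of the first component; the block
  \<open>01\<close> then marks its end.
\<close>

definition pair_word :: "bool list \<Rightarrow> bool list \<Rightarrow> bool list" where
  "pair_word x u = concat (map (\<lambda>b. [b, b]) x) @ [False, True] @ u"

definition class_NP :: "language set" where
  "class_NP = {L. \<exists>L' \<in> class_P. \<exists>p :: nat poly. \<forall>x.
     x \<in> L \<longleftrightarrow> (\<exists>u. length u \<le> poly p (length x) \<and> pair_word x u \<in> L')}"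

definition polytime_reducible :: "language \<Rightarrow> language \<Rightarrow> bool" where
  "polytime_reducible A B \<longleftrightarrow> (\<exists>f. polytime f \<and> (\<forall>x. x \<in> A \<longleftrightarrow> f x \<in> B))"

definition NP_hard :: "language \<Rightarrow> bool" where
  "NP_hard B \<longleftrightarrow> (\<forall>A \<in> class_NP. polytime_reducible A B)"

definition NP_complete :: "language \<Rightarrow> bool" where
  "NP_complete B \<longleftrightarrow> B \<in> class_NP \<and> NP_hard B"


section \<open>The decision problem\<close>

text \<open>
  A graph with vertex set \<open>{..<n}\<close> is encoded by its adjacency matrix, row by row; as the
  length of the word is the square of \<open>n\<close>, the word determines \<open>n\<close> and the graph.
\<close>

definition encode_graph :: "nat \<Rightarrow> nat set set \<Rightarrow> bool list" where
  "encode_graph n E = concat (map (\<lambda>i. map (\<lambda>j. {i, j} \<in> E) [0..<n]) [0..<n])"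

text \<open>
  The language of encodings of yes-instances.  The degree \<open>r\<close> is not a fixed parameter: it
  is determined by the input graph.
\<close>

definition regular_injective_coloring :: language where
  "regular_injective_coloring =
     {encode_graph n E | n E. sgraph {..<n} E \<and>
        (\<exists>r \<ge> 3. regular r {..<n} E \<and> injective_chromatic_number {..<n} E = r)}"

end

theory Submission imports Defs
begin

text \<open>
  Membership: an \<open>r\<close>-regular graph has injective chromatic number \<open>r\<close> iff it has a colouring with
  \<open>r\<close> colours in which every vertex sees every colour exactly once, and a word listing such a
  colouring is a certificate.

  Hardness: a computation of a polynomial-time verifier is described by clauses that force the
  assignment to contain the true configurations (Horn clauses, apart from those guessing the
  certificate).  The set of clauses becomes a hypergraph whose blocks have to be
  rainbow coloured with \<open>r\<close> colours, the colours being the literals: the point of a variable has to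
  receive its false literal, the point of a clause one of its true literals, and a block of size
  two keeps each clause point off the false literals.  As \<open>r\<close> is part of the input, it can be
  chosen larger than the number of blocks.  Then \<open>r\<close> copies of the points can be partitioned, once
  for every block, into the copies of this block and the sets of all copies of one remaining point;
  the bipartite incidence graph of these partitions is \<open>r\<close>-regular, the partitions colour its
  second side, and an exact colouring of the first side restricts to a rainbow colouring on each
  copy.

  All functions involved are made of sums, products, bounded quantifiers and input bits, with
  arguments of polynomial size; Turing machines evaluate these in unary.
\<close>


section \<open>Counter programs and their compilation to Turing machines\<close>

text \<open>Two demands have to be met at once: degree \<open>r\<close> everywhere, and every colour
  at every vertex. So each copy must lie in exactly one class of each of \<open>r\<close>
  partitions, and each class must have \<open>r\<close> members. Cyclic shifts reconcile the two
  kinds of classes. If copy \<open>l\<close> of a point has the colour of the point plus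
  \<open>l\<close> modulo \<open>r\<close>, then the \<open>l\<close>-th copy of a block is rainbow,
  all its colours being shifted alike, and the set of all copies of one point is rainbow as well,
  the shift taking every value. Hence the classes that merely restore regularity put no condition on
  the hypergraph.

  Blocks can only demand that colours differ, whereas clauses refer to particular literals. A block
  of \<open>r\<close> palette points gives names to the colours, up to a permutation.

  No clauses state that a cell has only one symbol. A model may exceed the true run, but the only
  clause without a positive literal forbids one output symbol, and a run that avoids this symbol is
  itself a model.\<close>

datatype com = Inc nat | Dec nat | InR | InL | IncBit nat | Emit nat
  | Seq com com (infixr ";;" 60) | Loop nat com | Scan com

type_synonym state = "nat \<times> bool list \<times> (nat \<Rightarrow> nat)"

text \<open>The costs are exact step counts of the compiled code: the 2 in the loop rules pays for
  the test and the jump back. \<open>InL\<close> has no rule at position 0, so no execution takes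
  the input head left of the first cell.\<close>

inductive exec :: "bool list \<Rightarrow> com \<Rightarrow> state \<Rightarrow> nat \<Rightarrow> state \<Rightarrow> bool" for x where
  Inc: "exec x (Inc i) (p, w, s) 1 (p, w, s(i := Suc (s i)))"
| Dec: "exec x (Dec i) (p, w, s) 1 (p, w, s(i := s i - 1))"
| InR: "exec x InR (p, w, s) 1 (Suc p, w, s)"
| InL: "exec x InL (Suc p, w, s) 1 (p, w, s)"
| IncBit: "exec x (IncBit i) (p, w, s) 1
    (p, w, if p < length x \<and> x ! p then s(i := Suc (s i)) else s)"
| Emit: "exec x (Emit i) (p, w, s) 1 (p, w @ [s i \<noteq> 0], s)"
| Seq: "exec x c \<sigma> t \<sigma>' \<Longrightarrow> exec x d \<sigma>' u \<sigma>'' \<Longrightarrow> exec x (c ;; d) \<sigma> (t + u) \<sigma>''"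
| Loop_0: "s i = 0 \<Longrightarrow> exec x (Loop i c) (p, w, s) 1 (p, w, s)"
| Loop_Suc: "s i = Suc m \<Longrightarrow> exec x c (p, w, s(i := m)) t \<sigma> \<Longrightarrow> exec x (Loop i c) \<sigma> u \<sigma>' \<Longrightarrow>
    exec x (Loop i c) (p, w, s) (t + u + 2) \<sigma>'"
| Scan_end: "length x \<le> p \<Longrightarrow> exec x (Scan c) (p, w, s) 1 (p, w, s)"
| Scan_step: "p < length x \<Longrightarrow> exec x c (Suc p, w, s) t \<sigma> \<Longrightarrow> exec x (Scan c) \<sigma> u \<sigma>' \<Longrightarrow>
    exec x (Scan c) (p, w, s) (t + u + 2) \<sigma>'"

fun width :: "com \<Rightarrow> nat" where
  "width (Inc i) = Suc i"
| "width (Dec i) = Suc i"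
| "width InR = 0"
| "width InL = 0"
| "width (IncBit i) = Suc i"
| "width (Emit i) = Suc i"
| "width (c ;; d) = max (width c) (width d)"
| "width (Loop i c) = max (Suc i) (width c)"
| "width (Scan c) = width c"

type_synonym instr = "nat list \<Rightarrow> nat \<times> (nat \<times> int) list"

definition moving :: "nat \<Rightarrow> int \<Rightarrow> nat list \<Rightarrow> (nat \<times> int) list" where
  "moving j d xs = (map (\<lambda>a. (a, 0)) xs)[j := (xs ! j, d)]"

text \<open>Addresses are machine states and jumps are absolute; \<open>a\<close> is the address of
  the first instruction. Counter \<open>i\<close> lives on tape \<open>i + 2\<close>, where scanning
  1 (the mark) means zero. A loop is left at an address 2 beyond the length of its body, because of
  the test and the jump back.\<close>

fun code :: "nat \<Rightarrow> com \<Rightarrow> instr list" where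
  "code a (Inc i) = [\<lambda>xs. (Suc a, moving (i + 2) 1 xs)]"
| "code a (Dec i) = [\<lambda>xs. (Suc a, if xs ! (i + 2) = 1 then moving 0 0 xs else moving (i + 2) (-1) xs)]"
| "code a InR = [\<lambda>xs. (Suc a, moving 0 1 xs)]"
| "code a InL = [\<lambda>xs. (Suc a, moving 0 (-1) xs)]"
| "code a (IncBit i) = [\<lambda>xs. (Suc a, if xs ! 0 = 2 then moving (i + 2) 1 xs else moving 0 0 xs)]"
| "code a (Emit i) = [\<lambda>xs. (Suc a, (moving 0 0 xs)[1 := (if xs ! (i + 2) = 1 then 1 else 2, 1)])]"
| "code a (c ;; d) = code a c @ code (a + length (code a c)) d"
| "code a (Loop i c) =
    [\<lambda>xs. if xs ! (i + 2) = 1 then (a + length (code (Suc a) c) + 2, moving 0 0 xs)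
          else (Suc a, moving (i + 2) (-1) xs)] @ code (Suc a) c @ [\<lambda>xs. (a, moving 0 0 xs)]"
| "code a (Scan c) =
    [\<lambda>xs. if xs ! 0 = 0 then (a + length (code (Suc a) c) + 2, moving 0 0 xs)
          else (Suc a, moving 0 1 xs)] @ code (Suc a) c @ [\<lambda>xs. (a, moving 0 0 xs)]"

text \<open>The value of a counter is the distance of the head of its tape from the only mark on it.\<close>

definition mark :: "int \<Rightarrow> nat" where
  "mark i = (if i = 0 then 1 else 0)"

definition layout :: "nat \<Rightarrow> bool list \<Rightarrow> state \<Rightarrow> tape list" where
  "layout K x \<sigma> = (case \<sigma> of (p, w, s) \<Rightarrow>
     (contents x, int p) # (contents w, int (length w)) # map (\<lambda>i. (mark, int (s i))) [0..<K])"

definition machine :: "nat \<Rightarrow> instr list \<Rightarrow> tm" where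
  "machine K P = \<lparr>tapes = K + 2, states = length P, symbols = 3, trans = (!) P\<rparr>"

lemma length_layout [simp]: "length (layout K x \<sigma>) = K + 2"
  by (auto simp: layout_def split: prod.split)

lemma layout_nth [simp]:
  "layout K x (p, w, s) ! 0 = (contents x, int p)"
  "layout K x (p, w, s) ! Suc 0 = (contents w, int (length w))"
  "i < K \<Longrightarrow> layout K x (p, w, s) ! Suc (Suc i) = (mark, int (s i))"
  by (auto simp: layout_def)

lemma tapes_machine: "tapes (machine K P) = K + 2"
  by (simp add: machine_def)

lemma step_machine:
  "q < length P \<Longrightarrow>
   step (machine K P) (q, ts) = (fst ((P ! q) (map scanned ts)), map2 act ts (snd ((P ! q) (map scanned ts))))"
  by (auto simp: step_def machine_def split: prod.split)

lemma map2_act_moving: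
  "j < length ts \<Longrightarrow> map2 act ts (moving j d (map scanned ts)) = ts[j := (fst (ts ! j), snd (ts ! j) + d)]"
  by (rule nth_equalityI) (auto simp: moving_def act_def scanned_def nth_list_update)

lemma map2_act_update:
  "length as = length ts \<Longrightarrow> j < length ts \<Longrightarrow> map2 act ts (as[j := a]) = (map2 act ts as)[j := act (ts ! j) a]"
  by (rule nth_equalityI) (auto simp: nth_list_update)

lemma map2_act_moving_0:
  "ts \<noteq> [] \<Longrightarrow> map2 act ts (moving 0 0 (map scanned ts)) = ts"
  by (subst map2_act_moving) auto

lemma length_moving [simp]: "length (moving j d xs) = length xs"
  by (simp add: moving_def)

lemma contents_snoc: "(contents w)(int (length w) := if b then 2 else 1) = contents (w @ [b])"
  by (rule ext) (auto simp: contents_def nth_append)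

lemma scanned_pair [simp]:
  "scanned (contents x, i) = contents x i"
  "scanned (mark, int n) = (if n = 0 then 1 else 0)"
  "scanned (mark, 0) = 1"
  "scanned (mark, 1 + int n) = 0"
  by (auto simp: scanned_def mark_def)

lemma layout_nonempty [simp]: "layout K x \<sigma> \<noteq> []"
  by (metis add_is_0 length_0_conv length_layout zero_neq_numeral)

lemma contents_bit: "contents x (int p) = 2 \<longleftrightarrow> p < length x \<and> x ! p"
  "contents x (int p) = 0 \<longleftrightarrow> length x \<le> p"
  by (auto simp: contents_def)

lemma act_layout_stay:
  "map2 act (layout K x \<sigma>) (moving 0 0 (map scanned (layout K x \<sigma>))) = layout K x \<sigma>"
  by (rule map2_act_moving_0) simp

lemma act_layout_input:
  assumes "int q = int p + d"
  shows "map2 act (layout K x (p, w, s)) (moving 0 d (map scanned (layout K x (p, w, s)))) = layout K x (q, w, s)"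
  using assms by (subst map2_act_moving) (auto simp: layout_def)

lemma act_layout_counter:
  assumes "i < K" "int m = int (s i) + d"
  shows "map2 act (layout K x (p, w, s)) (moving (Suc (Suc i)) d (map scanned (layout K x (p, w, s))))
    = layout K x (p, w, s(i := m))"
proof -
  have "(layout K x (p, w, s))[Suc (Suc i) := (mark, int m)] = layout K x (p, w, s(i := m))"
    using assms(1) by (auto simp: layout_def nth_list_update intro!: nth_equalityI)
  then show ?thesis using assms by (subst map2_act_moving) auto
qed

lemma act_layout_output:
  "map2 act (layout K x (p, w, s)) ((moving 0 0 (map scanned (layout K x (p, w, s))))[Suc 0 := (if b then 2 else 1, 1)])
    = layout K x (p, w @ [b], s)"
proof -
  have "(layout K x (p, w, s))[Suc 0 := (contents (w @ [b]), int (length w) + 1)] = layout K x (p, w @ [b], s)"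
    by (simp add: layout_def)
  then show ?thesis
    by (subst map2_act_update) (auto simp: act_layout_stay act_def contents_snoc[symmetric])
qed

fun loaded :: "instr list \<Rightarrow> nat \<Rightarrow> instr list \<Rightarrow> bool" where
  "loaded P a [] \<longleftrightarrow> True"
| "loaded P a (f # fs) \<longleftrightarrow> a < length P \<and> P ! a = f \<and> loaded P (Suc a) fs"

lemma loaded_append [simp]: "loaded P a (fs @ gs) \<longleftrightarrow> loaded P a fs \<and> loaded P (a + length fs) gs"
  by (induction fs arbitrary: a) auto

lemma loaded_suffix: "loaded (fs @ gs) (length fs) gs"
proof (induction gs arbitrary: fs)
  case (Cons g gs)
  show ?case using Cons[of "fs @ [g]"] by simp
qed simp

text \<open>Code occupies consecutive addresses and is left only at its end, so the simulations of
  the parts compose by adding step counts.\<close>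

lemma exec_simulation:
  assumes "exec x c \<sigma> t \<sigma>'" and "width c \<le> K" and "loaded P a (code a c)"
  shows "(step (machine K P) ^^ t) (a, layout K x \<sigma>) = (a + length (code a c), layout K x \<sigma>')"
  using assms
proof (induction arbitrary: a rule: exec.induct)
  case (Inc i p w s)
  then show ?case
    by (simp add: step_machine act_layout_counter[where m = "Suc (s i)"])
next
  case (Dec i p w s)
  then show ?case
    using act_layout_counter[of i K "s i - 1" s "-1" x p w] act_layout_stay[of K x "(p, w, s)"]
    by (auto simp add: step_machine of_nat_diff fun_upd_idem)
next
  case (InR p w s)
  then show ?case
    using act_layout_input[of "Suc p" p 1 K x w s] by (simp add: step_machine)
next
  case (InL p w s)
  then show ?case
    using act_layout_input[of p "Suc p" "-1" K x w s] by (simp add: step_machine)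
next
  case (IncBit i p w s)
  then show ?case
    using act_layout_counter[of i K "Suc (s i)" s 1 x p w] act_layout_stay[of K x "(p, w, s)"]
    by (auto simp add: step_machine contents_bit)
next
  case (Emit i p w s)
  then show ?case
    using act_layout_output[of K x p w s "s i \<noteq> 0"] by (auto simp add: step_machine)
next
  case (Seq c \<sigma> t \<sigma>' d u \<sigma>'')
  then show ?case by (simp add: add.commute[of t] funpow_add add.assoc)
next
  case (Loop_0 s i c p w)
  then show ?case
    by (simp add: step_machine act_layout_stay)
next
  case (Loop_Suc s i m c p w t \<sigma> u \<sigma>')
  \<comment> \<open>\<open>?e\<close> is the address of the closing jump. The four facts below are
    the test, the body, the jump and the remaining rounds.\<close>
  let ?S = "step (machine K P)" and ?e = "Suc (a + length (code (Suc a) c))"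
  have "?S (a, layout K x (p, w, s)) = (Suc a, layout K x (p, w, s(i := m)))"
    using Loop_Suc.prems Loop_Suc.hyps act_layout_counter[of i K m s "-1" x p w]
    by (simp add: step_machine)
  moreover have "(?S ^^ t) (Suc a, layout K x (p, w, s(i := m))) = (?e, layout K x \<sigma>)"
    using Loop_Suc.prems Loop_Suc.IH(1) by simp
  moreover have "?S (?e, layout K x \<sigma>) = (a, layout K x \<sigma>)"
    using Loop_Suc.prems by (simp add: step_machine act_layout_stay)
  moreover have "(?S ^^ u) (a, layout K x \<sigma>) = (a + length (code a (Loop i c)), layout K x \<sigma>')"
    using Loop_Suc.prems by (intro Loop_Suc.IH(2)) auto
  moreover have "t + u + 2 = u + (1 + (t + 1))" by simp
  ultimately show ?case by (simp only: funpow_add) simp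
next
  case (Scan_end p c w s)
  then show ?case
    by (simp add: step_machine act_layout_stay contents_bit)
next
  case (Scan_step p c w s t \<sigma> u \<sigma>')
  let ?S = "step (machine K P)" and ?e = "Suc (a + length (code (Suc a) c))"
  have "?S (a, layout K x (p, w, s)) = (Suc a, layout K x (Suc p, w, s))"
    using Scan_step.prems Scan_step.hyps act_layout_input[of "Suc p" p 1 K x w s]
    by (simp add: step_machine contents_bit)
  moreover have "(?S ^^ t) (Suc a, layout K x (Suc p, w, s)) = (?e, layout K x \<sigma>)"
    using Scan_step.prems Scan_step.IH(1) by simp
  moreover have "?S (?e, layout K x \<sigma>) = (a, layout K x \<sigma>)"
    using Scan_step.prems by (simp add: step_machine act_layout_stay)
  moreover have "(?S ^^ u) (a, layout K x \<sigma>) = (a + length (code a (Scan c)), layout K x \<sigma>')"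
    using Scan_step.prems by (intro Scan_step.IH(2)) auto
  moreover have "t + u + 2 = u + (1 + (t + 1))" by simp
  ultimately show ?case by (simp only: funpow_add) simp
qed

section \<open>Well-formedness of the compiled machine\<close>

definition good_instr :: "nat \<Rightarrow> nat \<Rightarrow> instr \<Rightarrow> bool" where
  "good_instr K b f \<longleftrightarrow> (\<forall>xs. length xs = K + 2 \<and> set xs \<subseteq> {..<3} \<longrightarrow>
     fst (f xs) \<le> b \<and> length (snd (f xs)) = K + 2 \<and> set (snd (f xs)) \<subseteq> {..<3} \<times> {-1, 0, 1})"

lemma set_moving:
  assumes "set xs \<subseteq> {..<3}" "j < length xs" "d \<in> {-1, 0, 1}"
  shows "set (moving j d xs) \<subseteq> {..<3} \<times> {-1, 0, 1}"
proof -
  have "xs ! j < 3" using assms by force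
  then show ?thesis
    using assms unfolding moving_def by (intro order.trans[OF set_update_subset_insert]) auto
qed

lemma good_moving:
  assumes "\<And>xs. f xs = (q xs, moving (j xs) (d xs) xs)" "\<And>xs. q xs \<le> b" "\<And>xs. j xs < K + 2"
    "\<And>xs. d xs \<in> {-1, 0, 1}"
  shows "good_instr K b f"
  unfolding good_instr_def
proof (intro allI impI)
  fix xs :: "nat list" assume xs: "length xs = K + 2 \<and> set xs \<subseteq> {..<3}"
  then have "set (moving (j xs) (d xs) xs) \<subseteq> {..<3} \<times> {-1, 0, 1}"
    by (intro set_moving assms(4)) (use assms(3) in auto)
  with xs show "fst (f xs) \<le> b \<and> length (snd (f xs)) = K + 2 \<and> set (snd (f xs)) \<subseteq> {..<3} \<times> {-1, 0, 1}"
    by (simp add: assms(1,2))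
qed

lemma good_code:
  "width c \<le> K \<Longrightarrow> a + length (code a c) \<le> b \<Longrightarrow> f \<in> set (code a c) \<Longrightarrow> good_instr K b f"
proof (induction c arbitrary: a f)
  case (Emit i)
  show ?case unfolding good_instr_def
  proof (intro allI impI)
    fix xs :: "nat list" assume xs: "length xs = K + 2 \<and> set xs \<subseteq> {..<3}"
    let ?a = "(if xs ! (i + 2) = 1 then 1 else 2, 1)"
    have "set ((moving 0 0 xs)[1 := ?a]) \<subseteq> insert ?a (set (moving 0 0 xs))"
      by (rule set_update_subset_insert)
    also have "\<dots> \<subseteq> {..<3} \<times> {-1, 0, 1}"
      using set_moving[of xs 0 0] xs by auto
    finally show "fst (f xs) \<le> b \<and> length (snd (f xs)) = K + 2 \<and> set (snd (f xs)) \<subseteq> {..<3} \<times> {-1, 0, 1}"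
      using Emit xs by simp
  qed
next
  case (Loop i c)
  then consider "f = hd (code a (Loop i c))" | "f \<in> set (code (Suc a) c)" | "f = (\<lambda>xs. (a, moving 0 0 xs))"
    by auto
  then show ?case
  proof cases
    case 1
    then show ?thesis using Loop.prems
      by (intro good_moving[where q = "\<lambda>xs. if xs ! (i + 2) = 1 then a + length (code (Suc a) c) + 2 else Suc a"
           and j = "\<lambda>xs. if xs ! (i + 2) = 1 then 0 else i + 2" and d = "\<lambda>xs. if xs ! (i + 2) = 1 then 0 else -1"]) auto
  next
    case 2
    then show ?thesis using Loop.prems by (intro Loop.IH[of "Suc a"]) auto
  next
    case 3
    then show ?thesis using Loop.prems by (intro good_moving[where q = "\<lambda>_. a" and j = "\<lambda>_. 0" and d = "\<lambda>_. 0"]) auto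
  qed
next
  case (Scan c)
  then consider "f = hd (code a (Scan c))" | "f \<in> set (code (Suc a) c)" | "f = (\<lambda>xs. (a, moving 0 0 xs))"
    by auto
  then show ?case
  proof cases
    case 1
    then show ?thesis using Scan.prems
      by (intro good_moving[where q = "\<lambda>xs. if xs ! 0 = 0 then a + length (code (Suc a) c) + 2 else Suc a"
           and j = "\<lambda>_. 0" and d = "\<lambda>xs. if xs ! 0 = 0 then 0 else 1"]) auto
  next
    case 2
    then show ?thesis using Scan.prems by (intro Scan.IH[of "Suc a"]) auto
  next
    case 3
    then show ?thesis using Scan.prems by (intro good_moving[where q = "\<lambda>_. a" and j = "\<lambda>_. 0" and d = "\<lambda>_. 0"]) auto
  qed
next
  case (Seq c d)
  then show ?case using Seq.IH(1)[of a f] Seq.IH(2)[of "a + length (code a c)" f] by auto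
next
  case (Inc i)
  then show ?case by (intro good_moving[where q = "\<lambda>_. Suc a" and j = "\<lambda>_. i + 2" and d = "\<lambda>_. 1"]) auto
next
  case (Dec i)
  then show ?case by (intro good_moving[where q = "\<lambda>_. Suc a" and j = "\<lambda>xs. if xs ! (i + 2) = 1 then 0 else i + 2"
        and d = "\<lambda>xs. if xs ! (i + 2) = 1 then 0 else -1"]) auto
next
  case InR
  then show ?case by (intro good_moving[where q = "\<lambda>_. Suc a" and j = "\<lambda>_. 0" and d = "\<lambda>_. 1"]) auto
next
  case InL
  then show ?case by (intro good_moving[where q = "\<lambda>_. Suc a" and j = "\<lambda>_. 0" and d = "\<lambda>_. -1"]) auto
next
  case (IncBit i)
  then show ?case by (intro good_moving[where q = "\<lambda>_. Suc a" and j = "\<lambda>xs. if xs ! 0 = 2 then i + 2 else 0"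
        and d = "\<lambda>xs. if xs ! 0 = 2 then 1 else 0"]) auto
qed

section \<open>From program executions to polynomial time\<close>

lemma step_halted: "states M \<le> q \<Longrightarrow> (step M ^^ n) (q, ts) = (q, ts)"
  by (induction n) (simp_all add: step_def)

lemma step_halted_mono:
  assumes "(step M ^^ t) c = (q, ts)" "states M \<le> q" "t \<le> u"
  shows "(step M ^^ u) c = (q, ts)"
proof -
  have "(step M ^^ u) c = (step M ^^ ((u - t) + t)) c" using assms(3) by simp
  also have "\<dots> = (q, ts)" using assms(1,2) by (simp only: funpow_add comp_apply step_halted)
  finally show ?thesis .
qed

lemma exec_polytime:
  fixes p :: "nat poly"
  assumes "\<And>x. \<exists>t \<sigma>. exec x c (0, [], \<lambda>_. 0) t \<sigma> \<and> t \<le> poly p (length x) \<and> fst (snd \<sigma>) = f x"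
  shows "polytime f"
proof -
  define K where "K = width c"
  \<comment> \<open>The counter tapes start blank, but the layout needs a mark at cell 0 of each.
    This extra instruction writes the marks and accounts for the \<open>+ 1\<close> in the time
    bound.\<close>
  define prep :: instr where
    "prep = (\<lambda>xs. (1, (xs ! 0, 0) # (0, 0) # replicate K (1, 0)))"
  define P where "P = prep # code 1 c"
  let ?M = "machine K P"
  have good: "good_instr K (length P) f" if "f \<in> set P" for f
  proof -
    consider "f = prep" | "f \<in> set (code 1 c)" using \<open>f \<in> set P\<close> by (auto simp: P_def)
    then show ?thesis
    proof cases
      case 1
      have "xs ! 0 < 3" if "length xs = K + 2" "set xs \<subseteq> {..<3}" for xs :: "nat list"
      proof -
        have "xs ! 0 \<in> set xs" using that(1) by simp
        with that(2) show ?thesis by blast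
      qed
      with 1 show ?thesis by (auto simp: good_instr_def prep_def P_def)
    next
      case 2
      then show ?thesis by (intro good_code[of c K 1]) (auto simp: K_def P_def)
    qed
  qed
  have "wf_tm ?M"
    unfolding wf_tm_def
  proof (intro conjI allI impI)
    fix q xs assume "q < states ?M" and xs: "length xs = tapes ?M \<and> set xs \<subseteq> {..<symbols ?M}"
    then have "good_instr K (length P) (P ! q)" by (intro good) (auto simp: machine_def)
    with xs show "case trans ?M q xs of (q', acts) \<Rightarrow>
        q' \<le> states ?M \<and> length acts = tapes ?M \<and> set acts \<subseteq> {..<symbols ?M} \<times> {-1, 0, 1}"
      by (simp add: machine_def good_instr_def case_prod_beta')
  qed (auto simp: machine_def)
  moreover have "computes_in_time ?M f (poly (p + 1))"
    unfolding computes_in_time_def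
  proof
    fix x
    obtain t \<sigma> where t: "exec x c (0, [], \<lambda>_. 0) t \<sigma>" "t \<le> poly p (length x)" "fst (snd \<sigma>) = f x"
      using assms by blast
    have "map (\<lambda>i. (mark, int 0)) [0..<K] = map2 act (replicate K (contents [], 0)) (replicate K (1, 0))"
      by (auto simp: act_def mark_def contents_def fun_eq_iff intro!: nth_equalityI)
    then have "step ?M (init ?M x) = (1, layout K x (0, [], \<lambda>_. 0))"
      by (simp add: init_def step_machine P_def prep_def tapes_machine layout_def act_def scanned_def)
        (simp add: fun_eq_iff contents_def)
    moreover have "(step ?M ^^ t) (1, layout K x (0, [], \<lambda>_. 0)) = (length P, layout K x \<sigma>)"
      using exec_simulation[OF t(1), of K P 1] loaded_suffix[of "[prep]" "code 1 c"] by (simp add: P_def K_def)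
    ultimately have "(step ?M ^^ (t + 1)) (init ?M x) = (length P, layout K x \<sigma>)"
      by (simp add: funpow_Suc_right del: funpow.simps)
    then have "(step ?M ^^ poly (p + 1) (length x)) (init ?M x) = (length P, layout K x \<sigma>)"
      by (rule step_halted_mono) (use t(2) in \<open>auto simp: machine_def\<close>)
    then show "case (step ?M ^^ poly (p + 1) (length x)) (init ?M x) of (q, ts) \<Rightarrow>
        q = states ?M \<and> fst (ts ! 1) = contents (f x)"
      using t(3) by (auto simp: machine_def layout_def split: prod.splits)
  qed
  ultimately show ?thesis unfolding polytime_def by blast
qed

section \<open>Polynomial-time computable functions on counters\<close>

lemma poly_nat_mono: "a \<le> b \<Longrightarrow> poly p a \<le> poly p (b :: nat)"
  by (induction p) (auto intro!: add_mono mult_mono)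

definition exec_within :: "bool list \<Rightarrow> com \<Rightarrow> state \<Rightarrow> nat \<Rightarrow> state \<Rightarrow> bool" where
  "exec_within x c \<sigma> T \<sigma>' \<longleftrightarrow> (\<exists>t\<le>T. exec x c \<sigma> t \<sigma>')"

lemma within_mono: "exec_within x c \<sigma> T \<sigma>' \<Longrightarrow> T \<le> U \<Longrightarrow> exec_within x c \<sigma> U \<sigma>'"
  unfolding exec_within_def by (meson order.trans)

lemma within_Seq:
  "exec_within x c \<sigma> T \<sigma>' \<Longrightarrow> exec_within x d \<sigma>' U \<sigma>'' \<Longrightarrow> exec_within x (c ;; d) \<sigma> (T + U) \<sigma>''"
  unfolding exec_within_def by (meson Seq add_mono)

lemma within_Inc: "s' = s(i := Suc (s i)) \<Longrightarrow> exec_within x (Inc i) (p, w, s) 1 (p, w, s')"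
  unfolding exec_within_def using Inc by blast

lemma within_Inc_Inc:
  "s' = (s(i := Suc (s i)))(j := Suc ((s(i := Suc (s i))) j)) \<Longrightarrow>
    exec_within x (Inc i ;; Inc j) (p, w, s) (1 + 1) (p, w, s')"
  by (rule within_Seq[OF within_Inc within_Inc]) auto

lemma within_Dec: "s' = s(i := s i - 1) \<Longrightarrow> exec_within x (Dec i) (p, w, s) 1 (p, w, s')"
  unfolding exec_within_def using Dec by blast

lemma within_InR: "exec_within x InR (p, w, s) 1 (Suc p, w, s)"
  unfolding exec_within_def using InR by blast

lemma within_InL: "exec_within x InL (Suc p, w, s) 1 (p, w, s)"
  unfolding exec_within_def using InL by blast

lemma within_IncBit:
  "exec_within x (IncBit i) (p, w, s) 1 (p, w, s(i := s i + of_bool (p < length x \<and> x ! p)))"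
  unfolding exec_within_def using IncBit[of x i p w s] by (auto simp: fun_upd_idem split: if_splits)

lemma within_Emit: "exec_within x (Emit i) (p, w, s) 1 (p, w @ [s i \<noteq> 0], s)"
  unfolding exec_within_def using Emit by blast

text \<open>\<open>P\<close>, \<open>W\<close> and \<open>S\<close> give the state after
  \<open>j\<close> rounds. The test has already decremented counter \<open>i\<close> when the body
  starts, hence the update in the first assumption. The induction counts the rounds that
  remain.\<close>

lemma within_Loop:
  assumes "\<And>j. j < n \<Longrightarrow> exec_within x c (P j, W j, (S j)(i := n - Suc j)) T (P (Suc j), W (Suc j), S (Suc j))"
    and "\<And>j. j \<le> n \<Longrightarrow> S j i = n - j"
  shows "exec_within x (Loop i c) (P 0, W 0, S 0) (n * (T + 2) + 1) (P n, W n, S n)"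
proof -
  have "exec_within x (Loop i c) (P (n - k), W (n - k), S (n - k)) (k * (T + 2) + 1) (P n, W n, S n)"
    if "k \<le> n" for k
    using that
  proof (induction k)
    case 0
    then show ?case using Loop_0[of "S n" i x c "P n" "W n"] assms(2)[of n] by (auto simp: exec_within_def)
  next
    case (Suc k)
    let ?j = "n - Suc k"
    have j: "Suc ?j = n - k" "?j < n" using Suc.prems by auto
    obtain t where t: "t \<le> T" "exec x c (P ?j, W ?j, (S ?j)(i := k)) t (P (n - k), W (n - k), S (n - k))"
      using assms(1)[OF j(2)] j Suc.prems unfolding exec_within_def by auto
    obtain u where u: "u \<le> k * (T + 2) + 1" "exec x (Loop i c) (P (n - k), W (n - k), S (n - k)) u (P n, W n, S n)"
      using Suc unfolding exec_within_def by auto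
    have "S ?j i = Suc k" using assms(2)[of ?j] Suc.prems by simp
    then have "exec x (Loop i c) (P ?j, W ?j, S ?j) (t + u + 2) (P n, W n, S n)"
      using t(2) u(2) by (rule Loop_Suc)
    then show ?case unfolding exec_within_def using t(1) u(1) by (intro exI[of _ "t + u + 2"]) simp
  qed
  from this[of n] show ?thesis by simp
qed

section \<open>Routines on counters and on the input head\<close>

lemma within_move:
  assumes "i \<noteq> j" "s' = s(i := 0, j := s j + s i)"
  shows "exec_within x (Loop i (Inc j)) (p, w, s) (3 * s i + 1) (p, w, s')"
proof -
  have "exec_within x (Loop i (Inc j)) (p, w, s(i := s i - 0, j := s j + 0)) (s i * (1 + 2) + 1)
      (p, w, s(i := s i - s i, j := s j + s i))"
    using assms(1) by (intro within_Loop[where P = "\<lambda>_. p" and W = "\<lambda>_. w" and S = "\<lambda>k. s(i := s i - k, j := s j + k)"] within_Inc) auto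
  then show ?thesis using assms(2) by (auto elim!: within_mono)
qed

text \<open>A loop can read a counter only by emptying it, so the value is duplicated and then
  restored from the scratch counter \<open>k\<close>.\<close>

lemma within_copy:
  assumes "i \<noteq> j" "i \<noteq> k" "j \<noteq> k" "s k = 0" "s' = s(j := s j + s i)"
  shows "exec_within x (Loop i (Inc j ;; Inc k) ;; Loop k (Inc i)) (p, w, s) (7 * s i + 2) (p, w, s')"
proof -
  let ?S = "\<lambda>m. s(i := s i - m, j := s j + m, k := m)"
  have "exec_within x (Loop i (Inc j ;; Inc k)) (p, w, ?S 0) (s i * (1 + 1 + 2) + 1) (p, w, ?S (s i))"
    using assms(1-3) by (intro within_Loop[where P = "\<lambda>_. p" and W = "\<lambda>_. w" and S = ?S] within_Inc_Inc) auto
  moreover have "?S 0 = s" using assms by auto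
  ultimately have "exec_within x (Loop i (Inc j ;; Inc k)) (p, w, s) (4 * s i + 1) (p, w, ?S (s i))"
    by (auto elim!: within_mono)
  moreover have "exec_within x (Loop k (Inc i)) (p, w, ?S (s i)) (3 * ?S (s i) k + 1) (p, w, s')"
    using assms by (intro within_move) auto
  ultimately show ?thesis by (rule within_mono[OF within_Seq]) simp
qed

lemma within_truncated_sub:
  assumes "i \<noteq> j" "s' = s(i := 0, j := s j - s i)"
  shows "exec_within x (Loop i (Dec j)) (p, w, s) (3 * s i + 1) (p, w, s')"
proof -
  have "exec_within x (Loop i (Dec j)) (p, w, s(i := s i - 0, j := s j - 0)) (s i * (1 + 2) + 1)
      (p, w, s(i := s i - s i, j := s j - s i))"
    using assms(1) by (intro within_Loop[where P = "\<lambda>_. p" and W = "\<lambda>_. w" and S = "\<lambda>k. s(i := s i - k, j := s j - k)"] within_Dec) auto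
  then show ?thesis using assms(2) by (auto elim!: within_mono)
qed

lemma within_clear:
  assumes "i \<noteq> j" "s j = 0" "s' = s(i := 0)"
  shows "exec_within x (Loop i (Dec j)) (p, w, s) (3 * s i + 1) (p, w, s')"
  using assms by (intro within_truncated_sub) auto

text \<open>No command detects the left end of the input; the head returns because a counter has
  recorded its position.\<close>

lemma within_rewind:
  assumes "p = s i" "s' = s(i := 0)"
  shows "exec_within x (Loop i InL) (p, w, s) (3 * p + 1) (0, w, s')"
proof -
  have "exec_within x (Loop i InL) (p - 0, w, s(i := p - 0)) (p * (1 + 2) + 1) (p - p, w, s(i := p - p))"
  proof (intro within_Loop[where P = "\<lambda>k. p - k" and W = "\<lambda>_. w" and S = "\<lambda>k. s(i := p - k)"])
    fix j assume "j < p"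
    then have "p - j = Suc (p - Suc j)" by simp
    then show "exec_within x InL (p - j, w, (s(i := p - j))(i := p - Suc j)) 1 (p - Suc j, w, s(i := p - Suc j))"
      using within_InL[of x "p - Suc j"] by simp
  qed auto
  moreover have "s(i := p) = s" using assms(1) by auto
  ultimately show ?thesis using assms(2) by (auto elim!: within_mono)
qed

lemma within_forward:
  assumes "i \<noteq> j" "s' = s(i := 0, j := s j + s i)"
  shows "exec_within x (Loop i (InR ;; Inc j)) (0, w, s) (4 * s i + 1) (s i, w, s')"
proof -
  have "exec_within x (Loop i (InR ;; Inc j)) (0, w, s(i := s i - 0, j := s j + 0)) (s i * (1 + 1 + 2) + 1)
      (s i, w, s(i := s i - s i, j := s j + s i))"
    using assms(1) by (intro within_Loop[where P = "\<lambda>k. k" and W = "\<lambda>_. w" and S = "\<lambda>k. s(i := s i - k, j := s j + k)"]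
      within_Seq[OF within_InR] within_Inc) auto
  then show ?thesis using assms(2) by (auto elim!: within_mono)
qed

lemma within_scan:
  assumes "i \<noteq> j" "s' = s(i := s i + length x, j := s j + length x)"
  shows "exec_within x (Scan (Inc i ;; Inc j)) (0, w, s) (4 * length x + 1) (length x, w, s')"
proof -
  let ?S = "\<lambda>k. s(i := s i + k, j := s j + k)"
  have "exec_within x (Scan (Inc i ;; Inc j)) (length x - k, w, ?S (length x - k)) (4 * k + 1) (length x, w, ?S (length x))"
    if "k \<le> length x" for k
    using that
  proof (induction k)
    case 0
    then show ?case using Scan_end[of x "length x"] unfolding exec_within_def by auto
  next
    case (Suc k)
    let ?j = "length x - Suc k"
    have j: "Suc ?j = length x - k" "?j < length x" using Suc.prems by auto
    have "exec x (Inc i ;; Inc j) (length x - k, w, ?S ?j) (1 + 1) (length x - k, w, (?S ?j)(i := Suc (?S ?j i), j := Suc (((?S ?j)(i := Suc (?S ?j i))) j)))"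
      by (rule Seq[OF Inc Inc])
    moreover have "(?S ?j)(i := Suc (?S ?j i), j := Suc (((?S ?j)(i := Suc (?S ?j i))) j)) = ?S (length x - k)"
      using assms(1) j(1) by (auto simp del: Suc_diff_Suc simp flip: j(1))
    moreover obtain u where u: "u \<le> 4 * k + 1" "exec x (Scan (Inc i ;; Inc j)) (length x - k, w, ?S (length x - k)) u (length x, w, ?S (length x))"
      using Suc unfolding exec_within_def by auto
    ultimately have "exec x (Scan (Inc i ;; Inc j)) (?j, w, ?S ?j) (1 + 1 + u + 2) (length x, w, ?S (length x))"
      using j by (intro Scan_step) auto
    then show ?case unfolding exec_within_def using u(1) by (intro exI[of _ "1 + 1 + u + 2"]) simp
  qed
  from this[of "length x"] show ?thesis using assms by simp
qed

text \<open>
  The value of \<open>f\<close> is added to counter \<open>d\<close>.  Variable \<open>i\<close> of \<open>f\<close> resides in counter \<open>loc i\<close>, and the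
  counters above \<open>d\<close> are scratch space, zero before and after.  Since \<open>loc\<close> need not be injective and
  is arbitrary in the notion of computability, variables can be renamed for free.
\<close>

definition adds :: "(bool list \<Rightarrow> (nat \<Rightarrow> nat) \<Rightarrow> nat) \<Rightarrow> nat \<Rightarrow> (nat \<Rightarrow> nat) \<Rightarrow> com \<Rightarrow> nat poly \<Rightarrow> bool" where
  "adds f d loc c p \<longleftrightarrow> (\<forall>x w s N. (\<forall>i>d. s i = 0) \<longrightarrow> length x \<le> N \<longrightarrow> (\<forall>i. s (loc i) \<le> N) \<longrightarrow>
     f x (\<lambda>i. s (loc i)) \<le> poly p N \<and>
     exec_within x c (0, w, s) (poly p N) (0, w, s(d := s d + f x (\<lambda>i. s (loc i)))))"

definition computable :: "(bool list \<Rightarrow> (nat \<Rightarrow> nat) \<Rightarrow> nat) \<Rightarrow> bool" where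
  "computable f \<longleftrightarrow> (\<forall>d loc. (\<forall>i. loc i < d) \<longrightarrow> (\<exists>c p. adds f d loc c p))"

lemma computableI:
  assumes "\<And>d loc. (\<And>i. loc i < d) \<Longrightarrow> \<exists>c p. adds f d loc c p"
  shows "computable f"
  using assms unfolding computable_def by blast

lemma computableE:
  assumes "computable f" "\<And>i. loc i < d"
  obtains c p where "adds f d loc c p"
  using assms unfolding computable_def by blast

lemma addsI:
  assumes "\<And>x w s N. (\<And>i. i > d \<Longrightarrow> s i = 0) \<Longrightarrow> length x \<le> N \<Longrightarrow> (\<And>i. s (loc i) \<le> N) \<Longrightarrow>
     f x (\<lambda>i. s (loc i)) \<le> poly p N \<and>
     exec_within x c (0, w, s) (poly p N) (0, w, s(d := s d + f x (\<lambda>i. s (loc i))))"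
  shows "adds f d loc c p"
  using assms unfolding adds_def by blast

lemma addsD:
  assumes "adds f d loc c p" "\<And>i. i > d \<Longrightarrow> s i = 0" "length x \<le> N" "\<And>i. s (loc i) \<le> N"
  shows "f x (\<lambda>i. s (loc i)) \<le> poly p N"
    "s' = s(d := s d + f x (\<lambda>i. s (loc i))) \<Longrightarrow> exec_within x c (0, w, s) (poly p N) (0, w, s')"
  using assms unfolding adds_def by blast+

section \<open>Variables, arithmetic, sums and input bits\<close>

lemma computable_var: "computable (\<lambda>x s. s k)"
proof (rule computableI, intro exI, rule addsI, rule conjI)
  fix d :: nat and loc :: "nat \<Rightarrow> nat" and x :: "bool list" and w and s :: "nat \<Rightarrow> nat" and N :: nat
  assume loc: "\<And>i. loc i < d" and s: "\<And>i. i > d \<Longrightarrow> s i = 0" and N: "\<And>i. s (loc i) \<le> N"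
  show "s (loc k) \<le> poly [:2, 7:] N" using N[of k] by simp
  show "exec_within x (Loop (loc k) (Inc d ;; Inc (Suc d)) ;; Loop (Suc d) (Inc (loc k)))
      (0, w, s) (poly [:2, 7:] N) (0, w, s(d := s d + s (loc k)))"
    using loc[of k] s N[of k] by (intro within_mono[OF within_copy]) auto
qed

lemma computable_zero: "computable (\<lambda>x s. 0)"
proof (rule computableI, intro exI, rule addsI, rule conjI)
  fix d :: nat and loc :: "nat \<Rightarrow> nat" and x :: "bool list" and w and s :: "nat \<Rightarrow> nat" and N :: nat
  assume loc: "\<And>i. loc i < d" and s: "\<And>i. i > d \<Longrightarrow> s i = 0"
  show "0 \<le> poly [:1:] N" by simp
  show "exec_within x (Dec (Suc d)) (0, w, s) (poly [:1:] N) (0, w, s(d := s d + 0))"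
    using s[of "Suc d"] by (intro within_mono[OF within_Dec]) auto
qed

lemma computable_one: "computable (\<lambda>x s. 1)"
proof (rule computableI, intro exI, rule addsI, rule conjI)
  fix d :: nat and loc :: "nat \<Rightarrow> nat" and x :: "bool list" and w and s :: "nat \<Rightarrow> nat" and N :: nat
  show "1 \<le> poly [:1:] N" by simp
  show "exec_within x (Inc d) (0, w, s) (poly [:1:] N) (0, w, s(d := s d + 1))"
    by (intro within_mono[OF within_Inc]) auto
qed

lemma computable_add:
  assumes "computable f" "computable g"
  shows "computable (\<lambda>x s. f x s + g x s)"
proof (rule computableI)
  fix d loc assume loc: "\<And>i :: nat. loc i < (d :: nat)"
  have neq: "loc i \<noteq> d" for i using loc[of i] by simp
  obtain c1 p1 where 1: "adds f d loc c1 p1" using computableE[OF assms(1) loc] .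
  obtain c2 p2 where 2: "adds g d loc c2 p2" using computableE[OF assms(2) loc] .
  have "adds (\<lambda>x s. f x s + g x s) d loc (c1 ;; c2) (p1 + p2)"
  proof (rule addsI)
    fix x :: "bool list" and w and s :: "nat \<Rightarrow> nat" and N :: nat
    assume s: "\<And>i. i > d \<Longrightarrow> s i = 0" and N: "length x \<le> N" "\<And>i. s (loc i) \<le> N"
    let ?F = "f x (\<lambda>i. s (loc i))" and ?G = "g x (\<lambda>i. s (loc i))"
    let ?s = "s(d := s d + ?F)"
    have "exec_within x c1 (0, w, s) (poly p1 N) (0, w, ?s)"
      using s N by (intro addsD(2)[OF 1]) auto
    moreover have "exec_within x c2 (0, w, ?s) (poly p2 N) (0, w, s(d := s d + (?F + ?G)))"
      using s N by (intro addsD(2)[OF 2]) (auto simp: neq)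
    ultimately have "exec_within x (c1 ;; c2) (0, w, s) (poly (p1 + p2) N) (0, w, s(d := s d + (?F + ?G)))"
      by (auto dest: within_Seq)
    moreover have "?F + ?G \<le> poly (p1 + p2) N"
      using s N addsD(1)[OF 1, of s x N] addsD(1)[OF 2, of s x N] by (simp add: add_mono)
    ultimately show "?F + ?G \<le> poly (p1 + p2) N \<and>
        exec_within x (c1 ;; c2) (0, w, s) (poly (p1 + p2) N) (0, w, s(d := s d + (?F + ?G)))" by blast
  qed
  then show "\<exists>c p. adds (\<lambda>x s. f x s + g x s) d loc c p" by blast
qed

lemma computable_diff:
  assumes "computable f" "computable g"
  shows "computable (\<lambda>x s. f x s - g x s)"
proof (rule computableI)
  fix d loc assume loc: "\<And>i :: nat. loc i < (d :: nat)"
  then have loc': "\<And>i. loc i < d + 1" "\<And>i. loc i < d + 2" by (auto intro: less_trans)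
  have neq: "loc i \<noteq> Suc d" for i using loc[of i] by simp
  obtain c1 p1 where 1: "adds f (d + 1) loc c1 p1" using computableE[OF assms(1) loc'(1)] .
  obtain c2 p2 where 2: "adds g (d + 2) loc c2 p2" using computableE[OF assms(2) loc'(2)] .
  let ?c = "c1 ;; c2 ;; Loop (d + 2) (Dec (d + 1)) ;; Loop (d + 1) (Inc d)"
  let ?p = "p1 + (p2 + ((3 * p2 + 1) + (3 * p1 + 1)))"
  have "adds (\<lambda>x s. f x s - g x s) d loc ?c ?p"
  proof (rule addsI)
    fix x :: "bool list" and w and s :: "nat \<Rightarrow> nat" and N :: nat
    assume s: "\<And>i. i > d \<Longrightarrow> s i = 0" and N: "length x \<le> N" "\<And>i. s (loc i) \<le> N"
    let ?F = "f x (\<lambda>i. s (loc i))" and ?G = "g x (\<lambda>i. s (loc i))"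
    let ?s1 = "s(d + 1 := ?F)"
    let ?s2 = "s(d + 1 := ?F, d + 2 := ?G)"
    let ?s3 = "s(d + 1 := ?F - ?G)"
    have F: "?F \<le> poly p1 N" using s N by (intro addsD(1)[OF 1]) auto
    have G: "?G \<le> poly p2 N" using s N loc' addsD(1)[OF 2, of ?s1 x N] by (auto simp: neq)
    have "exec_within x c1 (0, w, s) (poly p1 N) (0, w, ?s1)"
      using s N by (intro addsD(2)[OF 1]) auto
    moreover have "exec_within x c2 (0, w, ?s1) (poly p2 N) (0, w, ?s2)"
      using s N by (intro addsD(2)[OF 2]) (auto simp: neq)
    moreover have "exec_within x (Loop (d + 2) (Dec (d + 1))) (0, w, ?s2) (3 * poly p2 N + 1) (0, w, ?s3)"
      using s G by (intro within_mono[OF within_truncated_sub]) auto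
    moreover have "exec_within x (Loop (d + 1) (Inc d)) (0, w, ?s3) (3 * poly p1 N + 1) (0, w, s(d := s d + (?F - ?G)))"
      using s F by (intro within_mono[OF within_move]) auto
    ultimately have "exec_within x ?c (0, w, s) (poly p1 N + (poly p2 N + ((3 * poly p2 N + 1) + (3 * poly p1 N + 1))))
       (0, w, s(d := s d + (?F - ?G)))"
      by (intro within_Seq)
    then show "?F - ?G \<le> poly ?p N \<and> exec_within x ?c (0, w, s) (poly ?p N) (0, w, s(d := s d + (?F - ?G)))"
      using F by simp
  qed
  then show "\<exists>c p. adds (\<lambda>x s. f x s - g x s) d loc c p" by blast
qed

text \<open>Variables are de Bruijn indices: under a binder, index 0 is the bound variable.\<close>

lemma computable_sum:
  assumes "computable f" "computable (\<lambda>x s. g x (\<lambda>i. s (Suc i)) (s 0))"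
  shows "computable (\<lambda>x s. \<Sum>v<f x s. g x s v)"
proof (rule computableI)
  fix d loc assume loc: "\<And>i :: nat. loc i < (d :: nat)"
  \<comment> \<open>Counter \<open>d + 1\<close> holds the number of remaining rounds,
    \<open>d + 2\<close> the bound variable, and \<open>d + 3\<close> receives each summand before
    it is moved to \<open>d\<close>.\<close>
  let ?loc = "case_nat (d + 2) loc"
  have loc': "loc i < d + 1" "loc i < d + 3" "?loc i < d + 3" for i
    using loc[of i] loc[of "i - 1"] by (auto split: nat.split)
  have neq: "loc i \<noteq> d" "loc i \<noteq> Suc d" "loc i \<noteq> Suc (Suc d)" for i
    using loc[of i] by auto
  obtain c1 p1 where 1: "adds f (d + 1) loc c1 p1" using computableE[OF assms(1) loc'(1)] .
  obtain c2 p2 where 2: "adds (\<lambda>x s. g x (\<lambda>i. s (Suc i)) (s 0)) (d + 3) ?loc c2 p2"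
    using computableE[OF assms(2) loc'(3)] .
  let ?b = "c2 ;; Loop (d + 3) (Inc d) ;; Inc (d + 2)"
  let ?c = "c1 ;; Loop (d + 1) ?b ;; Loop (d + 2) (Dec (d + 3))"
  \<comment> \<open>The bound variable may exceed \<open>N\<close>, but it stays below the number of
    summands, which is at most \<open>poly p1 N\<close>. So \<open>N + poly p1 N\<close> bounds all
    variables of the summand.\<close>
  let ?q = "p2 \<circ>\<^sub>p ([:0, 1:] + p1)"
  let ?p = "p1 * ?q + (p1 + (p1 * ((?q + ((3 * ?q + 1) + 1)) + 2) + 1 + (3 * p1 + 1)))"
  have "adds (\<lambda>x s. \<Sum>v<f x s. g x s v) d loc ?c ?p"
  proof (rule addsI)
    fix x :: "bool list" and w and s :: "nat \<Rightarrow> nat" and N :: nat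
    assume s: "\<And>i. i > d \<Longrightarrow> s i = 0" and N: "length x \<le> N" "\<And>i. s (loc i) \<le> N"
    let ?F = "f x (\<lambda>i. s (loc i))" and ?G = "\<lambda>v. g x (\<lambda>i. s (loc i)) v"
    let ?S = "\<lambda>j. s(d + 1 := ?F - j, d + 2 := j, d := s d + (\<Sum>v<j. ?G v))"
    let ?T = "poly ?q N + ((3 * poly ?q N + 1) + 1)"
    have F: "?F \<le> poly p1 N" using s N by (intro addsD(1)[OF 1]) auto
    have step: "?G j \<le> poly ?q N \<and>
        exec_within x ?b (0, w, (?S j)(d + 1 := ?F - Suc j)) ?T (0, w, ?S (Suc j))" if j: "j < ?F" for j
    proof -
      let ?s = "(?S j)(d + 1 := ?F - Suc j)"
      have bnd: "?s (?loc i) \<le> poly ([:0, 1:] + p1) N" for i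
        using j F N(2)[of "i - 1"] by (cases i) (auto simp: neq trans_le_add1)
      have Nq: "length x \<le> poly ([:0, 1:] + p1) N" using N(1) by simp
      have z: "\<And>i. i > d + 3 \<Longrightarrow> ?s i = 0" using s by auto
      have z3: "?s (d + 3) = 0" using s by simp
      have val: "g x (\<lambda>i. ?s (?loc (Suc i))) (?s (?loc 0)) = ?G j"
        by (simp add: neq)
      have upd: "?s(d + 3 := ?G j) =
          ?s(d + 3 := ?s (d + 3) + g x (\<lambda>i. ?s (?loc (Suc i))) (?s (?loc 0)))"
        unfolding val z3 by simp
      have G: "?G j \<le> poly ?q N"
        using addsD(1)[OF 2, where s = ?s, OF z Nq bnd] unfolding val by (simp add: poly_pcompose)
      have "exec_within x c2 (0, w, ?s) (poly p2 (poly ([:0, 1:] + p1) N)) (0, w, ?s(d + 3 := ?G j))"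
        by (rule addsD(2)[OF 2, where s = ?s, OF z Nq bnd], assumption, rule upd)
      then have "exec_within x c2 (0, w, ?s) (poly ?q N) (0, w, ?s(d + 3 := ?G j))"
        by (simp add: poly_pcompose)
      moreover have "exec_within x (Loop (d + 3) (Inc d)) (0, w, ?s(d + 3 := ?G j)) (3 * poly ?q N + 1)
          (0, w, ?s(d := s d + (\<Sum>v<Suc j. ?G v)))"
        using G s by (intro within_mono[OF within_move]) auto
      moreover have "exec_within x (Inc (d + 2)) (0, w, ?s(d := s d + (\<Sum>v<Suc j. ?G v))) 1 (0, w, ?S (Suc j))"
        by (intro within_Inc) auto
      ultimately have "exec_within x ?b (0, w, ?s) ?T (0, w, ?S (Suc j))"
        by (intro within_Seq)
      with G show ?thesis by simp
    qed
    have "exec_within x c1 (0, w, s) (poly p1 N) (0, w, ?S 0)"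
      using s N by (intro addsD(2)[OF 1]) (auto simp: fun_eq_iff)
    moreover have "exec_within x (Loop (d + 1) ?b) (0, w, ?S 0) (?F * (?T + 2) + 1) (0, w, ?S ?F)"
      using step by (intro within_Loop[where P = "\<lambda>_. 0" and W = "\<lambda>_. w" and S = ?S]) auto
    then have "exec_within x (Loop (d + 1) ?b) (0, w, ?S 0) (poly p1 N * (?T + 2) + 1) (0, w, ?S ?F)"
      by (rule within_mono) (intro add_mono mult_mono F; simp)
    moreover have "exec_within x (Loop (d + 2) (Dec (d + 3))) (0, w, ?S ?F) (3 * poly p1 N + 1)
        (0, w, s(d := s d + (\<Sum>v<?F. ?G v)))"
      using s F by (intro within_mono[OF within_clear]) (auto simp: fun_eq_iff)
    ultimately have "exec_within x ?c (0, w, s) (poly p1 N + (poly p1 N * (?T + 2) + 1 + (3 * poly p1 N + 1)))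
        (0, w, s(d := s d + (\<Sum>v<?F. ?G v)))"
      by (intro within_Seq)
    then have "exec_within x ?c (0, w, s) (poly ?p N) (0, w, s(d := s d + (\<Sum>v<?F. ?G v)))"
      by (rule within_mono) simp
    moreover have "(\<Sum>v<?F. ?G v) \<le> of_nat (card {..<?F}) * poly ?q N"
      by (rule sum_bounded_above) (use step in auto)
    then have "(\<Sum>v<?F. ?G v) \<le> poly p1 N * poly ?q N"
      using F by (auto intro: order.trans mult_right_mono)
    then have "(\<Sum>v<?F. ?G v) \<le> poly ?p N" by simp
    ultimately show "(\<Sum>v<?F. ?G v) \<le> poly ?p N \<and>
        exec_within x ?c (0, w, s) (poly ?p N) (0, w, s(d := s d + (\<Sum>v<?F. ?G v)))" by blast
  qed
  then show "\<exists>c p. adds (\<lambda>x s. \<Sum>v<f x s. g x s v) d loc c p" by blast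
qed

lemma computable_length: "computable (\<lambda>x s. length x)"
proof (rule computableI, intro exI, rule addsI, rule conjI)
  fix d :: nat and loc :: "nat \<Rightarrow> nat" and x :: "bool list" and w and s :: "nat \<Rightarrow> nat" and N :: nat
  assume s: "\<And>i. i > d \<Longrightarrow> s i = 0" and N: "length x \<le> N"
  let ?c = "Scan (Inc d ;; Inc (d + 1)) ;; Loop (d + 1) InL"
  have "exec_within x (Scan (Inc d ;; Inc (d + 1))) (0, w, s) (4 * length x + 1)
      (length x, w, s(d := s d + length x, d + 1 := length x))"
    by (rule within_scan) (use s in auto)
  moreover have "exec_within x (Loop (d + 1) InL) (length x, w, s(d := s d + length x, d + 1 := length x))
     (3 * length x + 1) (0, w, s(d := s d + length x))"
    by (rule within_rewind) (use s in auto)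
  ultimately have "exec_within x ?c (0, w, s) (4 * length x + 1 + (3 * length x + 1)) (0, w, s(d := s d + length x))"
    by (rule within_Seq)
  then show "exec_within x ?c (0, w, s) (poly [:2, 7:] N) (0, w, s(d := s d + length x))"
    by (rule within_mono) (use N in simp)
  show "length x \<le> poly [:2, 7:] N" using N by simp
qed

lemma computable_bit:
  assumes "computable f"
  shows "computable (\<lambda>x s. of_bool (f x s < length x \<and> x ! f x s))"
proof (rule computableI)
  fix d loc assume loc: "\<And>i :: nat. loc i < (d :: nat)"
  then have loc': "\<And>i. loc i < d + 1" by (auto intro: less_trans)
  obtain c1 p1 where 1: "adds f (d + 1) loc c1 p1" using computableE[OF assms(1) loc'(1)] .
  let ?c = "c1 ;; Loop (d + 1) (InR ;; Inc (d + 2)) ;; IncBit d ;; Loop (d + 2) InL"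
  let ?p = "p1 + (4 * p1 + 1 + (1 + (3 * p1 + 1)))"
  have "adds (\<lambda>x s. of_bool (f x s < length x \<and> x ! f x s)) d loc ?c ?p"
  proof (rule addsI)
    fix x :: "bool list" and w and s :: "nat \<Rightarrow> nat" and N :: nat
    assume s: "\<And>i. i > d \<Longrightarrow> s i = 0" and N: "length x \<le> N" "\<And>i. s (loc i) \<le> N"
    let ?F = "f x (\<lambda>i. s (loc i))"
    let ?b = "of_bool (?F < length x \<and> x ! ?F)"
    let ?s1 = "s(d + 1 := ?F)" and ?s2 = "s(d + 2 := ?F)"
    have F: "?F \<le> poly p1 N" using s N by (intro addsD(1)[OF 1]) auto
    have "exec_within x c1 (0, w, s) (poly p1 N) (0, w, ?s1)"
      using s N by (intro addsD(2)[OF 1]) auto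
    moreover have "exec_within x (Loop (d + 1) (InR ;; Inc (d + 2))) (0, w, ?s1) (4 * ?s1 (d + 1) + 1) (?s1 (d + 1), w, ?s2)"
      using s by (intro within_forward) (auto simp: fun_eq_iff)
    then have "exec_within x (Loop (d + 1) (InR ;; Inc (d + 2))) (0, w, ?s1) (4 * poly p1 N + 1) (?F, w, ?s2)"
      using F by (auto elim: within_mono)
    moreover have "exec_within x (IncBit d) (?F, w, ?s2) 1 (?F, w, ?s2(d := ?s2 d + ?b))"
      by (rule within_IncBit)
    moreover have "exec_within x (Loop (d + 2) InL) (?F, w, ?s2(d := ?s2 d + ?b)) (3 * poly p1 N + 1)
        (0, w, s(d := s d + ?b))"
      using F s by (intro within_mono[OF within_rewind]) (auto simp: fun_eq_iff)
    ultimately have "exec_within x ?c (0, w, s) (poly p1 N + (4 * poly p1 N + 1 + (1 + (3 * poly p1 N + 1)))) (0, w, s(d := s d + ?b))"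
      by (intro within_Seq)
    then show "?b \<le> poly ?p N \<and> exec_within x ?c (0, w, s) (poly ?p N) (0, w, s(d := s d + ?b))"
      by simp
  qed
  then show "\<exists>c p. adds (\<lambda>x s. of_bool (f x s < length x \<and> x ! f x s)) d loc c p" by blast
qed

text \<open>The link from counters to words: every machine used below writes a word of computable
  length whose bits are decided one by one from their positions.\<close>

lemma polytime_map:
  assumes "computable (\<lambda>x s. f x)" "computable (\<lambda>x s. of_bool (P x (s 0)))"
  shows "polytime (\<lambda>x. map (P x) [0..<f x])"
proof -
  \<comment> \<open>Counter 0 stays zero and supplies dummy variables for \<open>f\<close>. Counter
    1 holds the position of the bit, counter 2 the remaining rounds, counter 3 the bit.\<close>
  obtain c1 p1 where 1: "adds (\<lambda>x s. f x) 2 (\<lambda>_. 0) c1 p1"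
    using computableE[OF assms(1), of "\<lambda>_. 0" 2] by auto
  obtain c2 p2 where 2: "adds (\<lambda>x s. of_bool (P x (s 0))) 3 (\<lambda>_. 1) c2 p2"
    using computableE[OF assms(2), of "\<lambda>_. 1" 3] by auto
  let ?b = "c2 ;; Emit 3 ;; Dec 3 ;; Inc 1"
  let ?c = "c1 ;; Loop 2 ?b"
  let ?q = "p2 \<circ>\<^sub>p ([:0, 1:] + p1)"
  show ?thesis
  proof (rule exec_polytime)
    fix x
    let ?F = "f x" and ?N = "length x"
    let ?S = "\<lambda>j. (\<lambda>_. 0)(2 :: nat := ?F - j, 1 := j)"
    let ?T = "poly ?q ?N + (1 + (1 + 1))"
    have F: "?F \<le> poly p1 ?N" by (rule addsD(1)[OF 1, of "\<lambda>_. 0"]) auto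
    have "exec_within x c1 (0, [], \<lambda>_. 0) (poly p1 ?N) (0, [], ?S 0)"
      by (rule addsD(2)[OF 1]) auto
    moreover have "exec_within x ?b (0, map (P x) [0..<j], (?S j)(2 := ?F - Suc j)) ?T (0, map (P x) [0..<Suc j], ?S (Suc j))"
      if j: "j < ?F" for j
    proof -
      let ?s = "(?S j)(2 := ?F - Suc j)" and ?w = "map (P x) [0..<j]" and ?v = "map (P x) [0..<Suc j]"
      have "exec_within x c2 (0, ?w, ?s) (poly p2 (poly ([:0, 1:] + p1) ?N)) (0, ?w, ?s(3 := of_bool (P x j)))"
        using F j by (intro addsD(2)[OF 2]) auto
      then have "exec_within x c2 (0, ?w, ?s) (poly ?q ?N) (0, ?w, ?s(3 := of_bool (P x j)))"
        by (simp add: poly_pcompose)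
      moreover have "exec_within x (Emit 3) (0, ?w, ?s(3 := of_bool (P x j))) 1
          (0, ?w @ [(?s(3 := of_bool (P x j))) (3::nat) \<noteq> 0], ?s(3 := of_bool (P x j)))"
        by (rule within_Emit)
      then have "exec_within x (Emit 3) (0, ?w, ?s(3 := of_bool (P x j))) 1 (0, ?v, ?s(3 := of_bool (P x j)))"
        by simp
      moreover have "exec_within x (Dec 3) (0, ?v, ?s(3 := of_bool (P x j))) 1 (0, ?v, ?s)"
        by (rule within_Dec) (auto simp: fun_eq_iff)
      moreover have "exec_within x (Inc 1) (0, ?v, ?s) 1 (0, ?v, ?S (Suc j))"
        by (rule within_Inc) (auto simp: fun_eq_iff)
      ultimately show ?thesis by (intro within_Seq)
    qed
    then have "exec_within x (Loop 2 ?b) (0, map (P x) [0..<0], ?S 0) (?F * (?T + 2) + 1) (0, map (P x) [0..<?F], ?S ?F)"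
      by (intro within_Loop[where P = "\<lambda>_. 0" and W = "\<lambda>j. map (P x) [0..<j]" and S = ?S]) auto
    then have "exec_within x (Loop 2 ?b) (0, [], ?S 0) (poly p1 ?N * (?T + 2) + 1) (0, map (P x) [0..<?F], ?S ?F)"
      by (simp del: One_nat_def) (rule within_mono, assumption, auto intro!: mult_mono F)
    ultimately have "exec_within x ?c (0, [], \<lambda>_. 0) (poly p1 ?N + (poly p1 ?N * (?T + 2) + 1)) (0, map (P x) [0..<?F], ?S ?F)"
      by (rule within_Seq)
    moreover have "poly p1 ?N + (poly p1 ?N * (?T + 2) + 1) = poly (p1 + (p1 * (?q + 5) + 1)) ?N"
      by (simp add: algebra_simps)
    ultimately obtain t where "exec x ?c (0, [], \<lambda>_. 0) t (0, map (P x) [0..<?F], ?S ?F)"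
        "t \<le> poly (p1 + (p1 * (?q + 5) + 1)) ?N"
      unfolding exec_within_def by metis
    then show "\<exists>t \<sigma>. exec x ?c (0, [], \<lambda>_. 0) t \<sigma> \<and> t \<le> poly (p1 + (p1 * (?q + 5) + 1)) (length x) \<and>
        fst (snd \<sigma>) = map (P x) [0..<f x]"
      by fastforce
  qed
qed

lemma computable_rename:
  assumes "computable f"
  shows "computable (\<lambda>x s. f x (\<lambda>i. s (\<pi> i)))"
proof (rule computableI)
  fix d :: nat and loc :: "nat \<Rightarrow> nat" assume loc: "\<And>i. loc i < d"
  obtain c p where cp: "adds f d (\<lambda>i. loc (\<pi> i)) c p"
    using computableE[OF assms, of "\<lambda>i. loc (\<pi> i)" d] loc by blast
  have "adds (\<lambda>x s. f x (\<lambda>i. s (\<pi> i))) d loc c p"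
    by (rule addsI, rule conjI) (use addsD[OF cp] in auto)
  then show "\<exists>c p. adds (\<lambda>x s. f x (\<lambda>i. s (\<pi> i))) d loc c p" by blast
qed

text \<open>Keeps a term meaningful under a binder, where its variables have moved up by
  one.\<close>

lemmas computable_shift = computable_rename[where \<pi> = Suc]

section \<open>Decidable predicates and further closure properties\<close>

abbreviation checkable :: "(bool list \<Rightarrow> (nat \<Rightarrow> nat) \<Rightarrow> bool) \<Rightarrow> bool" where
  "checkable P \<equiv> computable (\<lambda>x s. of_bool (P x s))"

lemma computable_const: "computable (\<lambda>x s. c)"
proof (induction c)
  case (Suc c)
  then show ?case using computable_add[OF computable_one] by simp
qed (rule computable_zero)

lemma computable_Suc: "computable f \<Longrightarrow> computable (\<lambda>x s. Suc (f x s))"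
  using computable_add[OF computable_one] by simp

text \<open>A product is a sum of equal summands.\<close>

lemma computable_mult:
  assumes "computable f" "computable g"
  shows "computable (\<lambda>x s. f x s * g x s)"
  using computable_sum[OF assms(1) computable_shift[OF assms(2)]] by simp

lemma checkable_less:
  assumes "computable f" "computable g"
  shows "checkable (\<lambda>x s. f x s < g x s)"
proof -
  have "of_bool (a < b) = 1 - (1 - (b - a))" for a b :: nat by auto
  then show ?thesis
    using computable_diff[OF computable_one computable_diff[OF computable_one computable_diff[OF assms(2,1)]]]
    by simp
qed

lemma checkable_not:
  assumes "checkable P"
  shows "checkable (\<lambda>x s. \<not> P x s)"
proof -
  have *: "of_bool (\<not> b) = 1 - (of_bool b :: nat)" for b by simp
  show ?thesis unfolding * by (rule computable_diff[OF computable_one assms])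
qed

lemma checkable_conj: "checkable P \<Longrightarrow> checkable Q \<Longrightarrow> checkable (\<lambda>x s. P x s \<and> Q x s)"
  unfolding of_bool_conj by (rule computable_mult)

lemma checkable_disj: "checkable P \<Longrightarrow> checkable Q \<Longrightarrow> checkable (\<lambda>x s. P x s \<or> Q x s)"
  using checkable_not[OF checkable_conj[OF checkable_not[of P] checkable_not[of Q]]] by simp

lemma checkable_imp: "checkable P \<Longrightarrow> checkable Q \<Longrightarrow> checkable (\<lambda>x s. P x s \<longrightarrow> Q x s)"
  unfolding imp_conv_disj by (intro checkable_disj checkable_not)

lemma checkable_iff: "checkable P \<Longrightarrow> checkable Q \<Longrightarrow> checkable (\<lambda>x s. P x s \<longleftrightarrow> Q x s)"
  unfolding iff_conv_conj_imp by (intro checkable_conj checkable_imp)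

lemma checkable_le:
  assumes "computable f" "computable g"
  shows "checkable (\<lambda>x s. f x s \<le> g x s)"
  unfolding not_less[symmetric] by (intro checkable_not checkable_less assms)

lemma checkable_eq:
  assumes "computable f" "computable g"
  shows "checkable (\<lambda>x s. f x s = g x s)"
  unfolding eq_iff by (intro checkable_conj checkable_le assms)

lemma checkable_const: "checkable (\<lambda>x s. b)"
  by (rule computable_const)

lemma checkable_ex:
  assumes "computable f" "checkable (\<lambda>x s. Q x (\<lambda>i. s (Suc i)) (s 0))"
  shows "checkable (\<lambda>x s. \<exists>v<f x s. Q x s v)"
proof -
  have "0 < (\<Sum>v<n. of_bool (R v) :: nat) \<longleftrightarrow> (\<exists>v<n. R v)" for n :: nat and R
    by (subst neq0_conv[symmetric], subst sum_eq_0_iff) auto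
  then show ?thesis
    using checkable_less[OF computable_zero computable_sum[OF assms(1), where g = "\<lambda>x s v. of_bool (Q x s v)", OF assms(2)]]
    by simp
qed

lemma checkable_all:
  assumes "computable f" "checkable (\<lambda>x s. Q x (\<lambda>i. s (Suc i)) (s 0))"
  shows "checkable (\<lambda>x s. \<forall>v<f x s. Q x s v)"
  using checkable_not[OF checkable_ex[OF assms(1), where Q = "\<lambda>x s v. \<not> Q x s v", OF checkable_not[OF assms(2)]]]
  by simp

lemma checkable_bex_list:
  assumes "\<And>q. q \<in> set qs \<Longrightarrow> checkable (P q)"
  shows "checkable (\<lambda>x s. \<exists>q\<in>set qs. P q x s)"
  using assms
proof (induction qs)
  case Nil
  then show ?case using checkable_const[of False] by simp
next
  case (Cons q qs)
  then show ?case using checkable_disj[of "P q" "\<lambda>x s. \<exists>q\<in>set qs. P q x s"] by simp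
qed

lemma computable_if:
  assumes "checkable P" "computable f" "computable g"
  shows "computable (\<lambda>x s. if P x s then f x s else g x s)"
proof -
  have "(if b then m else n) = of_bool b * m + of_bool (\<not> b) * n" for b and m n :: nat by simp
  then show ?thesis
    using computable_add[OF computable_mult[OF assms(1,2)] computable_mult[OF checkable_not[OF assms(1)] assms(3)]]
    by simp
qed

lemma checkable_if:
  assumes "checkable P" "checkable Q" "checkable R"
  shows "checkable (\<lambda>x s. if P x s then Q x s else R x s)"
  using computable_if[OF assms] by (simp add: if_distrib cong: if_cong)

lemma computable_div:
  assumes "computable f" "computable g"
  shows "computable (\<lambda>x s. f x s div g x s)"
proof -
  \<comment> \<open>The quotient is the number of \<open>i\<close> with
    \<open>Suc i * b \<le> a\<close>; the conjunct \<open>0 < b\<close> produces the value 0 of a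
    division by zero.\<close>
  have *: "a div b = (\<Sum>i<a. of_bool (0 < b \<and> Suc i * b \<le> a))" for a b :: nat
  proof (cases "b = 0")
    case False
    have "{i. i < a \<and> (0 < b \<and> Suc i * b \<le> a)} = {..<a div b}"
    proof (intro equalityI subsetI)
      fix i assume "i \<in> {i. i < a \<and> (0 < b \<and> Suc i * b \<le> a)}"
      then show "i \<in> {..<a div b}" using less_eq_div_iff_mult_less_eq[of b "Suc i" a] by simp
    next
      fix i assume i: "i \<in> {..<a div b}"
      then have "Suc i * b \<le> a" using less_eq_div_iff_mult_less_eq[of b "Suc i" a] False by simp
      moreover have "i < a" using i by (meson div_le_dividend lessThan_iff order.strict_trans2)
      ultimately show "i \<in> {i. i < a \<and> (0 < b \<and> Suc i * b \<le> a)}" using False by simp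
    qed
    then show ?thesis by (simp add: of_bool_def sum.If_cases Int_def)
  qed simp
  show ?thesis
    unfolding *
    by (rule computable_sum[where g = "\<lambda>x s i. of_bool (0 < g x s \<and> Suc i * g x s \<le> f x s)"])
      (intro assms checkable_conj checkable_less checkable_le computable_zero computable_mult computable_Suc
        computable_var assms[THEN computable_shift])+
qed

lemma computable_mod:
  assumes "computable f" "computable g"
  shows "computable (\<lambda>x s. f x s mod g x s)"
  using computable_diff[OF assms(1) computable_mult[OF computable_div[OF assms] assms(2)]]
  by (simp add: minus_div_mult_eq_mod)

lemma computable_poly:
  assumes "computable f"
  shows "computable (\<lambda>x s. poly p (f x s))"
proof (induction p)
  case 0
  then show ?case by (simp add: computable_zero)
next
  case (pCons a p)
  then show ?case using computable_add[OF computable_const computable_mult[OF assms pCons(2)]] by simp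
qed

text \<open>Substitution is a sum with a single nonzero summand.\<close>

lemma computable_let:
  assumes "computable g" "computable (\<lambda>x s. f x (\<lambda>i. s (Suc i)) (s 0))"
  shows "computable (\<lambda>x s. f x s (g x s))"
proof -
  have "computable (\<lambda>x s. \<Sum>v<Suc (g x s). of_bool (v = g x s) * f x s v)"
    by (rule computable_sum[where g = "\<lambda>x s v. of_bool (v = g x s) * f x s v"])
      (intro computable_Suc computable_mult checkable_eq computable_var assms assms(1)[THEN computable_shift])+
  moreover have "(\<Sum>v<Suc n. of_bool (v = n) * h v) = h n" for n and h :: "nat \<Rightarrow> nat"
  proof -
    have "(\<Sum>v<n. of_bool (v = n) * h v) = 0" by (rule sum.neutral) auto
    then show ?thesis by simp
  qed
  ultimately show ?thesis by simp
qed

text \<open>\<open>computable_let\<close> always eliminates variable 0. Therefore the arguments are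
  first put in reverse order and then substituted from the last to the first; those still pending
  are shifted past the variables that remain.\<close>

lemma computable_comp2:
  assumes "computable (\<lambda>x s. f x (s 0) (s 1))" "computable g" "computable h"
  shows "computable (\<lambda>x s. f x (g x s) (h x s))"
proof -
  have "computable (\<lambda>x s. f x (s 1) (s 0))"
    using computable_rename[OF assms(1), of "\<lambda>i. 1 - i"] by simp
  then have "computable (\<lambda>x s. f x (s 0) (h x (\<lambda>i. s (Suc i))))"
    by (intro computable_let[OF computable_shift[OF assms(3)], where f = "\<lambda>x s v. f x (s 0) v"]) simp
  then show ?thesis
    by (rule computable_let[OF assms(2), where f = "\<lambda>x s v. f x v (h x s)"])
qed

lemma computable_comp3:
  assumes "computable (\<lambda>x s. f x (s 0) (s 1) (s 2))" "computable g" "computable h" "computable k"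
  shows "computable (\<lambda>x s. f x (g x s) (h x s) (k x s))"
proof -
  have "computable (\<lambda>x s. f x (s 2) (s 1) (s 0))"
    using computable_rename[OF assms(1), of "\<lambda>i. 2 - i"] by simp
  then have "computable (\<lambda>x s. f x (s 1) (s 0) (k x (\<lambda>i. s (Suc (Suc i)))))"
    by (intro computable_let[OF computable_shift[OF computable_shift[OF assms(4)]], where f = "\<lambda>x s v. f x (s 1) (s 0) v"])
      (simp add: numeral_2_eq_2)
  then have "computable (\<lambda>x s. f x (s 0) (h x (\<lambda>i. s (Suc i))) (k x (\<lambda>i. s (Suc i))))"
    by (intro computable_let[OF computable_shift[OF assms(3)], where f = "\<lambda>x s v. f x (s 0) v (k x (\<lambda>i. s (Suc i)))"]) simp
  then show ?thesis
    by (rule computable_let[OF assms(2), where f = "\<lambda>x s v. f x v (h x s) (k x s)"])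
qed

lemma computable_comp4:
  assumes "computable (\<lambda>x s. f x (s 0) (s 1) (s 2) (s 3))"
    and "computable g" "computable h" "computable k" "computable l"
  shows "computable (\<lambda>x s. f x (g x s) (h x s) (k x s) (l x s))"
proof -
  have "computable (\<lambda>x s. f x (s 3) (s 2) (s 1) (s 0))"
    using computable_rename[OF assms(1), of "\<lambda>i. 3 - i"] by simp
  then have "computable (\<lambda>x s. f x (s 2) (s 1) (s 0) (l x (\<lambda>i. s (Suc (Suc (Suc i))))))"
    by (intro computable_let[OF computable_shift[OF computable_shift[OF computable_shift[OF assms(5)]]],
          where f = "\<lambda>x s v. f x (s 2) (s 1) (s 0) v"])
      (simp add: numeral_2_eq_2 numeral_3_eq_3)
  then have "computable (\<lambda>x s. f x (s 1) (s 0) (k x (\<lambda>i. s (Suc (Suc i)))) (l x (\<lambda>i. s (Suc (Suc i)))))"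
    by (intro computable_let[OF computable_shift[OF computable_shift[OF assms(4)]],
          where f = "\<lambda>x s v. f x (s 1) (s 0) v (l x (\<lambda>i. s (Suc (Suc i))))"])
      (simp add: numeral_2_eq_2)
  then have "computable (\<lambda>x s. f x (s 0) (h x (\<lambda>i. s (Suc i))) (k x (\<lambda>i. s (Suc i))) (l x (\<lambda>i. s (Suc i))))"
    by (intro computable_let[OF computable_shift[OF assms(3)],
          where f = "\<lambda>x s v. f x (s 0) v (k x (\<lambda>i. s (Suc i))) (l x (\<lambda>i. s (Suc i)))"]) simp
  then show ?thesis
    by (rule computable_let[OF assms(2), where f = "\<lambda>x s v. f x v (h x s) (k x s) (l x s)"])
qed

lemma computable_sum_list:
  assumes "\<And>q. q \<in> set qs \<Longrightarrow> computable (f q)"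
  shows "computable (\<lambda>x s. \<Sum>q\<leftarrow>qs. f q x s)"
  using assms
proof (induction qs)
  case Nil
  then show ?case using computable_zero by simp
next
  case (Cons q qs)
  then show ?case using computable_add[of "f q" "\<lambda>x s. \<Sum>q\<leftarrow>qs. f q x s"] by simp
qed

lemmas computable_intros =
  computable_const computable_add computable_diff computable_mult computable_Suc computable_div computable_mod
  computable_length computable_poly checkable_less checkable_le checkable_eq checkable_not checkable_conj
  checkable_disj checkable_imp checkable_iff checkable_ex checkable_all computable_bit checkable_if computable_if

section \<open>Membership in NP\<close>

text \<open>An injective colouring is injective on every neighbourhood. With \<open>r\<close>
  colours and \<open>r\<close> neighbours it is thus a bijection there; conversely, such bijections
  give all degrees the value \<open>r\<close>, and the neighbourhood of any one vertex rules out
  fewer colours. This last argument needs a vertex: the empty graph has number 0. Colours move from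
  \<open>{1..r}\<close> to \<open>{..<r}\<close>.\<close>

lemma injective_chromatic_number_regular_iff:
  fixes V :: "'a set"
  assumes G: "sgraph V E" and r: "0 < r"
  shows "regular r V E \<and> injective_chromatic_number V E = r \<longleftrightarrow>
    V \<noteq> {} \<and> (\<exists>f. \<forall>v\<in>V. f v < r \<and> (\<forall>c<r. \<exists>!w. w \<in> V \<and> {v, w} \<in> E \<and> f w = c))"
    (is "?L \<longleftrightarrow> ?R")
proof -
  define N where "N v = {u \<in> V. {v, u} \<in> E}" for v
  have fin: "finite V" using G by (simp add: sgraph_def)
  then have finN: "finite (N v)" for v by (simp add: N_def)
  have inj: "inj_on f (N v)" if "injective_coloring k V E f" "v \<in> V" for k v and f :: "'a \<Rightarrow> nat"
    using that unfolding injective_coloring_def N_def inj_on_def by blast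
  have img: "f ` N v \<subseteq> {1..k}" if "injective_coloring k V E f" for k v and f :: "'a \<Rightarrow> nat"
    using that unfolding injective_coloring_def N_def by blast
  show ?thesis
  proof
    assume L: ?L
    \<comment> \<open>Giving all vertices different colours shows that the minimum is attained, so
      that \<open>LeastI_ex\<close> applies.\<close>
    obtain g where g: "bij_betw g V {0..<card V}" using ex_bij_betw_finite_nat[OF fin] by blast
    have "Suc (g v) \<le> card V" if "v \<in> V" for v using g that by (auto simp: bij_betw_def Suc_le_eq)
    then have "injective_coloring (card V) V E (\<lambda>v. Suc (g v))"
      using g unfolding injective_coloring_def bij_betw_def inj_on_def by (auto simp: image_subset_iff)
    then have "\<exists>k f. injective_coloring k V E f" by blast
    from LeastI_ex[OF this] obtain f where f: "injective_coloring r V E f"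
      using L unfolding injective_chromatic_number_def by auto
    have "V \<noteq> {}"
    proof
      assume "V = {}"
      then have "injective_chromatic_number V E = 0"
        unfolding injective_chromatic_number_def injective_coloring_def by (intro Least_eq_0) auto
      with L r show False by simp
    qed
    moreover have "f v - 1 < r \<and> (\<forall>c<r. \<exists>!w. w \<in> V \<and> {v, w} \<in> E \<and> f w - 1 = c)" if v: "v \<in> V" for v
    proof -
      have pos: "f u \<in> {1..r}" if "u \<in> V" for u using f that unfolding injective_coloring_def by blast
      have "card (f ` N v) = r"
        using L v card_image[OF inj[OF f v]] by (simp add: regular_def N_def)
      then have eq: "f ` N v = {1..r}" using img[OF f, of v] by (intro card_subset_eq) auto
      have "\<exists>!w. w \<in> V \<and> {v, w} \<in> E \<and> f w - 1 = c" if "c < r" for c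
      proof -
        have "Suc c \<in> f ` N v" using eq that by simp
        then obtain w where w: "w \<in> N v" "f w = Suc c" by auto
        have "u = w" if "u \<in> V" "{v, u} \<in> E" "f u - 1 = c" for u
        proof -
          have "f u = f w" using pos[OF that(1)] that(3) w(2) by auto
          moreover have "u \<in> N v" using that by (simp add: N_def)
          ultimately show ?thesis using inj[OF f v] w(1) by (auto dest: inj_onD)
        qed
        moreover have "w \<in> V \<and> {v, w} \<in> E \<and> f w - 1 = c" using w by (simp add: N_def)
        ultimately show ?thesis by (intro ex1I[of _ w]) blast+
      qed
      moreover have "f v - 1 < r" using pos[OF v] by auto
      ultimately show ?thesis by simp
    qed
    ultimately show ?R by (intro conjI exI[of _ "\<lambda>v. f v - 1"] ballI) simp_all
  next
    assume ?R
    then obtain f where F: "\<forall>v\<in>V. f v < r \<and> (\<forall>c<r. \<exists>!w. w \<in> V \<and> {v, w} \<in> E \<and> f w = c)"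
      and ne: "V \<noteq> {}"
      by (elim conjE exE) (rule that; assumption)
    have f: "f v < r" "c < r \<Longrightarrow> \<exists>!w. w \<in> V \<and> {v, w} \<in> E \<and> f w = c" if "v \<in> V" for v c
      using bspec[OF F that] by simp_all
    have injf: "inj_on f (N v)" if "v \<in> V" for v
    proof (rule inj_onI)
      fix u w assume "u \<in> N v" "w \<in> N v" "f u = f w"
      then have u: "u \<in> V \<and> {v, u} \<in> E \<and> f u = f u" and w: "w \<in> V \<and> {v, w} \<in> E \<and> f w = f u"
        by (simp_all add: N_def)
      have "\<exists>!z. z \<in> V \<and> {v, z} \<in> E \<and> f z = f u"
        using that f(1) u by (intro f(2)) auto
      then show "u = w" using u w by blast
    qed
    have "f ` N v = {..<r}" if "v \<in> V" for v
    proof (intro equalityI subsetI)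
      fix c assume "c \<in> {..<r}"
      then have "\<exists>!w. w \<in> V \<and> {v, w} \<in> E \<and> f w = c" using f(2)[OF that] by simp
      then show "c \<in> f ` N v" unfolding N_def by blast
    qed (use f(1) in \<open>auto simp: N_def\<close>)
    then have cardN: "card (N v) = r" if "v \<in> V" for v
      using card_image[OF injf[OF that]] that by simp
    then have reg: "regular r V E" by (simp add: regular_def N_def)
    have "injective_coloring r V E (\<lambda>v. Suc (f v))"
      unfolding injective_coloring_def
    proof (intro conjI notI)
      show "(\<lambda>v. Suc (f v)) ` V \<subseteq> {1..r}" using f(1) by (auto simp: Suc_le_eq)
      assume "\<exists>v\<in>V. \<exists>u\<in>V. \<exists>w\<in>V. {v, u} \<in> E \<and> {v, w} \<in> E \<and> u \<noteq> w \<and> Suc (f u) = Suc (f w)"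
      then show False using injf by (auto simp: N_def inj_on_def)
    qed
    moreover have "r \<le> k" if "injective_coloring k V E g" for k g
    proof -
      obtain v where v: "v \<in> V" using ne by blast
      have "card (N v) = card (g ` N v)" using card_image[OF inj[OF that v]] by simp
      also have "\<dots> \<le> card {1..k}" using img[OF that] by (intro card_mono) auto
      finally show ?thesis using cardN[OF v] by simp
    qed
    ultimately have "injective_chromatic_number V E = r"
      unfolding injective_chromatic_number_def by (intro Least_equality) auto
    with reg show ?L by blast
  qed
qed

section \<open>Adjacency matrices as words\<close>

lemma length_concat_rows [simp]:
  "length (concat (map (\<lambda>i. map (f i) [0..<n]) [0..<m])) = m * n"
  by (induction m) auto

lemma row_index_less:
  assumes "i < m" "j < n"
  shows "i * n + j < m * (n :: nat)"
proof -
  have "i * n + j < Suc i * n" using assms(2) by simp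
  also have "\<dots> \<le> m * n" using assms(1) by (intro mult_right_mono) auto
  finally show ?thesis .
qed

lemma nth_concat_rows:
  assumes "i < m" "j < n"
  shows "concat (map (\<lambda>i. map (f i) [0..<n]) [0..<m]) ! (i * n + j) = f i j"
  using assms
proof (induction m)
  case (Suc m)
  show ?case
  proof (cases "i = m")
    case True
    then show ?thesis using Suc.prems by (simp add: nth_append)
  next
    case False
    then have "i < m" using Suc.prems by simp
    moreover have "i * n + j < m * n"
      using row_index_less[OF \<open>i < m\<close> Suc.prems(2)] .
    ultimately show ?thesis using Suc by (simp add: nth_append)
  qed
qed simp

lemma concat_rows_eqI:
  assumes "length xs = m * n" "\<And>i j. i < m \<Longrightarrow> j < n \<Longrightarrow> xs ! (i * n + j) = f i j"
  shows "xs = concat (map (\<lambda>i. map (f i) [0..<n]) [0..<m])"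
proof (rule nth_equalityI)
  fix k assume k: "k < length xs"
  then have n: "0 < n" using assms(1) by (cases n) auto
  have "k div n < m" using k assms(1) n by (simp add: less_mult_imp_div_less)
  then have "xs ! (k div n * n + k mod n) = f (k div n) (k mod n)"
    "concat (map (\<lambda>i. map (f i) [0..<n]) [0..<m]) ! (k div n * n + k mod n) = f (k div n) (k mod n)"
    using n by (intro assms(2) nth_concat_rows; simp)+
  then show "xs ! k = concat (map (\<lambda>i. map (f i) [0..<n]) [0..<m]) ! k"
    by simp
qed (simp add: assms(1))

text \<open>The language in terms of the bits of the word: a zero diagonal and symmetry make the
  matrix that of a simple graph, and the exact colouring takes care of regularity.\<close>

lemma regular_injective_coloring_iff:
  "x \<in> regular_injective_coloring \<longleftrightarrow>
    (\<exists>n>0. length x = n * n \<and> (\<forall>i<n. \<not> x ! (i * n + i)) \<and>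
      (\<forall>i<n. \<forall>j<n. x ! (i * n + j) \<longrightarrow> x ! (j * n + i)) \<and>
      (\<exists>r\<ge>3. \<exists>f :: nat \<Rightarrow> nat. \<forall>v<n. f v < r \<and> (\<forall>c<r. \<exists>!w. w < n \<and> x ! (v * n + w) \<and> f w = c)))"
    (is "_ \<longleftrightarrow> ?R")
proof
  assume "x \<in> regular_injective_coloring"
  then obtain n E r where x: "x = encode_graph n E" and E: "sgraph {..<n} E"
    and r: "r \<ge> 3" "regular r {..<n} E" "injective_chromatic_number {..<n} E = r"
    unfolding regular_injective_coloring_def by blast
  have *: "{..<n} \<noteq> {} \<and> (\<exists>f. \<forall>v\<in>{..<n}. f v < r \<and> (\<forall>c<r. \<exists>!w. w \<in> {..<n} \<and> {v, w} \<in> E \<and> f w = c))"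
    by (subst injective_chromatic_number_regular_iff[OF E, symmetric]) (use r in auto)
  have len: "length x = n * n" by (simp add: x encode_graph_def)
  have nth: "x ! (i * n + j) = ({i, j} \<in> E)" if "i < n" "j < n" for i j
    using that by (simp add: x encode_graph_def nth_concat_rows)
  have "{i, i} \<notin> E" for i using E by (auto simp: sgraph_def)
  then have loop: "\<forall>i<n. \<not> x ! (i * n + i)" by (simp add: nth)
  have sym: "\<forall>i<n. \<forall>j<n. x ! (i * n + j) \<longrightarrow> x ! (j * n + i)" by (simp add: nth insert_commute)
  from * obtain f where f: "\<forall>v<n. f v < r \<and> (\<forall>c<r. \<exists>!w. w < n \<and> {v, w} \<in> E \<and> f w = c)"
    unfolding Ball_def lessThan_iff by (elim conjE exE) (rule that; assumption)
  have "\<forall>v<n. f v < r \<and> (\<forall>c<r. \<exists>!w. w < n \<and> x ! (v * n + w) \<and> f w = c)"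
  proof (intro allI impI conjI)
    fix v c assume "v < n" "c < r"
    then have "\<exists>!w. w < n \<and> {v, w} \<in> E \<and> f w = c" using f by blast
    then show "\<exists>!w. w < n \<and> x ! (v * n + w) \<and> f w = c"
      by (rule back_subst[of Ex1]) (use \<open>v < n\<close> in \<open>auto simp: fun_eq_iff nth\<close>)
  qed (use f in auto)
  moreover have "n > 0" using * by auto
  ultimately show ?R using len loop sym r(1)
    by (intro exI[of _ n] conjI exI[of _ r] exI[of _ f])
next
  assume ?R
  then obtain n r :: nat and f :: "nat \<Rightarrow> nat" where n: "n > 0" and len: "length x = n * n" and loop: "\<forall>i<n. \<not> x ! (i * n + i)"
    and sym: "\<forall>i<n. \<forall>j<n. x ! (i * n + j) \<longrightarrow> x ! (j * n + i)"
    and r: "r \<ge> 3" and f: "\<forall>v<n. f v < r \<and> (\<forall>c<r. \<exists>!w. w < n \<and> x ! (v * n + w) \<and> f w = c)"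
    by (elim exE conjE) (rule that; assumption)
  define E where "E = {{i, j} |i j. i < n \<and> j < n \<and> x ! (i * n + j)}"
  have in_E: "{i, j} \<in> E \<longleftrightarrow> x ! (i * n + j)" if "i < n" "j < n" for i j
    using that sym unfolding E_def by (auto simp: doubleton_eq_iff)
  have "i \<noteq> j" if "i < n" "x ! (i * n + j)" for i j using loop that by auto
  then have E: "sgraph {..<n} E"
    unfolding sgraph_def E_def by (auto simp: card_insert_if)
  have "x = encode_graph n E"
    unfolding encode_graph_def by (rule concat_rows_eqI[OF len]) (simp add: in_E)
  moreover have "regular r {..<n} E \<and> injective_chromatic_number {..<n} E = r"
  proof (subst injective_chromatic_number_regular_iff[OF E])
    have "\<forall>v<n. f v < r \<and> (\<forall>c<r. \<exists>!w. w < n \<and> {v, w} \<in> E \<and> f w = c)"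
    proof (intro allI impI conjI)
      fix v c assume "v < n" "c < r"
      then have "\<exists>!w. w < n \<and> x ! (v * n + w) \<and> f w = c" using f by blast
      then show "\<exists>!w. w < n \<and> {v, w} \<in> E \<and> f w = c"
        by (rule back_subst[of Ex1]) (use \<open>v < n\<close> in \<open>auto simp: fun_eq_iff in_E\<close>)
    qed (use f in auto)
    then show "{..<n} \<noteq> {} \<and> (\<exists>f. \<forall>v\<in>{..<n}. f v < r \<and> (\<forall>c<r. \<exists>!w. w \<in> {..<n} \<and> {v, w} \<in> E \<and> f w = c))"
      using n unfolding Ball_def lessThan_iff by (intro conjI exI[of _ f]) auto
  qed (use r in auto)
  ultimately show "x \<in> regular_injective_coloring"
    unfolding regular_injective_coloring_def using E r by blast
qed

section \<open>Certificates and their verifier\<close>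

definition one_at :: "bool list \<Rightarrow> nat \<Rightarrow> bool" where
  "one_at x j \<longleftrightarrow> j < length x \<and> x ! j"

lemma checkable_one_at: "computable f \<Longrightarrow> checkable (\<lambda>x s. one_at x (f x s))"
  unfolding one_at_def by (rule computable_bit)

lemma length_doubled: "length (concat (map (\<lambda>b. [b, b]) x)) = 2 * length x"
  by (induction x) auto

lemma length_pair_word: "length (pair_word x u) = 2 * length x + 2 + length u"
  by (simp add: pair_word_def length_doubled)

lemma nth_doubled:
  "i < length x \<Longrightarrow> concat (map (\<lambda>b. [b, b]) x) ! (2 * i) = x ! i \<and> concat (map (\<lambda>b. [b, b]) x) ! Suc (2 * i) = x ! i"
proof (induction x arbitrary: i)
  case (Cons a x)
  then show ?case by (cases i) auto
qed simp

lemma one_at_pair_word: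
  "i < length x \<Longrightarrow> one_at (pair_word x u) (2 * i) = x ! i"
  "i < length x \<Longrightarrow> one_at (pair_word x u) (2 * i + 1) = x ! i"
  "\<not> one_at (pair_word x u) (2 * length x)"
  "one_at (pair_word x u) (2 * length x + 1)"
  "one_at (pair_word x u) (2 * length x + 2 + j) = one_at u j"
  using nth_doubled[of i x]
  by (simp_all add: one_at_def length_pair_word pair_word_def nth_append length_doubled)

definition separator :: "bool list \<Rightarrow> nat \<Rightarrow> bool" where
  "separator w m \<longleftrightarrow> (\<forall>i<m. one_at w (2 * i) \<longleftrightarrow> one_at w (2 * i + 1)) \<and>
     \<not> one_at w (2 * m) \<and> one_at w (2 * m + 1)"

text \<open>A smaller \<open>m\<close> fails because the two bits at \<open>2 * m\<close> form a
  doubled bit; a larger one fails because the mark violates the agreement demanded before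
  \<open>m\<close>.\<close>

lemma separator_pair_word: "separator (pair_word x u) m \<longleftrightarrow> m = length x"
proof
  assume m: "separator (pair_word x u) m"
  show "m = length x"
  proof (rule ccontr)
    assume "m \<noteq> length x"
    then consider "m < length x" | "length x < m" by linarith
    then show False
      using m one_at_pair_word(1-4)[where x = x and u = u] unfolding separator_def by cases blast+
  qed
qed (use one_at_pair_word(1-4)[where x = x and u = u] in \<open>simp add: separator_def\<close>)

text \<open>
  \<open>U v c\<close> says that \<open>v\<close> has colour \<open>c\<close>.  No degrees have to be counted: they are equal to the number
  \<open>r\<close> of colours if every vertex has exactly one neighbour of each colour.
\<close>

definition valid_certificate :: "nat \<Rightarrow> (nat \<Rightarrow> nat \<Rightarrow> bool) \<Rightarrow> (nat \<Rightarrow> nat \<Rightarrow> bool) \<Rightarrow> bool" where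
  "valid_certificate n X U \<longleftrightarrow> (\<forall>i<n. \<not> X i i) \<and> (\<forall>i<n. \<forall>j<n. X i j \<longrightarrow> X j i) \<and>
     (\<exists>r<Suc n. 3 \<le> r \<and> (\<forall>v<n. \<exists>c<r. U v c \<and> (\<forall>d<r. U v d \<longrightarrow> d = c)) \<and>
       (\<forall>v<n. \<forall>c<r. \<exists>w<n. X v w \<and> U w c \<and> (\<forall>z<n. X v z \<and> U z c \<longrightarrow> z = w)))"

text \<open>All quantifiers have computable bounds, as decidability by counters requires. The
  certificate begins at \<open>2 * m + 2\<close> and is a matrix with rows of length
  \<open>n\<close>, which is enough since there are at most \<open>n\<close> colours.\<close>

definition certificate_language :: language where
  "certificate_language = {w. \<exists>m<length w. separator w m \<and> (\<exists>n<Suc m. 0 < n \<and> n * n = m \<and>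
     valid_certificate n (\<lambda>i j. one_at w (2 * (i * n + j))) (\<lambda>v c. one_at w (2 * m + 2 + (v * n + c))))}"

lemma class_P_I:
  assumes "checkable (\<lambda>x s. x \<in> L)"
  shows "L \<in> class_P"
proof -
  have "polytime (\<lambda>x. map (\<lambda>_. x \<in> L) [0..<1])"
    by (rule polytime_map[OF computable_one]) (rule assms)
  then show ?thesis by (simp add: class_P_def)
qed

lemma certificate_language_in_P: "certificate_language \<in> class_P"
proof (rule class_P_I)
  show "checkable (\<lambda>x s. x \<in> certificate_language)"
    unfolding certificate_language_def separator_def valid_certificate_def mem_Collect_eq
    by (intro computable_intros checkable_one_at computable_var)
qed

lemma certificate_iff:
  "pair_word x u \<in> certificate_language \<longleftrightarrow> (\<exists>n>0. length x = n * n \<and>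
     valid_certificate n (\<lambda>i j. x ! (i * n + j)) (\<lambda>v c. one_at u (v * n + c)))"
proof -
  have X: "one_at (pair_word x u) (2 * (i * n + j)) = x ! (i * n + j)"
    if "length x = n * n" "i < n" "j < n" for i j n
    using row_index_less[OF that(2,3)] that(1) by (intro one_at_pair_word) simp
  have eq: "valid_certificate n (\<lambda>i j. one_at (pair_word x u) (2 * (i * n + j))) U
      \<longleftrightarrow> valid_certificate n (\<lambda>i j. x ! (i * n + j)) U" if "length x = n * n" for n U
    unfolding valid_certificate_def using X[OF that] by (simp cong: conj_cong imp_cong)
  have bound: "n < Suc (length x)" if "length x = n * n" for n
    unfolding that by (simp add: less_Suc_eq_le)
  have ex_eq: "(\<exists>m<l. m = a \<and> P m) \<longleftrightarrow> a < l \<and> P a" for l a :: nat and P by blast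
  have "pair_word x u \<in> certificate_language \<longleftrightarrow> (\<exists>n<Suc (length x). 0 < n \<and> n * n = length x \<and>
      valid_certificate n (\<lambda>i j. one_at (pair_word x u) (2 * (i * n + j))) (\<lambda>v c. one_at u (v * n + c)))"
    unfolding certificate_language_def mem_Collect_eq separator_pair_word ex_eq one_at_pair_word(5)
    by (simp add: length_pair_word)
  also have "\<dots> \<longleftrightarrow> (\<exists>n<Suc (length x). 0 < n \<and> n * n = length x \<and>
      valid_certificate n (\<lambda>i j. x ! (i * n + j)) (\<lambda>v c. one_at u (v * n + c)))"
    using eq by (intro ex_cong1 conj_cong refl) simp
  also have "\<dots> \<longleftrightarrow> (\<exists>n>0. length x = n * n \<and>
      valid_certificate n (\<lambda>i j. x ! (i * n + j)) (\<lambda>v c. one_at u (v * n + c)))"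
    using bound by (intro ex_cong1) auto
  finally show ?thesis .
qed

lemma regular_injective_coloring_in_NP: "regular_injective_coloring \<in> class_NP"
proof -
  have "x \<in> regular_injective_coloring \<longleftrightarrow>
     (\<exists>u. length u \<le> poly [:0, 1:] (length x) \<and> pair_word x u \<in> certificate_language)" for x
  proof
    assume "x \<in> regular_injective_coloring"
    then obtain n r :: nat and f :: "nat \<Rightarrow> nat" where n: "n > 0" and len: "length x = n * n" and loop: "\<forall>i<n. \<not> x ! (i * n + i)"
      and sym: "\<forall>i<n. \<forall>j<n. x ! (i * n + j) \<longrightarrow> x ! (j * n + i)"
      and r: "r \<ge> 3" and f: "\<forall>v<n. f v < r \<and> (\<forall>c<r. \<exists>!w. w < n \<and> x ! (v * n + w) \<and> f w = c)"
      unfolding regular_injective_coloring_iff by (elim exE conjE) (rule that; assumption)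
    \<comment> \<open>The certificate has as many bits as the adjacency matrix, so the identity
      polynomial bounds its length.\<close>
    define u where "u = concat (map (\<lambda>v. map (\<lambda>c. f v = c) [0..<n]) [0..<n])"
    \<comment> \<open>Every colour occurs among the neighbours of vertex 0.\<close>
    have rn: "r \<le> n"
    proof -
      have "\<forall>c<r. \<exists>w<n. f w = c" using f n by blast
      then have "{..<r} \<subseteq> f ` {..<n}" by blast
      from surj_card_le[OF _ this] show ?thesis by simp
    qed
    have U: "one_at u (v * n + c) \<longleftrightarrow> f v = c" if "v < n" "c < r" for v c
      using that rn row_index_less[of v n c n] unfolding one_at_def u_def by (simp add: nth_concat_rows)
    have A: "\<exists>c<r. one_at u (v * n + c) \<and> (\<forall>d<r. one_at u (v * n + d) \<longrightarrow> d = c)" if v: "v < n" for v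
      using U[OF v] f v by (intro exI[of _ "f v"]) auto
    have B: "\<exists>w<n. x ! (v * n + w) \<and> one_at u (w * n + c) \<and>
          (\<forall>z<n. x ! (v * n + z) \<and> one_at u (z * n + c) \<longrightarrow> z = w)" if vc: "v < n" "c < r" for v c
    proof -
      have "\<exists>!w. w < n \<and> x ! (v * n + w) \<and> f w = c" using f vc by simp
      then obtain w where w: "w < n \<and> x ! (v * n + w) \<and> f w = c"
        and *: "\<And>z. z < n \<and> x ! (v * n + z) \<and> f z = c \<Longrightarrow> z = w"
        by (elim ex1E) blast
      show ?thesis
      proof (intro exI[of _ w] conjI allI impI)
        fix z assume "z < n" "x ! (v * n + z) \<and> one_at u (z * n + c)"
        then show "z = w" using U[of z c] vc(2) by (intro *) simp
      qed (use w U[of w c] vc(2) in simp_all)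
    qed
    have "r < Suc n \<and> 3 \<le> r \<and> (\<forall>v<n. \<exists>c<r. one_at u (v * n + c) \<and> (\<forall>d<r. one_at u (v * n + d) \<longrightarrow> d = c)) \<and>
        (\<forall>v<n. \<forall>c<r. \<exists>w<n. x ! (v * n + w) \<and> one_at u (w * n + c) \<and>
          (\<forall>z<n. x ! (v * n + z) \<and> one_at u (z * n + c) \<longrightarrow> z = w))"
      by (intro conjI allI impI A B) (use r rn in auto)
    then have "valid_certificate n (\<lambda>i j. x ! (i * n + j)) (\<lambda>v c. one_at u (v * n + c))"
      unfolding valid_certificate_def by (intro conjI loop sym, intro exI)
    then have "pair_word x u \<in> certificate_language"
      unfolding certificate_iff using n len by blast
    moreover have "length u \<le> poly [:0, 1:] (length x)" by (simp add: u_def len)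
    ultimately show "\<exists>u. length u \<le> poly [:0, 1:] (length x) \<and> pair_word x u \<in> certificate_language"
      by blast
  next
    assume "\<exists>u. length u \<le> poly [:0, 1:] (length x) \<and> pair_word x u \<in> certificate_language"
    then obtain u n where n: "n > 0" "length x = n * n"
      and v: "valid_certificate n (\<lambda>i j. x ! (i * n + j)) (\<lambda>v c. one_at u (v * n + c))"
      unfolding certificate_iff by blast
    let ?X = "\<lambda>v w. x ! (v * n + w)" and ?U = "\<lambda>v c. one_at u (v * n + c)"
    obtain r where r: "3 \<le> r" "\<forall>v<n. \<exists>c<r. ?U v c \<and> (\<forall>d<r. ?U v d \<longrightarrow> d = c)"
        "\<forall>v<n. \<forall>c<r. \<exists>w<n. ?X v w \<and> ?U w c \<and> (\<forall>z<n. ?X v z \<and> ?U z c \<longrightarrow> z = w)"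
      using v unfolding valid_certificate_def by (elim conjE exE) (rule that; assumption)
    then obtain f where f: "\<And>v. v < n \<Longrightarrow> f v < r \<and> ?U v (f v) \<and> (\<forall>d<r. ?U v d \<longrightarrow> d = f v)"
      by metis
    then have U: "?U v c \<longleftrightarrow> f v = c" if "v < n" "c < r" for v c using that by blast
    have "\<exists>!w. w < n \<and> ?X v w \<and> f w = c" if "v < n" "c < r" for v c
    proof -
      obtain w where w: "w < n" "?X v w" "?U w c" "\<forall>z<n. ?X v z \<and> ?U z c \<longrightarrow> z = w"
        using r(3) \<open>v < n\<close> \<open>c < r\<close> by blast
      show ?thesis
      proof (rule ex1I[of _ w])
        show "w < n \<and> ?X v w \<and> f w = c" using w(1-3) U[OF w(1) \<open>c < r\<close>] by blast
        show "z = w" if "z < n \<and> ?X v z \<and> f z = c" for z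
          using that w(4) U[of z c] \<open>c < r\<close> by blast
      qed
    qed
    with f have "\<forall>v<n. f v < r \<and> (\<forall>c<r. \<exists>!w. w < n \<and> ?X v w \<and> f w = c)" by blast
    with r(1) have "\<exists>r\<ge>3. \<exists>f :: nat \<Rightarrow> nat. \<forall>v<n. f v < r \<and> (\<forall>c<r. \<exists>!w. w < n \<and> ?X v w \<and> f w = c)"
      by (intro exI[of _ r] conjI exI[of _ f])
    moreover have "\<forall>i<n. \<not> ?X i i" "\<forall>i<n. \<forall>j<n. ?X i j \<longrightarrow> ?X j i"
      using v unfolding valid_certificate_def by blast+
    ultimately show "x \<in> regular_injective_coloring"
      unfolding regular_injective_coloring_iff using n by - (rule exI[of _ n], intro conjI)
  qed
  then show ?thesis unfolding class_NP_def using certificate_language_in_P by blast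
qed

section \<open>From rainbow colourings of hypergraphs to injective colourings\<close>

text \<open>The same \<open>r\<close> is the number of colours, of blocks and of points in a block.
  In the graph built below the number of blocks becomes the degree of the copies, and the block size
  the degree of the classes.\<close>

definition rainbow_colorable :: "nat \<Rightarrow> nat \<Rightarrow> (nat \<Rightarrow> nat \<Rightarrow> nat) \<Rightarrow> bool" where
  "rainbow_colorable r N slot \<longleftrightarrow>
     (\<exists>\<chi>. (\<forall>q<N. \<chi> q < r) \<and> (\<forall>b<r. inj_on (\<lambda>i. \<chi> (slot b i)) {..<r}))"

text \<open>
  \<open>slot b\<close> enumerates the \<open>r\<close> points of block \<open>b\<close>.  The pair \<open>(q, l)\<close> is copy \<open>l\<close> of point \<open>q\<close>.  The
  pair \<open>(p, b)\<close> is a class of the \<open>b\<close>-th partition of these copies: if \<open>p = slot b l\<close>, it is the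
  \<open>l\<close>-th copy of block \<open>b\<close>, and if \<open>p\<close> is not in block \<open>b\<close>, it consists of all copies of \<open>p\<close>.
\<close>

definition incident :: "nat \<Rightarrow> (nat \<Rightarrow> nat \<Rightarrow> nat) \<Rightarrow> nat \<Rightarrow> nat \<Rightarrow> nat \<Rightarrow> nat \<Rightarrow> bool" where
  "incident r slot q l p b \<longleftrightarrow> p = (if \<exists>j<r. q = slot b j then slot b l else q)"

lemma incident_block: "j < r \<Longrightarrow> incident r slot (slot b j) l p b \<longleftrightarrow> p = slot b l"
  unfolding incident_def by auto

text \<open>Copy \<open>(q, l)\<close> is vertex \<open>q * r + l\<close>, and class
  \<open>(p, b)\<close> is vertex \<open>N * r + (p * r + b)\<close>. The two disjuncts symmetrise
  the incidence relation.\<close>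

definition adjacent :: "nat \<Rightarrow> nat \<Rightarrow> (nat \<Rightarrow> nat \<Rightarrow> nat) \<Rightarrow> nat \<Rightarrow> nat \<Rightarrow> bool" where
  "adjacent r N slot v w \<longleftrightarrow>
     v < N * r \<and> N * r \<le> w \<and> incident r slot (v div r) (v mod r) ((w - N * r) div r) ((w - N * r) mod r) \<or>
     w < N * r \<and> N * r \<le> v \<and> incident r slot (w div r) (w mod r) ((v - N * r) div r) ((v - N * r) mod r)"

lemma div_less_of_less_mult: "v < N * r \<Longrightarrow> v div r < (N :: nat)"
  by (simp add: less_mult_imp_div_less)

definition exact_coloring :: "nat \<Rightarrow> (nat \<Rightarrow> nat \<Rightarrow> bool) \<Rightarrow> nat \<Rightarrow> (nat \<Rightarrow> nat) \<Rightarrow> bool" where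
  "exact_coloring n A r f \<longleftrightarrow> (\<forall>v<n. f v < r \<and> (\<forall>c<r. \<exists>!w. w < n \<and> A v w \<and> f w = c))"

text \<open>The colouring maps the neighbourhood bijectively to the colours. So the number of
  colours of an unknown exact colouring can be read off a single vertex.\<close>

lemma exact_coloring_degree:
  assumes "exact_coloring n A r f" "v < n"
  shows "card {w. w < n \<and> A v w} = r"
proof -
  have ex: "\<exists>!w. w < n \<and> A v w \<and> f w = c" if "c < r" for c
    using assms that unfolding exact_coloring_def by blast
  have less: "f w < r" if "w < n" for w using assms(1) that unfolding exact_coloring_def by blast
  have "bij_betw f {w. w < n \<and> A v w} {..<r}"
  proof (rule bij_betw_imageI)
    show "inj_on f {w. w < n \<and> A v w}"
    proof (rule inj_onI)
      fix w z assume w: "w \<in> {w. w < n \<and> A v w}" and z: "z \<in> {w. w < n \<and> A v w}" and eq: "f w = f z"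
      have "\<exists>!y. y < n \<and> A v y \<and> f y = f z" using less z by (intro ex) simp
      moreover have "w < n \<and> A v w \<and> f w = f z" "z < n \<and> A v z \<and> f z = f z" using w z eq by simp_all
      ultimately show "w = z" by (elim ex1E) metis
    qed
    show "f ` {w. w < n \<and> A v w} = {..<r}"
    proof (intro equalityI subsetI)
      fix c assume "c \<in> {..<r}"
      then obtain w where "w < n \<and> A v w \<and> f w = c" using ex1_implies_ex[OF ex[of c]] by auto
      then show "c \<in> f ` {w. w < n \<and> A v w}" by blast
    qed (use less in auto)
  qed
  then show ?thesis using bij_betw_same_card by fastforce
qed

lemma exact_coloring_inj:
  assumes "exact_coloring n A r f" "v < n" "A v w" "A v z" "w < n" "z < n" "f w = f z"
  shows "w = z"
proof -
  have "f z < r" using assms(1,6) unfolding exact_coloring_def by blast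
  then have "\<exists>!y. y < n \<and> A v y \<and> f y = f z" using assms(1,2) unfolding exact_coloring_def by blast
  moreover have "w < n \<and> A v w \<and> f w = f z" "z < n \<and> A v z \<and> f z = f z" using assms by simp_all
  ultimately show ?thesis by (elim ex1E) metis
qed

text \<open>The solution is \<open>c - a\<close> modulo \<open>r\<close>, with \<open>r - a\<close>
  in place of \<open>- a\<close> to remain in the natural numbers.\<close>

lemma mod_add_shift:
  fixes a c r :: nat
  assumes "c < r" "a < r"
  obtains l where "l < r" "(a + l) mod r = c" "\<And>l'. l' < r \<Longrightarrow> (a + l') mod r = c \<Longrightarrow> l' = l"
proof
  let ?l = "(c + (r - a)) mod r"
  show "?l < r" using assms by simp
  have "(a + ?l) mod r = (a + (c + (r - a))) mod r" by (rule mod_add_right_eq)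
  also have "a + (c + (r - a)) = c + r" using assms(2) by simp
  finally show "(a + ?l) mod r = c" using assms by simp
  show "l = ?l" if "l < r" "(a + l) mod r = c" for l
  proof -
    have "?l = ((a + l) mod r + (r - a)) mod r" using that by simp
    also have "\<dots> = (a + l + (r - a)) mod r" by (rule mod_add_left_eq)
    also have "a + l + (r - a) = l + r" using assms(2) by simp
    finally show ?thesis using that by simp
  qed
qed

text \<open>The copies of a point are coloured by shifting its colour modulo \<open>r\<close>, the classes by their partition.\<close>

lemma exact_coloring_adjacent:
  assumes slot: "\<And>b i. b < r \<Longrightarrow> i < r \<Longrightarrow> slot b i < N"
    and inj: "\<And>b. b < r \<Longrightarrow> inj_on (slot b) {..<r}" and r: "0 < r"
    and col: "rainbow_colorable r N slot"
  shows "\<exists>f. exact_coloring (2 * (N * r)) (adjacent r N slot) r f"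
proof -
  obtain \<chi> where \<chi>: "\<And>q. q < N \<Longrightarrow> \<chi> q < r" "\<And>b. b < r \<Longrightarrow> inj_on (\<lambda>i. \<chi> (slot b i)) {..<r}"
    using col unfolding rainbow_colorable_def by blast
  let ?M = "N * r"
  define f where "f v = (if v < ?M then (\<chi> (v div r) + v mod r) mod r else (v - ?M) mod r)" for v
  have surj: "\<exists>j<r. \<chi> (slot b j) = c" if "b < r" "c < r" for b c
  proof -
    have "(\<lambda>i. \<chi> (slot b i)) ` {..<r} \<subseteq> {..<r}" using \<chi>(1) slot that by auto
    then have "(\<lambda>i. \<chi> (slot b i)) ` {..<r} = {..<r}"
      using \<chi>(2)[OF that(1)] by (intro endo_inj_surj) auto
    then show ?thesis using that(2) by (metis (no_types, lifting) imageE lessThan_iff)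
  qed
  have "\<exists>!w. w < 2 * ?M \<and> adjacent r N slot v w \<and> f w = c" if v: "v < 2 * ?M" and c: "c < r" for v c
  proof (cases "v < ?M")
    case True
    define q l where "q = v div r" and "l = v mod r"
    \<comment> \<open>\<open>p\<close> names the class containing the copy in partition
      \<open>c\<close>; as classes are coloured by their partition, this is the only neighbour of
      colour \<open>c\<close>.\<close>
    define p where "p = (if \<exists>j<r. q = slot c j then slot c l else q)"
    have l: "l < r" using r by (simp add: l_def)
    have q: "q < N" using True by (simp add: q_def div_less_of_less_mult)
    have p: "p < N" using slot[OF c l] q by (simp add: p_def)
    show ?thesis
    proof (rule ex1I[of _ "?M + (p * r + c)"])
      have "p * r + c < ?M" using row_index_less[OF p c] .
      then show "?M + (p * r + c) < 2 * ?M \<and> adjacent r N slot v (?M + (p * r + c)) \<and> f (?M + (p * r + c)) = c"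
        using True c by (simp add: adjacent_def f_def incident_def p_def[symmetric] q_def[symmetric] l_def[symmetric])
    next
      fix w assume w: "w < 2 * ?M \<and> adjacent r N slot v w \<and> f w = c"
      then have "?M \<le> w" and wc: "(w - ?M) mod r = c" and inc: "incident r slot q l ((w - ?M) div r) ((w - ?M) mod r)"
        using True by (auto simp: adjacent_def f_def q_def l_def)
      have "(w - ?M) div r = p" using inc unfolding incident_def p_def wc .
      then have "w - ?M = p * r + c" using wc div_mult_mod_eq[of "w - ?M" r] by simp
      then show "w = ?M + (p * r + c)" using \<open>?M \<le> w\<close> by simp
    qed
  next
    case False
    define p b where "p = (v - ?M) div r" and "b = (v - ?M) mod r"
    have b: "b < r" using r by (simp add: b_def)
    have p: "p < N" using v False by (simp add: p_def less_mult_imp_div_less)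
    have adj: "adjacent r N slot v w \<longleftrightarrow> w < ?M \<and> incident r slot (w div r) (w mod r) p b" for w
      using False by (auto simp: adjacent_def p_def b_def)
    show ?thesis
    proof (cases "\<exists>j<r. p = slot b j")
      case inS: True
      \<comment> \<open>The class is the \<open>i\<close>-th copy of block \<open>b\<close>, whose
        members have the colours of the block shifted by \<open>i\<close>. The wanted one has
        original colour \<open>e\<close>, and exactly one point of the rainbow block has it.\<close>
      then obtain i where i: "i < r" "p = slot b i" by blast
      obtain e where e: "e < r" "(i + e) mod r = c" and eu: "\<And>e'. e' < r \<Longrightarrow> (i + e') mod r = c \<Longrightarrow> e' = e"
        by (rule mod_add_shift[OF c i(1)]) (rule that)
      obtain j where j: "j < r" "\<chi> (slot b j) = e" using surj[OF b e(1)] by blast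
      show ?thesis
      proof (rule ex1I[of _ "slot b j * r + i"])
        have "slot b j * r + i < ?M" using row_index_less[OF slot[OF b j(1)] i(1)] .
        then show "slot b j * r + i < 2 * ?M \<and> adjacent r N slot v (slot b j * r + i) \<and> f (slot b j * r + i) = c"
          using i j e unfolding adj by (simp add: incident_block f_def add.commute)
      next
        fix w assume w: "w < 2 * ?M \<and> adjacent r N slot v w \<and> f w = c"
        then have wM: "w < ?M" and inc: "incident r slot (w div r) (w mod r) p b" and fw: "f w = c" by (auto simp: adj)
        have "\<exists>j<r. w div r = slot b j"
        proof (rule ccontr)
          assume notin: "\<not> (\<exists>j<r. w div r = slot b j)"
          then have "p = w div r" using inc unfolding incident_def by (simp only: if_False)
          with inS notin show False by simp
        qed
        then obtain j' where j': "j' < r" "w div r = slot b j'" by blast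
        then have "p = slot b (w mod r)" using inc by (simp add: incident_block)
        then have wi: "w mod r = i" using inj[OF b] i r by (auto dest: inj_onD)
        have "\<chi> (slot b j') = e" using fw wM wi j' \<chi>(1)[OF slot[OF b j'(1)]] by (intro eu) (simp_all add: f_def add.commute)
        then have "j' = j" using \<chi>(2)[OF b] j j'(1) by (auto dest: inj_onD)
        then show "w = slot b j * r + i" using j'(2) wi div_mult_mod_eq[of w r] by simp
      qed
    next
      \<comment> \<open>The class consists of all copies of \<open>p\<close>, and exactly one shift
        \<open>l\<close> takes the colour of \<open>p\<close> to \<open>c\<close>.\<close>
      case notS: False
      obtain l where l: "l < r" "(\<chi> p + l) mod r = c" and lu: "\<And>l'. l' < r \<Longrightarrow> (\<chi> p + l') mod r = c \<Longrightarrow> l' = l"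
        by (rule mod_add_shift[OF c \<chi>(1)[OF p]]) (rule that)
      show ?thesis
      proof (rule ex1I[of _ "p * r + l"])
        have "p * r + l < ?M" using row_index_less[OF p l(1)] .
        then show "p * r + l < 2 * ?M \<and> adjacent r N slot v (p * r + l) \<and> f (p * r + l) = c"
          using l notS unfolding adj by (simp add: incident_def f_def)
      next
        fix w assume w: "w < 2 * ?M \<and> adjacent r N slot v w \<and> f w = c"
        then have wM: "w < ?M" and inc: "incident r slot (w div r) (w mod r) p b" and fw: "f w = c" by (auto simp: adj)
        have "\<not> (\<exists>j<r. w div r = slot b j)"
        proof
          assume "\<exists>j<r. w div r = slot b j"
          then have "p = slot b (w mod r)" using inc unfolding incident_def by (simp only: if_True)
          then show False using notS mod_less_divisor[OF r, of w] by blast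
        qed
        then have wp: "w div r = p" using inc unfolding incident_def by (simp only: if_False)
        then have "w mod r = l" using fw wM r by (intro lu) (simp_all add: f_def)
        then show "w = p * r + l" using wp div_mult_mod_eq[of w r] by simp
      qed
    qed
  qed
  moreover have "f v < r" for v using r by (simp add: f_def)
  ultimately show ?thesis unfolding exact_coloring_def by (intro exI[of _ f]) simp
qed

text \<open>Class \<open>(slot b 0, b)\<close> consists of copy 0 of each point of block
  \<open>b\<close>. Hence the colours of the copies 0 form a rainbow colouring, and the degree
  \<open>r\<close> of such a class, taken for \<open>b = 0\<close>, determines the number
  \<open>d\<close> of colours.\<close>

lemma rainbow_colorable_of_exact_coloring:
  assumes slot: "\<And>b i. b < r \<Longrightarrow> i < r \<Longrightarrow> slot b i < N"
    and inj: "\<And>b. b < r \<Longrightarrow> inj_on (slot b) {..<r}" and r: "0 < r"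
    and f: "exact_coloring (2 * (N * r)) (adjacent r N slot) d f"
  shows "d = r \<and> rainbow_colorable r N slot"
proof
  let ?M = "N * r"
  let ?v = "\<lambda>b. ?M + (slot b 0 * r + b)"
  have v: "?v b < 2 * ?M" if "b < r" for b
    using row_index_less[OF slot[OF that r] that] by simp
  have nb: "adjacent r N slot (?v b) (slot b j * r)" if "b < r" "j < r" for b j
    using that row_index_less[OF slot[OF that] r] r by (auto simp: adjacent_def incident_def)
  have M: "slot b j * r < 2 * ?M" if "b < r" "j < r" for b j
    using row_index_less[OF slot[OF that] r] by simp
  have "{w. w < 2 * ?M \<and> adjacent r N slot (?v 0) w} = (\<lambda>j. slot 0 j * r) ` {..<r}"
  proof (intro equalityI subsetI)
    fix w assume "w \<in> {w. w < 2 * ?M \<and> adjacent r N slot (?v 0) w}"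
    then have inc: "incident r slot (w div r) (w mod r) (slot 0 0) 0"
      using r by (auto simp: adjacent_def)
    have "\<exists>j<r. w div r = slot 0 j" using inc r unfolding incident_def by (metis (full_types))
    then obtain j where j: "j < r" "w div r = slot 0 j" by blast
    then have "slot 0 0 = slot 0 (w mod r)" using inc by (simp add: incident_block)
    then have "w mod r = 0" using inj[OF r] r by (auto dest: inj_onD)
    then have "w = slot 0 j * r" using j(2) div_mult_mod_eq[of w r] by simp
    with j(1) show "w \<in> (\<lambda>j. slot 0 j * r) ` {..<r}" by blast
  qed (use nb[OF r] M[OF r] in auto)
  moreover have "inj_on (\<lambda>j. slot 0 j * r) {..<r}"
    using inj[OF r] r by (auto simp: inj_on_def)
  ultimately show "d = r"
    using exact_coloring_degree[OF f v[OF r]] by (simp add: card_image)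
  show "rainbow_colorable r N slot"
    unfolding rainbow_colorable_def
  proof (intro exI[of _ "\<lambda>q. f (q * r)"] conjI allI impI)
    fix q assume "q < N"
    then have "q * r < 2 * ?M" using row_index_less[OF \<open>q < N\<close> r] by simp
    then have "f (q * r) < d" using f unfolding exact_coloring_def by blast
    then show "f (q * r) < r" by (simp add: \<open>d = r\<close>)
  next
    fix b assume b: "b < r"
    show "inj_on (\<lambda>i. f (slot b i * r)) {..<r}"
    proof (rule inj_onI)
      fix i j assume ij: "i \<in> {..<r}" "j \<in> {..<r}" "f (slot b i * r) = f (slot b j * r)"
      then have "slot b i * r = slot b j * r"
        using exact_coloring_inj[OF f v[OF b] nb[OF b, of i] nb[OF b, of j] M[OF b, of i] M[OF b, of j]] by simp
      then show "i = j" using inj[OF b] ij r by (auto dest: inj_onD)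
    qed
  qed
qed

lemma matrix_in_language_iff:
  assumes "\<And>v. \<not> A v v" "\<And>v w. A v w \<longleftrightarrow> A w v"
  shows "map (\<lambda>e. A (e div n) (e mod n)) [0..<n * n] \<in> regular_injective_coloring \<longleftrightarrow>
    0 < n \<and> (\<exists>r\<ge>3. \<exists>f. exact_coloring n A r f)"
proof -
  let ?x = "map (\<lambda>e. A (e div n) (e mod n)) [0..<n * n]"
  have nth: "?x ! (i * n + j) = A i j" if "i < n" "j < n" for i j
    using row_index_less[OF that] that by simp
  have sq: "length ?x = k * k \<longleftrightarrow> k = n" for k
    by (auto simp flip: power2_eq_square)
  have ex_eq: "(\<exists>k>0. k = n \<and> P k) \<longleftrightarrow> 0 < n \<and> P n" for P by blast
  have irr: "\<forall>i<n. \<not> ?x ! (i * n + i)" using assms(1) nth by simp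
  have sym: "\<forall>i<n. \<forall>j<n. ?x ! (i * n + j) \<longrightarrow> ?x ! (j * n + i)" using assms(2) nth by simp
  have "(w < n \<and> ?x ! (v * n + w) \<and> f w = c) \<longleftrightarrow> (w < n \<and> A v w \<and> f w = c)"
    if "v < n" for v w c and f :: "nat \<Rightarrow> nat"
    using nth[OF that, of w] by blast
  then have col: "(\<forall>v<n. f v < r \<and> (\<forall>c<r. \<exists>!w. w < n \<and> ?x ! (v * n + w) \<and> f w = c)) \<longleftrightarrow> exact_coloring n A r f"
    for f and r :: nat
    unfolding exact_coloring_def by (intro all_cong1 imp_cong conj_cong refl arg_cong[of _ _ Ex1] ext) auto
  show ?thesis
    unfolding regular_injective_coloring_iff sq ex_eq col using irr sym by blast
qed

section \<open>From satisfiability to rainbow colourings\<close>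

text \<open>
  Literals \<open>2 * x\<close> and \<open>2 * x + 1\<close> are the positive and the negative literal of variable \<open>x\<close>.  An empty
  clause imposes no condition.
\<close>

definition satisfiable :: "nat \<Rightarrow> nat \<Rightarrow> (nat \<Rightarrow> nat \<Rightarrow> bool) \<Rightarrow> bool" where
  "satisfiable k m lit \<longleftrightarrow> (\<exists>\<alpha>. \<forall>c<m. (\<exists>i<2 * k. lit c i) \<longrightarrow>
     (\<exists>i<2 * k. lit c i \<and> (\<alpha> (i div 2) \<longleftrightarrow> even i)))"

text \<open>These are the lists of a list-colouring instance with literals as colours; its graph is
  complete bipartite between clause points and variable points.\<close>

definition listed :: "nat \<Rightarrow> (nat \<Rightarrow> nat \<Rightarrow> bool) \<Rightarrow> nat \<Rightarrow> nat \<Rightarrow> bool" where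
  "listed k lit y i \<longleftrightarrow> (if y < k then i div 2 = y else i < 2 * k \<and> lit (y - k) i)"

text \<open>Room for \<open>k + m\<close> list blocks, one palette block and \<open>m * k\<close>
  separating blocks; the rest ensures that all \<open>2 * k\<close> literals and one further colour
  are available, and that \<open>r \<ge> 3\<close>.\<close>

definition cnf_colors :: "nat \<Rightarrow> nat \<Rightarrow> nat" where
  "cnf_colors k m = k + m + 1 + m * k + 2 * k + 3"

text \<open>
  The points are \<open>r * r\<close> dummies, \<open>r\<close> palette points and up to \<open>r\<close> points for variables and
  clauses, in this order.  Block \<open>b < k + m\<close> keeps point \<open>b\<close> off the palette colours that are not
  listed for it, block \<open>k + m\<close> is the palette, and the further blocks separate each clause point
  from each variable point.  Dummies \<open>b * r + i\<close> pad block \<open>b\<close> to size \<open>r\<close>.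
\<close>

definition cnf_slot :: "nat \<Rightarrow> nat \<Rightarrow> (nat \<Rightarrow> nat \<Rightarrow> bool) \<Rightarrow> nat \<Rightarrow> nat \<Rightarrow> nat \<Rightarrow> nat" where
  "cnf_slot k m lit r b i =
    (if b < k + m then
       if \<not> listed k lit b i then r * r + i
       else if \<exists>j<i. listed k lit b j then b * r + i
       else r * r + r + b
     else if b = k + m then r * r + i
     else if b - (k + m + 1) < m * k \<and> i = 0 then r * r + r + (k + (b - (k + m + 1)) div k)
     else if b - (k + m + 1) < m * k \<and> i = 1 then r * r + r + (b - (k + m + 1)) mod k
     else b * r + i)"

lemma block_index:
  assumes "e < m * (k :: nat)"
  shows "e div k < m" "e mod k < k"
proof -
  have "0 < k" using assms by (cases k) auto
  then show "e mod k < k" "e div k < m" using assms by (simp_all add: less_mult_imp_div_less)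
qed

lemma cnf_slot_cases:
  obtains "cnf_slot k m lit r b i = b * r + i" | "cnf_slot k m lit r b i = r * r + i"
    | y where "y < k + m" "cnf_slot k m lit r b i = r * r + r + y"
proof -
  have *: "(b - (k + m + 1)) div k < m \<and> (b - (k + m + 1)) mod k < k" if "b - (k + m + 1) < m * k"
    using block_index[OF that] by blast
  show ?thesis
    using that unfolding cnf_slot_def using * by (smt (verit) add_less_mono1 add.commute trans_less_add1)
qed

text \<open>The number of points is made up of \<open>r * r\<close> dummies, \<open>r\<close>
  palette points and room for \<open>r\<close> variable and clause points.\<close>

lemma cnf_slot_less:
  assumes "r = cnf_colors k m" "b < r" "i < r"
  shows "cnf_slot k m lit r b i < (r + 2) * r"
proof -
  have *: "b * r + i < r * r" using assms(2,3) by (rule row_index_less)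
  have r: "k + m < r" using assms(1) by (simp add: cnf_colors_def)
  have eq: "(r + 2) * r = r * r + r + r" by (simp add: algebra_simps)
  show ?thesis
    using * r assms(3) unfolding eq by (cases rule: cnf_slot_cases[of k m lit r b i]) linarith+
qed

lemma cnf_slot_edge:
  assumes "c < m" "x < k"
  shows "cnf_slot k m lit r (k + m + 1 + (c * k + x)) 0 = r * r + r + (k + c)"
    and "cnf_slot k m lit r (k + m + 1 + (c * k + x)) 1 = r * r + r + x"
proof -
  have "(c * k + x) div k = c" "(c * k + x) mod k = x" "c * k + x < m * k"
    using assms row_index_less[OF assms] by simp_all
  moreover have "\<not> k + m + 1 + e < k + m" "k + m + 1 + e \<noteq> k + m" "k + m + 1 + e - (k + m + 1) = e" for e
    by simp_all
  ultimately show "cnf_slot k m lit r (k + m + 1 + (c * k + x)) 0 = r * r + r + (k + c)"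
      "cnf_slot k m lit r (k + m + 1 + (c * k + x)) 1 = r * r + r + x"
    unfolding cnf_slot_def by (simp_all only: if_True if_False simp_thms one_neq_zero)
qed

lemma cnf_slot_list:
  assumes "b < k + m"
  shows "\<not> listed k lit b i \<Longrightarrow> cnf_slot k m lit r b i = r * r + i"
    and "listed k lit b i \<Longrightarrow> \<not> (\<exists>j<i. listed k lit b j) \<Longrightarrow> cnf_slot k m lit r b i = r * r + r + b"
    and "listed k lit b i \<Longrightarrow> \<exists>j<i. listed k lit b j \<Longrightarrow> cnf_slot k m lit r b i = b * r + i"
  using assms unfolding cnf_slot_def by (simp_all only: if_True if_False not_True_eq_False not_False_eq_True)

text \<open>Dummies, palette and points occupy disjoint ranges. In a list block only the first
  listed slot holds the point; in a separating block the two points lie on different sides of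
  \<open>k\<close>.\<close>

lemma cnf_slot_inj:
  assumes "r = cnf_colors k m" "b < r"
  shows "inj_on (cnf_slot k m lit r b) {..<r}"
proof (rule linorder_inj_onI)
  fix i j assume ij: "i < j" "i \<in> {..<r}" "j \<in> {..<r}"
  have i: "b * r + i < r * r" "i < r" using assms(2) ij row_index_less by auto
  have j: "b * r + j < r * r" "j < r" using assms(2) ij row_index_less by auto
  have e: "(b - (k + m + 1)) mod k < k" if "b - (k + m + 1) < m * k"
    using block_index[OF that] by blast
  consider (lst) "b < k + m" | (pal) "b = k + m" | (edge) "k + m < b" by linarith
  then show "cnf_slot k m lit r b i \<noteq> cnf_slot k m lit r b j"
  proof cases
    case lst
    have "cnf_slot k m lit r b i = r * r + r + b \<Longrightarrow> listed k lit b j \<Longrightarrow> cnf_slot k m lit r b j = b * r + j"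
      using lst ij i j unfolding cnf_slot_def by (auto split: if_splits)
    then show ?thesis using lst i j ij(1) unfolding cnf_slot_def by (auto split: if_splits)
  next
    case pal
    then show ?thesis using ij by (simp add: cnf_slot_def)
  next
    case edge
    then show ?thesis using i j ij(1) e unfolding cnf_slot_def by (auto split: if_splits)
  qed
qed auto

text \<open>Completes a partial rainbow colouring of a block: as many colours as slots
  remain.\<close>

lemma inj_extension:
  fixes g :: "nat \<Rightarrow> nat"
  assumes "S \<subseteq> {..<r}" "inj_on g S" "g ` S \<subseteq> {..<r}"
  obtains h where "inj_on h {..<r}" "h ` {..<r} \<subseteq> {..<r}" "\<And>i. i \<in> S \<Longrightarrow> h i = g i"
proof -
  have fin: "finite S" using assms(1) finite_subset by blast
  have "card ({..<r} - S) = card ({..<r} - g ` S)"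
    using assms fin by (simp add: card_Diff_subset card_image)
  then obtain f where f: "bij_betw f ({..<r} - S) ({..<r} - g ` S)"
    using finite_same_card_bij[of "{..<r} - S" "{..<r} - g ` S"] by auto
  let ?h = "\<lambda>i. if i \<in> S then g i else f i"
  have "bij_betw ?h S (g ` S)" using assms(2) by (simp add: bij_betw_def inj_on_def)
  moreover have "bij_betw ?h ({..<r} - S) ({..<r} - g ` S)"
    using f by (rule bij_betw_cong[THEN iffD1, rotated]) simp
  ultimately have "bij_betw ?h (S \<union> ({..<r} - S)) (g ` S \<union> ({..<r} - g ` S))"
    by (rule bij_betw_combine) auto
  moreover have "S \<union> ({..<r} - S) = {..<r}" "g ` S \<union> ({..<r} - g ` S) = {..<r}" using assms by auto
  ultimately have "bij_betw ?h {..<r} {..<r}" by simp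
  then show ?thesis by (intro that[of ?h]) (auto simp: bij_betw_def)
qed

text \<open>Palette point \<open>i\<close> gets colour \<open>i\<close>, and the points get
  \<open>base\<close>. Only dummies are left, and each of them lies in a single block, so every
  block is completed on its own.\<close>

lemma satisfiable_imp_rainbow:
  assumes r: "r = cnf_colors k m" and sat: "satisfiable k m lit"
  shows "rainbow_colorable r ((r + 2) * r) (cnf_slot k m lit r)"
proof -
  have rk: "2 * k < r" "0 < r" by (simp_all add: r cnf_colors_def)
  obtain \<alpha> where \<alpha>: "\<And>c. c < m \<Longrightarrow> \<exists>i<2 * k. lit c i \<Longrightarrow> \<exists>i<2 * k. lit c i \<and> (\<alpha> (i div 2) \<longleftrightarrow> even i)"
    using sat unfolding satisfiable_def by blast
  define good where "good c i \<longleftrightarrow> i < 2 * k \<and> lit c i \<and> (\<alpha> (i div 2) \<longleftrightarrow> even i)" for c i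
  \<comment> \<open>A variable gets its false literal, a clause one of its true literals. An empty
    clause gets \<open>2 * k\<close>, which is no literal and so differs from the colours of all
    variable points.\<close>
  define base where "base y = (if y < k then if \<alpha> y then 2 * y + 1 else 2 * y
      else if \<exists>i<2 * k. lit (y - k) i then SOME i. good (y - k) i else 2 * k)" for y
  have base_good: "good c (base (k + c))" if "c < m" "\<exists>i<2 * k. lit c i" for c
  proof -
    have "\<exists>i. good c i" using \<alpha>[OF that] by (auto simp: good_def)
    then have "good c (SOME i. good c i)" by (rule someI_ex)
    then show ?thesis using that(2) by (simp add: base_def)
  qed
  have base_less: "base y < r" if "y < k + m" for y
  proof (cases "y < k")
    case True
    then show ?thesis using rk by (simp add: base_def)
  next
    case False
    show ?thesis
    proof (cases "\<exists>i<2 * k. lit (y - k) i")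
      case True
      then have "good (y - k) (base (k + (y - k)))" using that False by (intro base_good) auto
      then show ?thesis using False rk by (simp add: good_def)
    next
      case empty: False
      then have "base y = 2 * k" using False unfolding base_def by (simp only: if_False)
      then show ?thesis using rk by simp
    qed
  qed
  have base_listed: "listed k lit y (base y)" if "y < k + m" "listed k lit y i" for y i
  proof (cases "y < k")
    case True
    then show ?thesis by (simp add: base_def listed_def)
  next
    case False
    then have "\<exists>i<2 * k. lit (y - k) i" using that(2) by (auto simp: listed_def)
    then have "good (y - k) (base (k + (y - k)))" using that(1) False by (intro base_good) auto
    then show ?thesis using False by (simp add: good_def listed_def)
  qed
  \<comment> \<open>A common colour would be a literal that is true for the clause and false for the
    variable.\<close>
  have base_edge: "base (k + c) \<noteq> base x" if "c < m" "x < k" for c x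
  proof (cases "\<exists>i<2 * k. lit c i")
    case True
    then have g: "good c (base (k + c))" using that(1) by (intro base_good)
    show ?thesis
    proof
      assume "base (k + c) = base x"
      then have "\<alpha> (base x div 2) \<longleftrightarrow> even (base x)" using g by (simp add: good_def)
      then show False using that(2) by (simp add: base_def split: if_splits)
    qed
  next
    case False
    then have "base (k + c) = 2 * k"
      unfolding base_def by (simp only: diff_add_inverse not_add_less1 if_False)
    moreover have "base x < 2 * k" using that(2) by (simp add: base_def)
    ultimately show ?thesis by simp
  qed
  define color where "color q = (if q < r * r + r then q - r * r else base (q - (r * r + r)))" for q
  \<comment> \<open>The slots of block \<open>b\<close> that are not dummies.\<close>
  define S where "S b = {i. i < r \<and> r * r \<le> cnf_slot k m lit r b i}" for b
  have color_palette: "color (r * r + i) = i" if "i < r" for i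
    using that by (simp add: color_def)
  have color_point: "color (r * r + r + y) = base y" for y
    by (simp add: color_def)
  have inj: "inj_on (\<lambda>i. color (cnf_slot k m lit r b i)) (S b)" if b: "b < r" for b
  proof -
    have dummy: "b * r + i < r * r" if "i < r" for i using row_index_less[OF b that] .
    consider (lst) "b < k + m" | (pal) "b = k + m" | (edge) "k + m < b" by linarith
    then show ?thesis
    proof cases
      case lst
      have unlisted: "color (cnf_slot k m lit r b i) = i" if "i \<in> S b" "\<not> listed k lit b i" for i
        using that color_palette by (simp add: cnf_slot_list(1)[OF lst] S_def)
      have first: "\<not> (\<exists>j<i. listed k lit b j)" if "i \<in> S b" "listed k lit b i" for i
      proof
        assume "\<exists>j<i. listed k lit b j"
        then have "cnf_slot k m lit r b i = b * r + i" using that(2) by (intro cnf_slot_list(3)[OF lst])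
        then show False using that(1) dummy[of i] by (simp add: S_def)
      qed
      have color_first: "color (cnf_slot k m lit r b i) = base b" if "i \<in> S b" "listed k lit b i" for i
        using cnf_slot_list(2)[OF lst that(2) first[OF that]] color_point by simp
      show ?thesis
      proof (rule linorder_inj_onI)
        fix i j assume ij: "i < j" "i \<in> S b" "j \<in> S b"
        show "color (cnf_slot k m lit r b i) \<noteq> color (cnf_slot k m lit r b j)"
        proof (cases "listed k lit b i")
          case True
          then have "\<not> listed k lit b j" using first[OF ij(3)] ij(1) by blast
          then show ?thesis
            using True color_first[OF ij(2)] unlisted[OF ij(3)] base_listed[OF lst True] by auto
        next
          case False
          show ?thesis
          proof (cases "listed k lit b j")
            case True
            then show ?thesis
              using False color_first[OF ij(3)] unlisted[OF ij(2)] base_listed[OF lst True] by auto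
          next
            case False
            then show ?thesis
              using \<open>\<not> listed k lit b i\<close> ij unlisted by simp
          qed
        qed
      qed auto
    next
      case pal
      then have "cnf_slot k m lit r b i = r * r + i" for i by (simp add: cnf_slot_def)
      then show ?thesis using color_palette by (simp add: inj_on_def S_def)
    next
      case edge
      let ?e = "b - (k + m + 1)"
      have e: "?e < m * k \<and> (i = 0 \<or> i = 1)" if "i \<in> S b" for i
      proof (rule ccontr)
        assume "\<not> (?e < m * k \<and> (i = 0 \<or> i = 1))"
        then have "cnf_slot k m lit r b i = b * r + i" using edge unfolding cnf_slot_def by auto
        then show False using that dummy[of i] by (simp add: S_def)
      qed
      have ne: "color (cnf_slot k m lit r b 0) \<noteq> color (cnf_slot k m lit r b 1)" if e: "?e < m * k"
      proof -
        have "b = k + m + 1 + (?e div k * k + ?e mod k)" using edge by simp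
        then have "cnf_slot k m lit r b 0 = r * r + r + (k + ?e div k)"
          "cnf_slot k m lit r b 1 = r * r + r + ?e mod k"
          using cnf_slot_edge[OF block_index[OF e], of lit r] by simp_all
        then show ?thesis using base_edge[OF block_index[OF e]] by (simp only: color_point not_False_eq_True)
      qed
      show ?thesis
      proof (rule linorder_inj_onI)
        fix i j assume ij: "i < j" "i \<in> S b" "j \<in> S b"
        then have "i = 0" "j = 1" using e[OF ij(2)] e[OF ij(3)] by auto
        then show "color (cnf_slot k m lit r b i) \<noteq> color (cnf_slot k m lit r b j)"
          using ne e[OF ij(2)] by blast
      qed auto
    qed
  qed
  have img: "(\<lambda>i. color (cnf_slot k m lit r b i)) ` S b \<subseteq> {..<r}" if b: "b < r" for b
  proof -
    have "color (cnf_slot k m lit r b i) < r" if "i \<in> S b" for i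
      using that row_index_less[OF b, of i r] base_less rk(2) unfolding S_def
      by (cases rule: cnf_slot_cases[of k m lit r b i]) (auto simp: color_def)
    then show ?thesis by blast
  qed
  have "\<exists>h. inj_on h {..<r} \<and> h ` {..<r} \<subseteq> {..<r} \<and> (\<forall>i\<in>S b. h i = color (cnf_slot k m lit r b i))"
    if b: "b < r" for b
  proof -
    have "S b \<subseteq> {..<r}" by (auto simp: S_def)
    from inj_extension[OF this inj[OF b] img[OF b]] obtain h where "inj_on h {..<r}" "h ` {..<r} \<subseteq> {..<r}"
        "\<And>i. i \<in> S b \<Longrightarrow> h i = color (cnf_slot k m lit r b i)"
      by metis
    then show ?thesis by (intro exI[of _ h] conjI ballI)
  qed
  then obtain h where h: "\<And>b. b < r \<Longrightarrow> inj_on (h b) {..<r}" "\<And>b. b < r \<Longrightarrow> h b ` {..<r} \<subseteq> {..<r}"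
      "\<And>b i. b < r \<Longrightarrow> i \<in> S b \<Longrightarrow> h b i = color (cnf_slot k m lit r b i)"
    by metis
  \<comment> \<open>Dummy \<open>b * r + i\<close> takes the colour that completes block
    \<open>b\<close> at slot \<open>i\<close>. The \<open>mod r\<close> is a default for points
    outside all blocks; in a block it changes nothing.\<close>
  define \<chi> where "\<chi> q = (if q < r * r then h (q div r) (q mod r) else color q mod r)" for q
  have \<chi>_slot: "\<chi> (cnf_slot k m lit r b i) = h b i" if "b < r" "i < r" for b i
  proof (cases "i \<in> S b")
    case True
    then have "h b i = color (cnf_slot k m lit r b i)" using h(3) that by blast
    moreover have "h b i < r" using h(2)[OF that(1)] that(2) by blast
    ultimately show ?thesis using True by (simp add: \<chi>_def S_def)
  next
    case False
    then have "cnf_slot k m lit r b i < r * r" using that(2) by (simp add: S_def)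
    moreover from this have "cnf_slot k m lit r b i = b * r + i"
      by (cases rule: cnf_slot_cases[of k m lit r b i]) simp_all
    ultimately show ?thesis using that by (simp add: \<chi>_def)
  qed
  show ?thesis
    unfolding rainbow_colorable_def
  proof (intro exI[of _ \<chi>] conjI allI impI)
    fix q :: nat
    have "h (q div r) (q mod r) < r" if "q < r * r"
    proof -
      have "q div r < r" "q mod r \<in> {..<r}" using that rk(2) by (simp_all add: less_mult_imp_div_less)
      then show ?thesis using h(2) by blast
    qed
    then show "\<chi> q < r" using rk(2) by (simp add: \<chi>_def)
  next
    fix b assume "b < r"
    then show "inj_on (\<lambda>i. \<chi> (cnf_slot k m lit r b i)) {..<r}"
      using h(1) \<chi>_slot by (simp add: inj_on_def)
  qed
qed

text \<open>The palette block makes \<open>pal\<close> a permutation of the colours, and colour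
  \<open>pal i\<close> is read as literal \<open>i\<close>.\<close>

lemma rainbow_imp_satisfiable:
  assumes r: "r = cnf_colors k m" and rb: "rainbow_colorable r ((r + 2) * r) (cnf_slot k m lit r)"
  shows "satisfiable k m lit"
proof -
  have rk: "2 * k < r" "k + m < r" "0 < r" by (simp_all add: r cnf_colors_def)
  obtain \<chi> where \<chi>: "\<And>q. q < (r + 2) * r \<Longrightarrow> \<chi> q < r"
    "\<And>b. b < r \<Longrightarrow> inj_on (\<lambda>i. \<chi> (cnf_slot k m lit r b i)) {..<r}"
    using rb unfolding rainbow_colorable_def by blast
  define pal where "pal i = \<chi> (r * r + i)" for i
  define point where "point y = \<chi> (r * r + r + y)" for y
  have injD: "i = j" if "b < r" "i < r" "j < r" "\<chi> (cnf_slot k m lit r b i) = \<chi> (cnf_slot k m lit r b j)" for b i j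
    using inj_onD[OF \<chi>(2)[OF that(1)]] that by simp
  have pal_inj: "inj_on pal {..<r}"
    using \<chi>(2)[OF rk(2)] by (simp add: cnf_slot_def pal_def[abs_def])
  moreover have "pal ` {..<r} \<subseteq> {..<r}"
    using \<chi>(1) by (auto simp: pal_def algebra_simps)
  ultimately have pal_surj: "pal ` {..<r} = {..<r}" by (intro endo_inj_surj) auto
  \<comment> \<open>The block of \<open>y\<close> contains the palette points of all unlisted
    colours, which leaves only listed ones for \<open>y\<close>. The bound on \<open>i\<close>
    ensures that the first listed slot, the one holding \<open>y\<close>, is among the
    \<open>r\<close> slots.\<close>
  have point: "\<exists>i. listed k lit y i \<and> point y = pal i" if y: "y < k + m" and i: "listed k lit y i" "i < r" for y i
  proof -
    define i0 where "i0 = (LEAST i. listed k lit y i)"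
    have i0: "listed k lit y i0" unfolding i0_def by (rule LeastI[of _ i]) (rule i(1))
    have "i0 \<le> i" unfolding i0_def by (rule Least_le) (rule i(1))
    then have i0_less: "i0 < r" using i(2) by simp
    have i0_min: "\<not> (\<exists>j<i0. listed k lit y j)" unfolding i0_def using not_less_Least by blast
    have slot0: "cnf_slot k m lit r y i0 = r * r + r + y"
      using i0 i0_min by (intro cnf_slot_list(2)[OF y])
    have "point y < r" using \<chi>(1)[of "r * r + r + y"] y rk by (simp add: point_def algebra_simps)
    then obtain j where j: "j < r" "point y = pal j" using pal_surj by (metis imageE lessThan_iff)
    have "listed k lit y j"
    proof (rule ccontr)
      assume notl: "\<not> listed k lit y j"
      then have "cnf_slot k m lit r y j = r * r + j" using y by (simp add: cnf_slot_def)
      then have "\<chi> (cnf_slot k m lit r y i0) = \<chi> (cnf_slot k m lit r y j)"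
        using j slot0 by (simp add: point_def pal_def)
      moreover have "y < r" using y rk by simp
      ultimately have "i0 = j" using injD[of y i0 j] i0_less j(1) by blast
      then show False using notl i0 by simp
    qed
    with j show ?thesis by blast
  qed
  have edge: "point (k + c) \<noteq> point x" if "c < m" "x < k" for c x
  proof
    assume eq: "point (k + c) = point x"
    let ?e = "c * k + x" and ?b = "k + m + 1 + (c * k + x)"
    have e: "?e < m * k" using row_index_less[OF that] .
    then have b: "?b < r" by (simp add: r cnf_colors_def)
    have "\<chi> (cnf_slot k m lit r ?b 0) = \<chi> (cnf_slot k m lit r ?b 1)"
      using eq unfolding point_def cnf_slot_edge[OF that] .
    moreover have "1 < r" by (simp add: r cnf_colors_def)
    ultimately have "(0 :: nat) = 1" using injD[of ?b 0 1] b rk(3) by blast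
    then show False by simp
  qed
  show ?thesis
    unfolding satisfiable_def
  \<comment> \<open>A variable point carries the false literal, so the variable is true if this is
    the negative one.\<close>
  proof (intro exI[of _ "\<lambda>x. point x = pal (2 * x + 1)"] allI impI)
    fix c assume c: "c < m" "\<exists>i<2 * k. lit c i"
    then obtain i0 where i0: "i0 < 2 * k" "lit c i0" by blast
    obtain i where i: "listed k lit (k + c) i" "point (k + c) = pal i"
      using point[of "k + c" i0] c(1) i0 rk by (auto simp: listed_def)
    then have il: "i < 2 * k" "lit c i" by (simp_all add: listed_def)
    let ?x = "i div 2"
    have x: "?x < k" using il(1) by simp
    obtain j where j: "listed k lit ?x j" "point ?x = pal j"
      using point[of ?x i] x il(1) rk by (auto simp: listed_def)
    then have jx: "j div 2 = i div 2" using x by (simp add: listed_def)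
    \<comment> \<open>Both literals belong to \<open>?x\<close>. As \<open>j\<close> is the false
      one, \<open>i\<close> must be the true one.\<close>
    have "i \<noteq> j" using edge[OF c(1) x] i(2) j(2) by auto
    have "point ?x = pal (2 * ?x + 1) \<longleftrightarrow> j = 2 * ?x + 1"
      using inj_onD[OF pal_inj, of j "2 * ?x + 1"] j(2) jx il(1) rk(1) by auto
    also have "\<dots> \<longleftrightarrow> even i" using \<open>i \<noteq> j\<close> jx by presburger
    finally show "\<exists>i<2 * k. lit c i \<and> (point (i div 2) = pal (2 * (i div 2) + 1) \<longleftrightarrow> even i)"
      using il by blast
  qed
qed

section \<open>Clauses describing a polynomial-time verification\<close>

text \<open>
  A schema stands for the clauses obtained by varying a time and two cells: if the guard holds and
  all variables of the first list are true, then so is one of the second list.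
\<close>

type_synonym var_term = "bool list \<Rightarrow> nat \<Rightarrow> nat \<Rightarrow> nat \<Rightarrow> nat"
type_synonym schema = "(bool list \<Rightarrow> nat \<Rightarrow> nat \<Rightarrow> nat \<Rightarrow> bool) \<times> var_term list \<times> var_term list"

definition schema_holds :: "(nat \<Rightarrow> bool) \<Rightarrow> bool list \<Rightarrow> schema \<Rightarrow> nat \<Rightarrow> nat \<Rightarrow> nat \<Rightarrow> bool" where
  "schema_holds \<alpha> x \<sigma> t h h' \<longleftrightarrow>
     fst \<sigma> x t h h' \<longrightarrow> (\<forall>v\<in>set (fst (snd \<sigma>)). \<alpha> (v x t h h')) \<longrightarrow> (\<exists>v\<in>set (snd (snd \<sigma>)). \<alpha> (v x t h h'))"

locale tableau =
  fixes M :: tm and pT pP :: "nat poly"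
  assumes wf: "wf_tm M"
begin

definition situations :: "(nat \<times> nat list) list" where
  "situations = List.product [0..<Suc (states M)] (List.n_lists (tapes M) [0..<symbols M])"

text \<open>Totalises the transition function: a halted machine repeats its configuration, so the
  same clauses describe every row up to the horizon.\<close>

definition delta :: "nat \<times> nat list \<Rightarrow> nat \<times> (nat \<times> int) list" where
  "delta s = (if fst s < states M then trans M (fst s) (snd s) else (fst s, map (\<lambda>a. (a, 0)) (snd s)))"

definition horizon :: "bool list \<Rightarrow> nat" where
  "horizon x = poly pT (length x)"

definition guess_length :: "bool list \<Rightarrow> nat" where
  "guess_length x = poly pP (length x)"

text \<open>A number above all indices in use. Heads move between 0 and twice the horizon, the input
  may reach further, and states, symbols, tapes and situations have to be digits too. It bounds the
  ranges of times and cells and is the base of the numerals \<open>var\<close>.\<close>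

definition base :: "bool list \<Rightarrow> nat" where
  "base x = 2 * horizon x + (2 * length x + 2 + guess_length x) +
     (states M + symbols M + tapes M + length situations + 10)"

text \<open>A numeral to base \<open>base x\<close>, its leading digit being the kind of variable;
  distinct digits give distinct numbers.\<close>

definition var :: "bool list \<Rightarrow> nat \<Rightarrow> nat \<Rightarrow> nat \<Rightarrow> nat \<Rightarrow> nat \<Rightarrow> nat" where
  "var x k \<tau> a t h = (((k * base x + \<tau>) * base x + a) * base x + t) * base x + h"

abbreviation "state_var x q t \<equiv> var x 0 0 q t 0"
abbreviation "head_var x \<tau> t h \<equiv> var x 1 \<tau> 0 t h"
abbreviation "cell_var x \<tau> a t h \<equiv> var x 2 \<tau> a t h"
abbreviation "scan_var x \<tau> a t \<equiv> var x 3 \<tau> a t 0"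
abbreviation "act_var x j t \<equiv> var x 4 0 j t 0"

text \<open>
  Index \<open>h\<close> of the tableau is cell \<open>h - horizon x\<close> of the tape, so that no head leaves the tableau.
  Tape 0 initially holds the pair of \<open>x\<close> and a certificate which is guessed by the assignment.
\<close>

definition input_cell :: "bool list \<Rightarrow> nat \<Rightarrow> nat \<Rightarrow> bool" where
  "input_cell x a h \<longleftrightarrow>
     (a = 0 \<and> (h < horizon x \<or> horizon x + (2 * length x + 2 + guess_length x) \<le> h)) \<or>
     (a = 1 \<and> (horizon x \<le> h \<and> h < horizon x + 2 * length x \<and> \<not> one_at x ((h - horizon x) div 2) \<or>
        h = horizon x + 2 * length x)) \<or>
     (a = 2 \<and> (horizon x \<le> h \<and> h < horizon x + 2 * length x \<and> one_at x ((h - horizon x) div 2) \<or>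
        h = horizon x + 2 * length x + 1))"

definition guess_cell :: "bool list \<Rightarrow> nat \<Rightarrow> bool" where
  "guess_cell x h \<longleftrightarrow> horizon x + 2 * length x + 2 \<le> h \<and> h < horizon x + (2 * length x + 2 + guess_length x)"

definition start_state :: schema where
  "start_state = (\<lambda>x t h h'. True, [], [\<lambda>x t h h'. state_var x 0 0])"
definition start_head :: "nat \<Rightarrow> schema" where
  "start_head \<tau> = (\<lambda>x t h h'. True, [], [\<lambda>x t h h'. head_var x \<tau> 0 (horizon x)])"
definition start_input :: "nat \<Rightarrow> schema" where
  "start_input a = (\<lambda>x t h h'. input_cell x a h, [], [\<lambda>x t h h'. cell_var x 0 a 0 h])"
definition start_guess :: schema where
  "start_guess = (\<lambda>x t h h'. guess_cell x h, [],
     [\<lambda>x t h h'. cell_var x 0 0 0 h, \<lambda>x t h h'. cell_var x 0 1 0 h, \<lambda>x t h h'. cell_var x 0 2 0 h])"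
text \<open>Only blanks may follow a blank; thus the guessed cells hold a word that may be shorter
  than the space provided for it.\<close>

definition start_pad :: schema where
  "start_pad = (\<lambda>x t h h'. guess_cell x h \<and> guess_cell x (h + 1),
     [\<lambda>x t h h'. cell_var x 0 0 0 h], [\<lambda>x t h h'. cell_var x 0 0 0 (h + 1)])"
definition start_blank :: "nat \<Rightarrow> schema" where
  "start_blank \<tau> = (\<lambda>x t h h'. True, [], [\<lambda>x t h h'. cell_var x \<tau> 0 0 h])"
text \<open>Scanned symbols and situations have variables of their own, since a schema speaks of at
  most two cells, while a transition depends on the cells under all heads.\<close>

definition run_scan :: "nat \<Rightarrow> nat \<Rightarrow> schema" where
  "run_scan \<tau> a = (\<lambda>x t h h'. t < horizon x,
     [\<lambda>x t h h'. head_var x \<tau> t h, \<lambda>x t h h'. cell_var x \<tau> a t h], [\<lambda>x t h h'. scan_var x \<tau> a t])"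
definition run_act :: "nat \<Rightarrow> schema" where
  "run_act j = (\<lambda>x t h h'. t < horizon x,
     (\<lambda>x t h h'. state_var x (fst (situations ! j)) t) #
       map (\<lambda>\<tau> x t h h'. scan_var x \<tau> (snd (situations ! j) ! \<tau>) t) [0..<tapes M],
     [\<lambda>x t h h'. act_var x j t])"
definition run_state :: "nat \<Rightarrow> schema" where
  "run_state j = (\<lambda>x t h h'. t < horizon x,
     [\<lambda>x t h h'. act_var x j t], [\<lambda>x t h h'. state_var x (fst (delta (situations ! j))) (t + 1)])"
definition run_write :: "nat \<Rightarrow> nat \<Rightarrow> schema" where
  "run_write j \<tau> = (\<lambda>x t h h'. t < horizon x,
     [\<lambda>x t h h'. act_var x j t, \<lambda>x t h h'. head_var x \<tau> t h],
     [\<lambda>x t h h'. cell_var x \<tau> (fst (snd (delta (situations ! j)) ! \<tau>)) (t + 1) h])"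
text \<open>The displacement is increased by 1 to make it a natural number; the guard keeps the new
  position inside the tableau.\<close>

definition run_move :: "nat \<Rightarrow> nat \<Rightarrow> schema" where
  "run_move j \<tau> = (\<lambda>x t h h'. t < horizon x \<and> 0 < h \<and> h + 1 < base x,
     [\<lambda>x t h h'. act_var x j t, \<lambda>x t h h'. head_var x \<tau> t h],
     [\<lambda>x t h h'. head_var x \<tau> (t + 1)
        (h + nat (snd (snd (delta (situations ! j)) ! \<tau>) + 1) - 1)])"
definition run_keep :: "nat \<Rightarrow> nat \<Rightarrow> schema" where
  "run_keep \<tau> a = (\<lambda>x t h h'. t < horizon x \<and> h \<noteq> h',
     [\<lambda>x t h h'. head_var x \<tau> t h', \<lambda>x t h h'. cell_var x \<tau> a t h],
     [\<lambda>x t h h'. cell_var x \<tau> a (t + 1) h])"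
text \<open>Symbol 1 in cell 0 of the output tape is the answer \<open>False\<close>. The empty list
  of conclusions makes this the only purely negative schema.\<close>

definition accepting :: schema where
  "accepting = (\<lambda>x t h h'. True, [\<lambda>x t h h'. cell_var x 1 1 (horizon x) (horizon x)], [])"

definition schemas :: "schema list" where
  "schemas = [start_state, start_guess, start_pad, accepting] @
     map start_head [0..<tapes M] @ map start_input [0..<3] @ map start_blank [1..<tapes M] @
     map (\<lambda>(\<tau>, a). run_scan \<tau> a) (List.product [0..<tapes M] [0..<symbols M]) @
     map run_act [0..<length situations] @ map run_state [0..<length situations] @
     map (\<lambda>(j, \<tau>). run_write j \<tau>) (List.product [0..<length situations] [0..<tapes M]) @
     map (\<lambda>(j, \<tau>). run_move j \<tau>) (List.product [0..<length situations] [0..<tapes M]) @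
     map (\<lambda>(\<tau>, a). run_keep \<tau> a) (List.product [0..<tapes M] [0..<symbols M])"

definition models :: "(nat \<Rightarrow> bool) \<Rightarrow> bool list \<Rightarrow> bool" where
  "models \<alpha> x \<longleftrightarrow> (\<forall>\<sigma>\<in>set schemas. \<forall>t<base x. \<forall>h<base x. \<forall>h'<base x. schema_holds \<alpha> x \<sigma> t h h')"

lemma in_schemas:
  "start_state \<in> set schemas" "start_guess \<in> set schemas" "start_pad \<in> set schemas" "accepting \<in> set schemas"
  "\<tau> < tapes M \<Longrightarrow> start_head \<tau> \<in> set schemas"
  "a < 3 \<Longrightarrow> start_input a \<in> set schemas"
  "1 \<le> \<tau> \<Longrightarrow> \<tau> < tapes M \<Longrightarrow> start_blank \<tau> \<in> set schemas"
  "\<tau> < tapes M \<Longrightarrow> a < symbols M \<Longrightarrow> run_scan \<tau> a \<in> set schemas"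
  "j < length situations \<Longrightarrow> run_act j \<in> set schemas"
  "j < length situations \<Longrightarrow> run_state j \<in> set schemas"
  "j < length situations \<Longrightarrow> \<tau> < tapes M \<Longrightarrow> run_write j \<tau> \<in> set schemas"
  "j < length situations \<Longrightarrow> \<tau> < tapes M \<Longrightarrow> run_move j \<tau> \<in> set schemas"
  "\<tau> < tapes M \<Longrightarrow> a < symbols M \<Longrightarrow> run_keep \<tau> a \<in> set schemas"
  unfolding schemas_def by auto

section \<open>The true run of the machine\<close>

definition cfg :: "bool list \<Rightarrow> nat \<Rightarrow> config" where
  "cfg w t = (step M ^^ t) (init M w)"
definition state :: "bool list \<Rightarrow> nat \<Rightarrow> nat" where
  "state w t = fst (cfg w t)"
definition cell :: "bool list \<Rightarrow> nat \<Rightarrow> nat \<Rightarrow> int \<Rightarrow> nat" where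
  "cell w t \<tau> = fst (snd (cfg w t) ! \<tau>)"
definition head :: "bool list \<Rightarrow> nat \<Rightarrow> nat \<Rightarrow> int" where
  "head w t \<tau> = snd (snd (cfg w t) ! \<tau>)"
definition scan :: "bool list \<Rightarrow> nat \<Rightarrow> nat list" where
  "scan w t = map scanned (snd (cfg w t))"

lemma tapes_ge: "2 \<le> tapes M" and symbols_ge: "3 \<le> symbols M"
  using wf by (simp_all add: wf_tm_def)

lemma cfg_0:
  "state w 0 = 0" "cell w 0 0 = contents w" "1 \<le> \<tau> \<Longrightarrow> \<tau> < tapes M \<Longrightarrow> cell w 0 \<tau> = (\<lambda>_. 0)"
  "\<tau> < tapes M \<Longrightarrow> head w 0 \<tau> = 0"
  using tapes_ge by (auto simp: state_def cell_def head_def cfg_def init_def contents_def nth_Cons' fun_eq_iff)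

lemma delta_wf:
  assumes "q \<le> states M" "length xs = tapes M" "set xs \<subseteq> {..<symbols M}"
  shows "fst (delta (q, xs)) \<le> states M" "length (snd (delta (q, xs))) = tapes M"
    "set (snd (delta (q, xs))) \<subseteq> {..<symbols M} \<times> {-1, 0, 1}"
proof -
  have "fst (delta (q, xs)) \<le> states M \<and> length (snd (delta (q, xs))) = tapes M \<and>
      set (snd (delta (q, xs))) \<subseteq> {..<symbols M} \<times> {-1, 0, 1}"
  proof (cases "q < states M")
    case True
    have "\<forall>q<states M. \<forall>xs. length xs = tapes M \<and> set xs \<subseteq> {..<symbols M} \<longrightarrow>
        (case trans M q xs of (q', acts) \<Rightarrow> q' \<le> states M \<and> length acts = tapes M \<and>
          set acts \<subseteq> {..<symbols M} \<times> {-1, 0, 1})"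
      using wf unfolding wf_tm_def by (elim conjE)
    from this[rule_format, OF True conjI[OF assms(2,3)]] show ?thesis
      using True by (simp add: delta_def case_prod_beta)
  next
    case False
    then show ?thesis using assms by (auto simp: delta_def)
  qed
  then show "fst (delta (q, xs)) \<le> states M" "length (snd (delta (q, xs))) = tapes M"
    "set (snd (delta (q, xs))) \<subseteq> {..<symbols M} \<times> {-1, 0, 1}" by blast+
qed

lemma delta_act_wf:
  assumes "q \<le> states M" "length xs = tapes M" "set xs \<subseteq> {..<symbols M}" "\<tau> < tapes M"
  shows "fst (snd (delta (q, xs)) ! \<tau>) < symbols M" "snd (snd (delta (q, xs)) ! \<tau>) \<in> {-1, 0, 1}"
proof -
  have "snd (delta (q, xs)) ! \<tau> \<in> set (snd (delta (q, xs)))"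
    using delta_wf(2)[OF assms(1-3)] assms(4) by simp
  then have "snd (delta (q, xs)) ! \<tau> \<in> {..<symbols M} \<times> {-1, 0, 1}"
    using delta_wf(3)[OF assms(1-3)] by blast
  then show "fst (snd (delta (q, xs)) ! \<tau>) < symbols M" "snd (snd (delta (q, xs)) ! \<tau>) \<in> {-1, 0, 1}"
    by (auto simp: mem_Times_iff)
qed

lemma step_delta:
  "step M (q, ts) = (fst (delta (q, map scanned ts)), map2 act ts (snd (delta (q, map scanned ts))))"
proof (cases "q < states M")
  case False
  have "map2 act ts (map (\<lambda>a. (a, 0)) (map scanned ts)) = ts"
    by (rule nth_equalityI) (auto simp: act_def scanned_def)
  with False show ?thesis by (simp add: step_def delta_def)
qed (simp add: step_def delta_def case_prod_beta)

lemma cfg_Suc: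
  "cfg w (Suc t) = (fst (delta (state w t, scan w t)), map2 act (snd (cfg w t)) (snd (delta (state w t, scan w t))))"
  using step_delta[of "state w t" "snd (cfg w t)"] by (simp add: cfg_def state_def scan_def)

lemma cfg_wf:
  "state w t \<le> states M \<and> length (snd (cfg w t)) = tapes M \<and>
    (\<forall>\<tau><tapes M. (\<forall>i. cell w t \<tau> i < symbols M) \<and> \<bar>head w t \<tau>\<bar> \<le> int t)"
proof (induction t)
  case 0
  have "contents w i < symbols M" for i using symbols_ge by (simp add: contents_def)
  moreover have "cell w 0 \<tau> i < symbols M" if "\<tau> < tapes M" for \<tau> i
    using calculation cfg_0(2)[of w] cfg_0(3)[of \<tau> w] that symbols_ge by (cases "\<tau> = 0") auto
  moreover have "length (snd (cfg w 0)) = tapes M" using tapes_ge by (simp add: cfg_def init_def)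
  ultimately show ?case using cfg_0(1,4) by simp
next
  case (Suc t)
  have sc: "length (scan w t) = tapes M" using Suc by (simp add: scan_def)
  have "scan w t ! \<tau> < symbols M" if "\<tau> < tapes M" for \<tau>
    using Suc that by (simp add: scan_def scanned_def cell_def)
  then have set: "set (scan w t) \<subseteq> {..<symbols M}" using sc by (metis in_set_conv_nth lessThan_iff subsetI)
  note wf' = delta_wf[OF conjunct1[OF Suc] sc set] delta_act_wf[OF conjunct1[OF Suc] sc set]
  have "length (snd (cfg w (Suc t))) = tapes M" using Suc wf'(2) by (simp add: cfg_Suc)
  moreover have "(\<forall>i. cell w (Suc t) \<tau> i < symbols M) \<and> \<bar>head w (Suc t) \<tau>\<bar> \<le> int (Suc t)" if "\<tau> < tapes M" for \<tau>
    using Suc wf'(2) wf'(4,5)[OF that] that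
    by (auto simp: cell_def head_def cfg_Suc act_def)
  moreover have "state w (Suc t) \<le> states M" using wf'(1) by (simp add: state_def cfg_Suc)
  ultimately show ?case by blast
qed

lemmas state_le = cfg_wf[THEN conjunct1]
lemmas length_cfg = cfg_wf[THEN conjunct2, THEN conjunct1]

lemma cell_less: "\<tau> < tapes M \<Longrightarrow> cell w t \<tau> i < symbols M"
  and head_bound: "\<tau> < tapes M \<Longrightarrow> \<bar>head w t \<tau>\<bar> \<le> int t"
  using cfg_wf by blast+

lemma scan_nth: "\<tau> < tapes M \<Longrightarrow> scan w t ! \<tau> = cell w t \<tau> (head w t \<tau>)"
  using length_cfg by (simp add: scan_def scanned_def cell_def head_def)

lemma length_scan: "length (scan w t) = tapes M"
  using length_cfg by (simp add: scan_def)

lemma set_scan: "set (scan w t) \<subseteq> {..<symbols M}"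
proof
  fix a assume "a \<in> set (scan w t)"
  then obtain \<tau> where "\<tau> < tapes M" "a = scan w t ! \<tau>" by (metis in_set_conv_nth length_scan)
  then show "a \<in> {..<symbols M}" using scan_nth cell_less by simp
qed

lemma situation_index: "\<exists>j<length situations. situations ! j = (state w t, scan w t)"
proof -
  have "(state w t, scan w t) \<in> set situations"
    using state_le[of w t] length_scan set_scan
    unfolding situations_def by (auto simp: set_n_lists less_Suc_eq_le atLeast0LessThan simp del: upt_Suc)
  then show ?thesis by (simp add: in_set_conv_nth)
qed

lemma run_Suc:
  "state w (Suc t) = fst (delta (state w t, scan w t))"
  "\<tau> < tapes M \<Longrightarrow> cell w (Suc t) \<tau> = (cell w t \<tau>)(head w t \<tau> := fst (snd (delta (state w t, scan w t)) ! \<tau>))"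
  "\<tau> < tapes M \<Longrightarrow> head w (Suc t) \<tau> = head w t \<tau> + snd (snd (delta (state w t, scan w t)) ! \<tau>)"
  using delta_wf(2)[OF state_le length_scan set_scan] length_cfg
  by (simp_all add: state_def cell_def head_def cfg_Suc act_def)

lemma delta_run:
  assumes "\<tau> < tapes M"
  shows "fst (snd (delta (state w t, scan w t)) ! \<tau>) < symbols M"
    "snd (snd (delta (state w t, scan w t)) ! \<tau>) \<in> {-1, 0, 1}"
  using delta_act_wf[OF state_le length_scan set_scan assms] by simp_all

section \<open>Every model contains a true run\<close>

lemma modelsD:
  assumes "models \<alpha> x" "\<sigma> \<in> set schemas" "t < base x" "h < base x" "h' < base x"
  shows "schema_holds \<alpha> x \<sigma> t h h'"
  using assms unfolding models_def by blast

text \<open>Each \<open>run_\<close> schema has a single conclusion, so truth propagates from one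
  row to the next. Nothing is claimed about further true variables.\<close>

lemma models_run:
  assumes mod: "models \<alpha> x"
    and start: "\<And>h. h < base x \<Longrightarrow> \<alpha> (cell_var x 0 (contents w (int h - int (horizon x))) 0 h)"
  shows "t \<le> horizon x \<Longrightarrow> \<alpha> (state_var x (state w t) t) \<and>
    (\<forall>\<tau><tapes M. \<alpha> (head_var x \<tau> t (nat (head w t \<tau> + int (horizon x)))) \<and>
      (\<forall>h<base x. \<alpha> (cell_var x \<tau> (cell w t \<tau> (int h - int (horizon x))) t h)))"
proof (induction t)
  case 0
  have B: "0 < base x" by (simp add: base_def)
  have "\<alpha> (state_var x 0 0)"
    using modelsD[OF mod in_schemas(1) B B B] by (simp add: schema_holds_def start_state_def)
  moreover have "\<alpha> (head_var x \<tau> 0 (horizon x))" if "\<tau> < tapes M" for \<tau>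
    using modelsD[OF mod in_schemas(5)[OF that] B B B] by (simp add: schema_holds_def start_head_def)
  moreover have "\<alpha> (cell_var x \<tau> (cell w 0 \<tau> (int h - int (horizon x))) 0 h)" if "\<tau> < tapes M" "h < base x" for \<tau> h
  proof (cases "\<tau> = 0")
    case True
    then show ?thesis using start[OF that(2)] by (simp add: cfg_0)
  next
    case False
    then have "1 \<le> \<tau>" by simp
    from modelsD[OF mod in_schemas(7)[OF this that(1)] B that(2) B] show ?thesis
      using cfg_0(3)[OF \<open>1 \<le> \<tau>\<close> that(1)] by (simp add: schema_holds_def start_blank_def)
  qed
  ultimately show ?case by (simp add: cfg_0)
next
  case (Suc t)
  let ?o = "int (horizon x)" and ?h = "\<lambda>\<tau>. nat (head w t \<tau> + int (horizon x))"
  have t: "t < horizon x" "t < base x" using Suc.prems by (auto simp: base_def)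
  have B: "0 < base x" by (simp add: base_def)
  have st: "\<alpha> (state_var x (state w t) t)"
    and hd: "\<And>\<tau>. \<tau> < tapes M \<Longrightarrow> \<alpha> (head_var x \<tau> t (?h \<tau>))"
    and ce: "\<And>\<tau> h. \<tau> < tapes M \<Longrightarrow> h < base x \<Longrightarrow> \<alpha> (cell_var x \<tau> (cell w t \<tau> (int h - ?o)) t h)"
    using Suc by simp_all
  \<comment> \<open>After \<open>t\<close> steps a head is at most \<open>t\<close> cells from its
    start, and \<open>t\<close> is below the horizon; so the guard of \<open>run_move\<close> is
    met.\<close>
  have hb: "0 < ?h \<tau>" "?h \<tau> + 1 < base x" "int (?h \<tau>) = head w t \<tau> + ?o" if "\<tau> < tapes M" for \<tau>
    using head_bound[OF that, of w t] t(1) by (auto simp: base_def)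
  have sc: "\<alpha> (scan_var x \<tau> (scan w t ! \<tau>) t)" if "\<tau> < tapes M" for \<tau>
  proof -
    have "scan w t ! \<tau> = cell w t \<tau> (int (?h \<tau>) - ?o)" using scan_nth[OF that] hb[OF that] by simp
    moreover have "scan w t ! \<tau> < symbols M" using scan_nth[OF that] cell_less[OF that] by simp
    from modelsD[OF mod in_schemas(8)[OF that this] t(2) _ B, of "?h \<tau>"] have
      "\<alpha> (cell_var x \<tau> (scan w t ! \<tau>) t (?h \<tau>)) \<Longrightarrow> \<alpha> (scan_var x \<tau> (scan w t ! \<tau>) t)"
      using hb[OF that] hd[OF that] t(1) by (simp add: schema_holds_def run_scan_def)
    ultimately show ?thesis using ce[OF that, of "?h \<tau>"] hb[OF that] by simp
  qed
  obtain j where j: "j < length situations" "situations ! j = (state w t, scan w t)"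
    using situation_index by blast
  have ac: "\<alpha> (act_var x j t)"
    using modelsD[OF mod in_schemas(9)[OF j(1)] t(2) B B] t(1) st sc j(2)
    by (simp add: schema_holds_def run_act_def)
  have "\<alpha> (state_var x (state w (Suc t)) (Suc t))"
    using modelsD[OF mod in_schemas(10)[OF j(1)] t(2) B B] t(1) ac j(2) run_Suc(1)
    by (simp add: schema_holds_def run_state_def)
  moreover have "\<alpha> (head_var x \<tau> (Suc t) (nat (head w (Suc t) \<tau> + ?o)))" if "\<tau> < tapes M" for \<tau>
  proof -
    let ?d = "snd (snd (delta (state w t, scan w t)) ! \<tau>)"
    have "?h \<tau> + nat (?d + 1) - 1 = nat (head w (Suc t) \<tau> + ?o)"
      using delta_run(2)[OF that, of w t] hb[OF that] run_Suc(3)[OF that] by auto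
    then show ?thesis
      using modelsD[OF mod in_schemas(12)[OF j(1) that] t(2) _ B, of "?h \<tau>"] t(1) ac j(2) hb[OF that] hd[OF that]
      by (simp add: schema_holds_def run_move_def)
  qed
  moreover have "\<alpha> (cell_var x \<tau> (cell w (Suc t) \<tau> (int h - ?o)) (Suc t) h)" if "\<tau> < tapes M" "h < base x" for \<tau> h
  proof (cases "h = ?h \<tau>")
    case True
    have "cell w (Suc t) \<tau> (int h - ?o) = fst (snd (delta (state w t, scan w t)) ! \<tau>)"
      using True hb(3)[OF that(1)] run_Suc(2)[OF that(1)] by simp
    then show ?thesis
      using modelsD[OF mod in_schemas(11)[OF j(1) that(1)] t(2) that(2) B] t(1) ac j(2) hd[OF that(1)] True
      by (simp add: schema_holds_def run_write_def)
  next
    case False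
    then have "int h - ?o \<noteq> head w t \<tau>" using hb(3)[OF that(1)] by auto
    then have eq: "cell w (Suc t) \<tau> (int h - ?o) = cell w t \<tau> (int h - ?o)"
      using run_Suc(2)[OF that(1)] by simp
    have "?h \<tau> < base x" using hb(2)[OF that(1)] by simp
    from modelsD[OF mod in_schemas(13)[OF that(1) cell_less[OF that(1)]] t(2) that(2) this, of w t "int h - ?o"]
    show ?thesis
      using t(1) hd[OF that(1)] ce[OF that] False eq by (simp add: schema_holds_def run_keep_def)
  qed
  ultimately show ?case by blast
qed

lemma contents_one_at:
  "contents w (int i) = (if i < length w then if one_at w i then 2 else 1 else 0)"
  by (auto simp: contents_def one_at_def)

lemma one_at_pair_word_prefix: "i < 2 * length x \<Longrightarrow> one_at (pair_word x u) i = one_at x (i div 2)"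
proof -
  assume "i < 2 * length x"
  then have i: "i div 2 < length x" by simp
  have "i = 2 * (i div 2) \<or> i = 2 * (i div 2) + 1" by presburger
  then show ?thesis using one_at_pair_word(1,2)[OF i, of u] i by (metis one_at_def)
qed

lemma input_cell_contents:
  assumes "length u \<le> guess_length x" "input_cell x a h"
  shows "contents (pair_word x u) (int h - int (horizon x)) = a"
proof (cases "h < horizon x")
  case True
  then show ?thesis using assms(2) by (auto simp: input_cell_def contents_def)
next
  case False
  define i where "i = h - horizon x"
  have i: "int h - int (horizon x) = int i" "h = horizon x + i" using False by (simp_all add: i_def)
  have a: "a = (if i < 2 * length x then if one_at x (i div 2) then 2 else 1
      else if i = 2 * length x then 1 else if i = 2 * length x + 1 then 2 else 0)"
    and "i < 2 * length x + 2 \<or> 2 * length x + 2 + guess_length x \<le> i"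
    using assms(2) unfolding input_cell_def i(2) by auto
  then consider "i < 2 * length x" | "i = 2 * length x" | "i = 2 * length x + 1" | "2 * length x + 2 + guess_length x \<le> i"
    by linarith
  then show ?thesis
    unfolding i(1) contents_one_at length_pair_word
    using a one_at_pair_word(3,4)[of x u] one_at_pair_word_prefix[of i x u] assms(1) by cases auto
qed

lemma input_cell_exists:
  assumes "\<not> guess_cell x h"
  shows "\<exists>a<3. input_cell x a h"
proof -
  consider "h < horizon x \<or> horizon x + (2 * length x + 2 + guess_length x) \<le> h"
    | "horizon x \<le> h \<and> h < horizon x + 2 * length x \<and> \<not> one_at x ((h - horizon x) div 2) \<or> h = horizon x + 2 * length x"
    | "horizon x \<le> h \<and> h < horizon x + 2 * length x \<and> one_at x ((h - horizon x) div 2) \<or> h = horizon x + 2 * length x + 1"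
    using assms unfolding guess_cell_def by linarith
  then show ?thesis
  proof cases
    case 1
    then show ?thesis by (intro exI[of _ 0]) (simp add: input_cell_def)
  next
    case 2
    then show ?thesis by (intro exI[of _ 1]) (simp add: input_cell_def)
  next
    case 3
    then show ?thesis by (intro exI[of _ 2]) (simp add: input_cell_def)
  qed
qed

text \<open>The certificate is read off the assignment, with ambiguous cells resolved so that the
  chosen symbol is always one that the assignment makes true.\<close>

lemma models_start:
  assumes mod: "models \<alpha> x"
  obtains u where "length u \<le> guess_length x"
    "\<And>h. h < base x \<Longrightarrow> \<alpha> (cell_var x 0 (contents (pair_word x u) (int h - int (horizon x))) 0 h)"
proof -
  have B: "0 < base x" by (simp add: base_def)
  define p where "p i = horizon x + 2 * length x + 2 + i" for i
  \<comment> \<open>The word ends at the first guessed cell marked blank, or with the guessed region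
    if there is none; \<open>start_pad\<close> marks all later cells blank.\<close>
  define P where "P i \<longleftrightarrow> guess_length x \<le> i \<or> \<alpha> (cell_var x 0 0 0 (p i))" for i
  define l where "l = (LEAST i. P i)"
  have Pl: "P l" unfolding l_def by (rule LeastI[of _ "guess_length x"]) (simp add: P_def)
  have lle: "l \<le> guess_length x" unfolding l_def by (rule Least_le) (simp add: P_def)
  have min: "\<not> P i" if "i < l" for i using that unfolding l_def by (rule not_less_Least)
  have pB: "p i < base x" "guess_cell x (p i)" if "i < guess_length x" for i
    using that by (simp_all add: p_def base_def guess_cell_def)
  \<comment> \<open>If a cell is marked with both bits, 2 wins; otherwise \<open>start_guess\<close>
    guarantees 1, because no cell before \<open>l\<close> is marked blank.\<close>
  define u where "u = map (\<lambda>i. \<alpha> (cell_var x 0 2 0 (p i))) [0..<l]"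
  have pad: "\<alpha> (cell_var x 0 0 0 (p i))" if "l \<le> i" "i < guess_length x" for i
    using that
  proof (induction i rule: dec_induct)
    case base
    then show ?case using Pl by (simp add: P_def)
  next
    case (step i)
    then have "guess_cell x (p i + 1)" "guess_cell x (p i)" by (simp_all add: p_def guess_cell_def)
    with modelsD[OF mod in_schemas(3) B pB(1)[of i] B] step show ?case
      by (simp add: schema_holds_def start_pad_def p_def)
  qed
  have "\<alpha> (cell_var x 0 (contents (pair_word x u) (int h - int (horizon x))) 0 h)" if h: "h < base x" for h
  proof (cases "guess_cell x h")
    case True
    define i where "i = h - (horizon x + 2 * length x + 2)"
    have i: "h = p i" "i < guess_length x" using True by (auto simp: guess_cell_def i_def p_def)
    have "int h - int (horizon x) = int (2 * length x + 2 + i)" by (simp add: i(1) p_def)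
    then have c: "contents (pair_word x u) (int h - int (horizon x)) = contents u (int i)"
      unfolding contents_one_at length_pair_word one_at_pair_word(5) by (simp only: contents_one_at length_pair_word one_at_pair_word(5)) simp
    show ?thesis
    proof (cases "i < l")
      case less: True
      then have "\<not> \<alpha> (cell_var x 0 0 0 h)" using min[of i] i by (simp add: P_def)
      then have "\<alpha> (cell_var x 0 1 0 h) \<or> \<alpha> (cell_var x 0 2 0 h)"
        using modelsD[OF mod in_schemas(2) B h B] True by (simp add: schema_holds_def start_guess_def)
      moreover have "contents u (int i) = (if \<alpha> (cell_var x 0 2 0 h) then 2 else 1)"
        using less by (simp add: contents_def u_def i(1))
      ultimately show ?thesis unfolding c by auto
    next
      case False
      then have "contents u (int i) = 0" by (simp add: contents_def u_def)
      then show ?thesis using pad[of i] False i unfolding c by simp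
    qed
  next
    case False
    then obtain a where a: "a < 3" "input_cell x a h" using input_cell_exists by blast
    moreover have "length u \<le> guess_length x" using lle by (simp add: u_def)
    ultimately have "contents (pair_word x u) (int h - int (horizon x)) = a" by (intro input_cell_contents)
    then show ?thesis
      using modelsD[OF mod in_schemas(6)[OF a(1)] B h B] a(2) by (simp add: schema_holds_def start_input_def)
  qed
  moreover have "length u \<le> guess_length x" using lle by (simp add: u_def)
  ultimately show ?thesis using that by blast
qed

lemma accept_iff:
  assumes "computes_in_time M (\<lambda>y. [y \<in> L]) (poly q)" "poly q (length w) \<le> horizon x"
  shows "cell w (horizon x) 1 0 = (if w \<in> L then 2 else 1)"
proof -
  obtain ts where ts: "(step M ^^ poly q (length w)) (init M w) = (states M, ts)" "fst (ts ! 1) = contents [w \<in> L]"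
    using assms(1) unfolding computes_in_time_def by (metis (mono_tags, lifting) case_prodE)
  have "cfg w (horizon x) = (states M, ts)"
    unfolding cfg_def by (rule step_halted_mono[OF ts(1)]) (use assms(2) in auto)
  then show ?thesis using ts(2) by (simp add: cell_def contents_def)
qed

section \<open>Every accepting run yields a model\<close>

definition truth :: "bool list \<Rightarrow> bool list \<Rightarrow> nat \<Rightarrow> nat \<Rightarrow> nat \<Rightarrow> nat \<Rightarrow> nat \<Rightarrow> bool" where
  "truth x w k \<tau> a t h \<longleftrightarrow>
     (if k = 0 then a = state w t
      else if k = 1 then int h = head w t \<tau> + int (horizon x)
      else if k = 2 then a = cell w t \<tau> (int h - int (horizon x))
      else if k = 3 then a = cell w t \<tau> (head w t \<tau>)
      else situations ! a = (state w t, scan w t))"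

text \<open>Division undoes \<open>var\<close> whenever all digits after the kind are below the
  base, and the assignment becomes a predicate on numbers.\<close>

definition decoded_truth :: "bool list \<Rightarrow> bool list \<Rightarrow> nat \<Rightarrow> bool" where
  "decoded_truth x w v = (let B = base x in
     truth x w (v div B div B div B div B) (v div B div B div B mod B) (v div B div B mod B) (v div B mod B) (v mod B))"

lemma decoded_truth_var:
  assumes "\<tau> < base x" "a < base x" "t < base x" "h < base x"
  shows "decoded_truth x w (var x k \<tau> a t h) = truth x w k \<tau> a t h"
proof -
  have "(y * base x + z) div base x = y \<and> (y * base x + z) mod base x = z" if "z < base x" for y z
    using that by (simp add: div_mult_self3)
  then show ?thesis using assms by (simp add: decoded_truth_def var_def Let_def)
qed

text \<open>The clauses are true statements about the run. The output hypothesis enters in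
  \<open>accepting\<close>, the bound on \<open>u\<close> in the input cells that have to be blank
  beyond the guessed region.\<close>

lemma run_models:
  assumes u: "length u \<le> guess_length x" and acc: "cell (pair_word x u) (horizon x) 1 0 \<noteq> 1"
  shows "models (decoded_truth x (pair_word x u)) x"
  unfolding models_def
proof (intro ballI allI impI)
  fix \<sigma> t h h' assume \<sigma>: "\<sigma> \<in> set schemas" and t: "t < base x" and h: "h < base x" and h': "h' < base x"
  let ?w = "pair_word x u" and ?\<alpha> = "decoded_truth x (pair_word x u)"
  have B: "0 < base x" "1 < base x" "2 < base x" "horizon x < base x" "t < horizon x \<Longrightarrow> t + 1 < base x" by (auto simp: base_def)
  have tB: "\<tau> < base x" if "\<tau> < tapes M" for \<tau> using that by (simp add: base_def)
  have aB: "a < base x" if "a < symbols M" for a using that by (simp add: base_def)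
  have qB: "q < base x" if "q \<le> states M" for q using that by (simp add: base_def)
  have jB: "j < base x" if "j < length situations" for j using that by (simp add: base_def)
  have sit: "fst (situations ! j) \<le> states M \<and> length (snd (situations ! j)) = tapes M \<and>
      set (snd (situations ! j)) \<subseteq> {..<symbols M}" if "j < length situations" for j
  proof -
    have "situations ! j \<in> set situations" using that by simp
    then show ?thesis
      unfolding situations_def by (auto simp: set_n_lists less_Suc_eq_le atLeast0LessThan simp del: upt_Suc)
  qed
  have sitn: "snd (situations ! j) ! \<tau> < symbols M" if "j < length situations" "\<tau> < tapes M" for j \<tau>
    using sit[OF that(1)] that(2) by (metis lessThan_iff nth_mem subsetD)
  have dB: "fst (snd (delta (situations ! j)) ! \<tau>) < symbols M" "snd (snd (delta (situations ! j)) ! \<tau>) \<in> {-1, 0, 1}"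
    if "j < length situations" "\<tau> < tapes M" for j \<tau>
    using delta_act_wf[of "fst (situations ! j)" "snd (situations ! j)" \<tau>] sit[OF that(1)] that(2) by simp_all
  have dq: "fst (delta (situations ! j)) \<le> states M" if "j < length situations" for j
    using delta_wf(1)[of "fst (situations ! j)" "snd (situations ! j)"] sit[OF that] by simp
  have dec: "?\<alpha> (var x k \<tau> a t h) = truth x ?w k \<tau> a t h"
    if "\<tau> < base x" "a < base x" "t < base x" "h < base x" for k \<tau> a t h
    using that by (rule decoded_truth_var)
  from \<sigma> consider "\<sigma> = start_state" | "\<sigma> = start_guess" | "\<sigma> = start_pad" | "\<sigma> = accepting"
    | \<tau> where "\<sigma> = start_head \<tau>" "\<tau> < tapes M" | a where "\<sigma> = start_input a" "a < 3"
    | \<tau> where "\<sigma> = start_blank \<tau>" "1 \<le> \<tau>" "\<tau> < tapes M"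
    | \<tau> a where "\<sigma> = run_scan \<tau> a" "\<tau> < tapes M" "a < symbols M"
    | j where "\<sigma> = run_act j" "j < length situations"
    | j where "\<sigma> = run_state j" "j < length situations"
    | j \<tau> where "\<sigma> = run_write j \<tau>" "j < length situations" "\<tau> < tapes M"
    | j \<tau> where "\<sigma> = run_move j \<tau>" "j < length situations" "\<tau> < tapes M"
    | \<tau> a where "\<sigma> = run_keep \<tau> a" "\<tau> < tapes M" "a < symbols M"
    unfolding schemas_def by auto
  then show "schema_holds ?\<alpha> x \<sigma> t h h'"
  proof cases
    case 1
    then show ?thesis using B by (simp add: schema_holds_def start_state_def dec truth_def cfg_0)
  next
    case 2
    have "contents ?w (int h - int (horizon x)) \<in> {0, 1, 2}" by (simp add: contents_def)
    then show ?thesis using 2 B h tapes_ge by (auto simp: schema_holds_def start_guess_def dec truth_def cfg_0)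
  next
    case 3
    \<comment> \<open>In the guessed region blanks begin where the word ends, so no bit follows a
      blank.\<close>
    have "contents ?w (int (Suc h) - int (horizon x)) = 0"
      if "guess_cell x h" "contents ?w (int h - int (horizon x)) = 0"
      using that by (auto simp: guess_cell_def contents_def split: if_splits)
    moreover have "h + 1 < base x" if "guess_cell x (h + 1)" using that by (simp add: guess_cell_def base_def)
    ultimately show ?thesis using 3 B h tapes_ge
      by (auto simp: schema_holds_def start_pad_def dec truth_def cfg_0 algebra_simps)
  next
    case 4
    then show ?thesis using B acc by (simp add: schema_holds_def accepting_def dec truth_def)
  next
    case (5 \<tau>)
    then show ?thesis using B tB by (simp add: schema_holds_def start_head_def dec truth_def cfg_0)
  next
    case (6 a)
    then show ?thesis using B h input_cell_contents[OF u] tapes_ge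
      by (simp add: schema_holds_def start_input_def dec truth_def cfg_0)
  next
    case (7 \<tau>)
    then show ?thesis using B h tB cfg_0(3) by (simp add: schema_holds_def start_blank_def dec truth_def)
  next
    case (8 \<tau> a)
    have "?\<alpha> (scan_var x \<tau> a t)" if "int h = head ?w t \<tau> + int (horizon x)"
        "a = cell ?w t \<tau> (int h - int (horizon x))"
      unfolding dec[OF tB[OF 8(2)] aB[OF 8(3)] t B(1)] truth_def using that by simp
    then show ?thesis using 8 B h t tB aB
      by (simp add: schema_holds_def run_scan_def dec) (simp add: truth_def)
  next
    case (9 j)
    have "situations ! j = (state ?w t, scan ?w t)"
      if "fst (situations ! j) = state ?w t" "\<forall>\<tau><tapes M. snd (situations ! j) ! \<tau> = cell ?w t \<tau> (head ?w t \<tau>)"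
    proof (rule prod_eqI)
      show "snd (situations ! j) = snd (state ?w t, scan ?w t)"
        using that(2) sit[OF 9(2)] by (auto simp: scan_nth length_scan intro!: nth_equalityI)
    qed (use that(1) in simp)
    then show ?thesis using 9 B t tB aB sitn qB jB sit
      by (simp add: schema_holds_def run_act_def dec truth_def)
  next
    case (10 j)
    then show ?thesis using B t dq[OF 10(2)] qB jB run_Suc(1)
      by (simp add: schema_holds_def run_state_def dec) (simp add: truth_def)
  next
    case (11 j \<tau>)
    then show ?thesis using B t h dB(1)[OF 11(2,3)] aB tB jB run_Suc(2)[OF 11(3)]
      by (simp add: schema_holds_def run_write_def dec) (auto simp: truth_def)
  next
    case (12 j \<tau>)
    let ?d = "snd (snd (delta (situations ! j)) ! \<tau>)"
    \<comment> \<open>Under the guard the truncated subtraction is exact, and \<open>n\<close> is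
      \<open>h\<close> displaced by \<open>?d\<close>.\<close>
    define n where "n = h + nat (?d + 1) - 1"
    have n: "n < base x" "int n = int h + ?d" if "0 < h" "h + 1 < base x"
      using dB(2)[OF 12(2,3)] that h by (auto simp: n_def)
    have "?\<alpha> (head_var x \<tau> (t + 1) n)"
      if g: "t < horizon x" "0 < h" "h + 1 < base x" and a: "?\<alpha> (act_var x j t)" "?\<alpha> (head_var x \<tau> t h)"
    proof -
      have "situations ! j = (state ?w t, scan ?w t)"
        using a(1) dec[OF B(1) jB[OF 12(2)] t B(1)] by (simp add: truth_def)
      moreover have "int h = head ?w t \<tau> + int (horizon x)"
        using a(2) dec[OF tB[OF 12(3)] B(1) t h] by (simp add: truth_def)
      ultimately have "int n = head ?w (t + 1) \<tau> + int (horizon x)"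
        using n(2)[OF g(2,3)] run_Suc(3)[OF 12(3), of ?w t] by simp
      then show ?thesis
        using dec[OF tB[OF 12(3)] B(1) B(5)[OF g(1)] n(1)[OF g(2,3)]] by (simp add: truth_def)
    qed
    then show ?thesis unfolding 12(1) schema_holds_def run_move_def n_def by simp
  next
    case (13 \<tau> a)
    then show ?thesis using B t h h' tB aB run_Suc(2)[OF 13(2)]
      by (simp add: schema_holds_def run_keep_def dec) (auto simp: truth_def)
  qed
qed

lemma models_iff:
  assumes "computes_in_time M (\<lambda>y. [y \<in> L]) (poly q)"
    and "\<And>u. length u \<le> guess_length x \<Longrightarrow> poly q (length (pair_word x u)) \<le> horizon x"
  shows "(\<exists>\<alpha>. models \<alpha> x) \<longleftrightarrow> (\<exists>u. length u \<le> guess_length x \<and> pair_word x u \<in> L)"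
proof
  assume "\<exists>\<alpha>. models \<alpha> x"
  then obtain \<alpha> where mod: "models \<alpha> x" by blast
  then obtain u where u: "length u \<le> guess_length x"
    "\<And>h. h < base x \<Longrightarrow> \<alpha> (cell_var x 0 (contents (pair_word x u) (int h - int (horizon x))) 0 h)"
    using models_start by blast
  let ?w = "pair_word x u"
  have B: "horizon x < base x" "0 < base x" by (simp_all add: base_def)
  have "1 < tapes M" using tapes_ge by simp
  with models_run[OF mod u(2) order_refl] B(1)
  have "\<alpha> (cell_var x 1 (cell ?w (horizon x) 1 (int (horizon x) - int (horizon x))) (horizon x) (horizon x))"
    by blast
  moreover have "\<not> \<alpha> (cell_var x 1 1 (horizon x) (horizon x))"
    using modelsD[OF mod in_schemas(4) B(2) B(2) B(2)] by (simp add: schema_holds_def accepting_def)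
  ultimately have "cell ?w (horizon x) 1 0 \<noteq> 1" by (metis cancel_comm_monoid_add_class.diff_cancel)
  then have "?w \<in> L" using accept_iff[OF assms(1) assms(2)[OF u(1)]] by (simp split: if_splits)
  with u(1) show "\<exists>u. length u \<le> guess_length x \<and> pair_word x u \<in> L" by blast
next
  assume "\<exists>u. length u \<le> guess_length x \<and> pair_word x u \<in> L"
  then obtain u where u: "length u \<le> guess_length x" "pair_word x u \<in> L" by blast
  then have "cell (pair_word x u) (horizon x) 1 0 \<noteq> 1"
    using accept_iff[OF assms(1) assms(2)[OF u(1)]] by simp
  then show "\<exists>\<alpha>. models \<alpha> x" using run_models[OF u(1)] by blast
qed

end

section \<open>NP-hardness\<close>

definition schema_vars :: "schema \<Rightarrow> var_term list" where
  "schema_vars \<sigma> = fst (snd \<sigma>) @ snd (snd \<sigma>)"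

definition computable_schema :: "schema \<Rightarrow> bool" where
  "computable_schema \<sigma> \<longleftrightarrow> checkable (\<lambda>x s. fst \<sigma> x (s 0) (s 1) (s 2)) \<and>
     (\<forall>v\<in>set (schema_vars \<sigma>). computable (\<lambda>x s. v x (s 0) (s 1) (s 2)))"

text \<open>The sum is merely a computable strict bound for all the variables that occur.\<close>

definition var_count :: "schema list \<Rightarrow> (bool list \<Rightarrow> nat) \<Rightarrow> bool list \<Rightarrow> nat" where
  "var_count S B x = (\<Sum>t<B x. \<Sum>h<B x. \<Sum>h'<B x. \<Sum>v\<leftarrow>concat (map schema_vars S). Suc (v x t h h'))"

definition clause_count :: "schema list \<Rightarrow> (bool list \<Rightarrow> nat) \<Rightarrow> bool list \<Rightarrow> nat" where
  "clause_count S B x = length S * B x * B x * B x"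

text \<open>A failing guard leaves the clause without literals, and \<open>satisfiable\<close>
  treats such a clause as no condition.\<close>

definition schema_literal :: "schema \<Rightarrow> bool list \<Rightarrow> nat \<Rightarrow> nat \<Rightarrow> nat \<Rightarrow> nat \<Rightarrow> bool" where
  "schema_literal \<sigma> x t h h' i \<longleftrightarrow> fst \<sigma> x t h h' \<and>
     ((\<exists>v\<in>set (fst (snd \<sigma>)). i = 2 * v x t h h' + 1) \<or> (\<exists>v\<in>set (snd (snd \<sigma>)). i = 2 * v x t h h'))"

text \<open>Clause numbers are numerals with the digits schema, time and two cells. Searching the
  enumerated list instead of indexing it gives a finite disjunction, the form that
  \<open>checkable_bex_list\<close> handles.\<close>

definition literal :: "schema list \<Rightarrow> (bool list \<Rightarrow> nat) \<Rightarrow> bool list \<Rightarrow> nat \<Rightarrow> nat \<Rightarrow> bool" where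
  "literal S B x c i \<longleftrightarrow> (\<exists>p\<in>set (List.enumerate 0 S). fst p = c div B x div B x div B x \<and>
     schema_literal (snd p) x (c div B x div B x mod B x) (c div B x mod B x) (c mod B x) i)"

lemma var_less_count:
  assumes "\<sigma> \<in> set S" "v \<in> set (schema_vars \<sigma>)" "t < B x" "h < B x" "h' < B x"
  shows "v x t h h' < var_count S B x"
proof -
  let ?f = "\<lambda>t h h'. \<Sum>v\<leftarrow>concat (map schema_vars S). Suc (v x t h h')"
  have "Suc (v x t h h') \<in> set (map (\<lambda>v. Suc (v x t h h')) (concat (map schema_vars S)))"
    using assms(1,2) by auto
  then have "Suc (v x t h h') \<le> ?f t h h'" by (intro member_le_sum_list) auto
  also have "\<dots> \<le> (\<Sum>h'<B x. ?f t h h')"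
    using assms(5) by (intro member_le_sum) auto
  also have "\<dots> \<le> (\<Sum>h<B x. \<Sum>h'<B x. ?f t h h')"
    using assms(4) by (intro member_le_sum[where f = "\<lambda>h. \<Sum>h'<B x. ?f t h h'"]) auto
  also have "\<dots> \<le> var_count S B x"
    unfolding var_count_def
    using assms(3) by (intro member_le_sum[where f = "\<lambda>t. \<Sum>h<B x. \<Sum>h'<B x. ?f t h h'"]) auto
  finally show ?thesis by simp
qed

lemma literal_decode:
  assumes "k < length S" "t < B x" "h < B x" "h' < B x"
  shows "((k * B x + t) * B x + h) * B x + h' < clause_count S B x"
    and "literal S B x (((k * B x + t) * B x + h) * B x + h') i \<longleftrightarrow> schema_literal (S ! k) x t h h' i"
proof -
  show "((k * B x + t) * B x + h) * B x + h' < clause_count S B x"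
    unfolding clause_count_def by (intro row_index_less assms)
  have "(y * B x + z) div B x = y \<and> (y * B x + z) mod B x = z" if "z < B x" for y z
    using that by (simp add: div_mult_self3)
  then have "literal S B x (((k * B x + t) * B x + h) * B x + h') i \<longleftrightarrow>
      (\<exists>p\<in>set (List.enumerate 0 S). fst p = k \<and> schema_literal (snd p) x t h h' i)"
    using assms unfolding literal_def by simp
  also have "\<dots> \<longleftrightarrow> schema_literal (S ! k) x t h h' i"
    using assms(1) by (auto simp: in_set_enumerate_eq Bex_def)
  finally show "literal S B x (((k * B x + t) * B x + h) * B x + h') i \<longleftrightarrow> schema_literal (S ! k) x t h h' i" .
qed

text \<open>\<open>var_count\<close> is above all variables of the clause, so the bound on
  \<open>i\<close> cuts off nothing. As \<open>\<sigma>\<close> mentions a variable, its clause is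
  empty only if the guard fails.\<close>

lemma clause_satisfied_iff:
  assumes "\<sigma> \<in> set S" "schema_vars \<sigma> \<noteq> []" "t < B x" "h < B x" "h' < B x"
  shows "((\<exists>i<2 * var_count S B x. schema_literal \<sigma> x t h h' i) \<longrightarrow>
      (\<exists>i<2 * var_count S B x. schema_literal \<sigma> x t h h' i \<and> (\<alpha> (i div 2) \<longleftrightarrow> even i))) \<longleftrightarrow>
    schema_holds \<alpha> x \<sigma> t h h'" (is "(?N \<longrightarrow> ?T) \<longleftrightarrow> ?H")
proof (cases "fst \<sigma> x t h h'")
  case False
  then show ?thesis by (simp add: schema_literal_def schema_holds_def)
next
  case g: True
  have less: "2 * v x t h h' + 1 < 2 * var_count S B x" "2 * v x t h h' < 2 * var_count S B x"
    if "v \<in> set (schema_vars \<sigma>)" for v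
    using var_less_count[of \<sigma> S v t B x h h'] assms that by simp_all
  have neg: "schema_literal \<sigma> x t h h' (2 * v x t h h' + 1)" "v \<in> set (schema_vars \<sigma>)" if "v \<in> set (fst (snd \<sigma>))" for v
    using that g by (auto simp: schema_literal_def schema_vars_def)
  have pos: "schema_literal \<sigma> x t h h' (2 * v x t h h')" "v \<in> set (schema_vars \<sigma>)" if "v \<in> set (snd (snd \<sigma>))" for v
    using that g by (auto simp: schema_literal_def schema_vars_def)
  obtain v where "v \<in> set (fst (snd \<sigma>)) \<or> v \<in> set (snd (snd \<sigma>))"
    using assms(2) by (metis Un_iff last_in_set schema_vars_def set_append)
  then have N: ?N using neg pos less by blast
  have "?T \<longleftrightarrow> (\<exists>v\<in>set (fst (snd \<sigma>)). \<not> \<alpha> (v x t h h')) \<or> (\<exists>v\<in>set (snd (snd \<sigma>)). \<alpha> (v x t h h'))"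
    (is "_ \<longleftrightarrow> ?D")
  proof
    assume ?T
    then obtain i where i: "schema_literal \<sigma> x t h h' i" "\<alpha> (i div 2) \<longleftrightarrow> even i" by blast
    then show ?D unfolding schema_literal_def by auto
  next
    assume ?D
    then show ?T
    proof
      assume "\<exists>v\<in>set (fst (snd \<sigma>)). \<not> \<alpha> (v x t h h')"
      then obtain v where v: "v \<in> set (fst (snd \<sigma>))" "\<not> \<alpha> (v x t h h')" by blast
      then show ?T using neg[OF v(1)] less(1)[OF neg(2)[OF v(1)]]
        by (intro exI[of _ "2 * v x t h h' + 1"]) simp
    next
      assume "\<exists>v\<in>set (snd (snd \<sigma>)). \<alpha> (v x t h h')"
      then obtain v where v: "v \<in> set (snd (snd \<sigma>))" "\<alpha> (v x t h h')" by blast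
      then show ?T using pos[OF v(1)] less(2)[OF pos(2)[OF v(1)]]
        by (intro exI[of _ "2 * v x t h h'"]) simp
    qed
  qed
  then show ?thesis using N g unfolding schema_holds_def by blast
qed

lemma satisfiable_schemas_iff:
  assumes ne: "\<And>\<sigma>. \<sigma> \<in> set S \<Longrightarrow> schema_vars \<sigma> \<noteq> []"
  shows "satisfiable (var_count S B x) (clause_count S B x) (literal S B x) \<longleftrightarrow>
    (\<exists>\<alpha>. \<forall>\<sigma>\<in>set S. \<forall>t<B x. \<forall>h<B x. \<forall>h'<B x. schema_holds \<alpha> x \<sigma> t h h')"
proof -
  let ?c = "\<lambda>k t h h'. ((k * B x + t) * B x + h) * B x + h'"
  let ?sat = "\<lambda>\<alpha> l. (\<exists>i<2 * var_count S B x. l i) \<longrightarrow> (\<exists>i<2 * var_count S B x. l i \<and> (\<alpha> (i div 2) \<longleftrightarrow> even i))"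
  have *: "?sat \<alpha> (literal S B x (?c k t h h')) \<longleftrightarrow> schema_holds \<alpha> x (S ! k) t h h'"
    if "k < length S" "t < B x" "h < B x" "h' < B x" for \<alpha> k t h h'
    unfolding literal_decode(2)[where S = S and B = B and x = x, OF that]
    using that by (intro clause_satisfied_iff ne) auto
  have "(\<forall>c<clause_count S B x. ?sat \<alpha> (literal S B x c)) \<longleftrightarrow>
      (\<forall>\<sigma>\<in>set S. \<forall>t<B x. \<forall>h<B x. \<forall>h'<B x. schema_holds \<alpha> x \<sigma> t h h')" (is "?L \<longleftrightarrow> ?R") for \<alpha>
  proof
    assume L: ?L
    show ?R
    proof (intro ballI allI impI)
      fix \<sigma> t h h' assume "\<sigma> \<in> set S" and b: "t < B x" "h < B x" "h' < B x"
      then obtain k where k: "k < length S" "\<sigma> = S ! k" by (auto simp: in_set_conv_nth)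
      have "?sat \<alpha> (literal S B x (?c k t h h'))"
        using L literal_decode(1)[where S = S and B = B and x = x, OF k(1) b] by blast
      then show "schema_holds \<alpha> x \<sigma> t h h'" unfolding *[OF k(1) b] k(2) .
    qed
  next
    assume R: ?R
    show ?L
    proof (rule allI, rule impI)
      fix c assume c: "c < clause_count S B x"
      then have B: "0 < B x" by (cases "B x") (auto simp: clause_count_def)
      define k t h h' where "k = c div B x div B x div B x" and "t = c div B x div B x mod B x"
        and "h = c div B x mod B x" and "h' = c mod B x"
      have b: "t < B x" "h < B x" "h' < B x" using B by (simp_all add: t_def h_def h'_def)
      have k: "k < length S"
        using c unfolding k_def clause_count_def by (intro less_mult_imp_div_less) (simp add: mult.assoc)
      have "c = ?c k t h h'" by (simp add: k_def t_def h_def h'_def)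
      moreover have "schema_holds \<alpha> x (S ! k) t h h'" using R b k by simp
      ultimately show "?sat \<alpha> (literal S B x c)" using *[OF k b] by simp
    qed
  qed
  then show ?thesis unfolding satisfiable_def by simp
qed

section \<open>Computability of the clauses and of the graph\<close>

lemma computable_var_count:
  assumes "\<And>\<sigma>. \<sigma> \<in> set S \<Longrightarrow> computable_schema \<sigma>" "computable (\<lambda>x s. B x)"
  shows "computable (\<lambda>x s. var_count S B x)"
proof -
  have v: "computable (\<lambda>x s. Suc (v x (s 2) (s 1) (s 0)))" if "v \<in> set (concat (map schema_vars S))" for v
  proof -
    have "computable (\<lambda>x s. v x (s 0) (s 1) (s 2))"
      using assms(1) that unfolding computable_schema_def by auto
    then show ?thesis
      by (rule computable_Suc[OF computable_comp3[of v]]) (rule computable_var)+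
  qed
  show ?thesis
    unfolding var_count_def
    by (rule computable_sum[OF assms(2)], rule computable_sum[OF assms(2)], rule computable_sum[OF assms(2)],
        rule computable_sum_list) (use v in \<open>simp add: numeral_2_eq_2\<close>)
qed

lemma computable_clause_count:
  "computable (\<lambda>x s. B x) \<Longrightarrow> computable (\<lambda>x s. clause_count S B x)"
  unfolding clause_count_def by (intro computable_mult computable_const)

lemma checkable_schema_literal:
  assumes "computable_schema \<sigma>"
  shows "checkable (\<lambda>x s. schema_literal \<sigma> x (s 0) (s 1) (s 2) (s 3))"
  unfolding schema_literal_def
  by (intro checkable_conj checkable_disj checkable_bex_list checkable_eq computable_add computable_mult
      computable_const computable_var)
    (use assms in \<open>auto simp: computable_schema_def schema_vars_def\<close>)

lemma checkable_literal:
  assumes "\<And>\<sigma>. \<sigma> \<in> set S \<Longrightarrow> computable_schema \<sigma>" "computable (\<lambda>x s. B x)" "computable f" "computable g"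
  shows "checkable (\<lambda>x s. literal S B x (f x s) (g x s))"
proof -
  have "checkable (\<lambda>x s. literal S B x (s 0) (s 1))"
    unfolding literal_def
  proof (intro checkable_bex_list checkable_conj checkable_eq computable_const computable_div computable_var assms(2))
    fix p assume "p \<in> set (List.enumerate 0 S)"
    then have p: "fst p < length S" "S ! fst p = snd p" by (simp_all add: in_set_enumerate_eq)
    have "computable_schema (snd p)" unfolding p(2)[symmetric] using nth_mem[OF p(1)] by (rule assms(1))
    note base = checkable_schema_literal[OF this]
    show "checkable (\<lambda>x s. schema_literal (snd p) x (s 0 div B x div B x mod B x) (s 0 div B x mod B x) (s 0 mod B x) (s 1))"
      by (rule computable_comp4[where f = "\<lambda>x a b c d. of_bool (schema_literal (snd p) x a b c d)", OF base])
        (intro computable_div computable_mod computable_var assms(2))+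
  qed
  then show ?thesis
    by (rule computable_comp2[where f = "\<lambda>x a b. of_bool (literal S B x a b)", OF _ assms(3,4)])
qed

context
  fixes k m :: "bool list \<Rightarrow> nat" and lit :: "bool list \<Rightarrow> nat \<Rightarrow> nat \<Rightarrow> bool"
  assumes k: "computable (\<lambda>x s. k x)" and m: "computable (\<lambda>x s. m x)"
    and lit: "\<And>f g. computable f \<Longrightarrow> computable g \<Longrightarrow> checkable (\<lambda>x s. lit x (f x s) (g x s))"
begin

lemma computable_cnf_colors: "computable (\<lambda>x s. cnf_colors (k x) (m x))"
  unfolding cnf_colors_def by (intro computable_intros k m)

lemma checkable_listed:
  assumes "computable f" "computable g"
  shows "checkable (\<lambda>x s. listed (k x) (lit x) (f x s) (g x s))"
  unfolding listed_def by (intro computable_intros k lit assms)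

lemma computable_cnf_slot:
  assumes "computable f" "computable g"
  shows "computable (\<lambda>x s. cnf_slot (k x) (m x) (lit x) (cnf_colors (k x) (m x)) (f x s) (g x s))"
proof (rule computable_comp2[where f =
      "\<lambda>x. cnf_slot (k x) (m x) (lit x) (cnf_colors (k x) (m x))", OF _ assms])
  show "computable (\<lambda>x s. cnf_slot (k x) (m x) (lit x) (cnf_colors (k x) (m x)) (s 0) (s 1))"
    unfolding cnf_slot_def
    by (intro computable_if computable_intros computable_cnf_colors checkable_listed k m computable_var)
qed

lemma checkable_cnf_adjacent:
  assumes "computable f" "computable g"
  shows "checkable (\<lambda>x s. let r = cnf_colors (k x) (m x) in
    adjacent r ((r + 2) * r) (cnf_slot (k x) (m x) (lit x) r) (f x s) (g x s))"
proof (rule computable_comp2[where f = "\<lambda>x a b. of_bool (let r = cnf_colors (k x) (m x) in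
    adjacent r ((r + 2) * r) (cnf_slot (k x) (m x) (lit x) r) a b)", OF _ assms])
  show "checkable (\<lambda>x s. let r = cnf_colors (k x) (m x) in
    adjacent r ((r + 2) * r) (cnf_slot (k x) (m x) (lit x) r) (s 0) (s 1))"
    unfolding Let_def adjacent_def incident_def
    by (intro checkable_conj checkable_disj checkable_eq computable_if computable_intros computable_cnf_colors
        computable_cnf_slot computable_var)
qed

definition cnf_graph :: "bool list \<Rightarrow> bool list" where
  "cnf_graph x = (let r = cnf_colors (k x) (m x); n = 2 * ((r + 2) * r * r) in
     map (\<lambda>e. adjacent r ((r + 2) * r) (cnf_slot (k x) (m x) (lit x) r) (e div n) (e mod n)) [0..<n * n])"

lemma polytime_cnf_graph: "polytime cnf_graph"
proof -
  let ?r = "\<lambda>x. cnf_colors (k x) (m x)"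
  let ?n = "\<lambda>x. 2 * ((?r x + 2) * ?r x * ?r x)"
  let ?P = "\<lambda>x e. let r = ?r x in
    adjacent r ((r + 2) * r) (cnf_slot (k x) (m x) (lit x) r) (e div ?n x) (e mod ?n x)"
  have "polytime (\<lambda>x. map (?P x) [0..<?n x * ?n x])"
    by (rule polytime_map)
      (intro checkable_cnf_adjacent computable_mult computable_add computable_const computable_cnf_colors
        computable_div computable_mod computable_var)+
  then show ?thesis by (simp add: cnf_graph_def[abs_def] Let_def)
qed

text \<open>The language allows any degree \<open>d \<ge> 3\<close>, but the graph itself forces
  \<open>d = r\<close>.\<close>

lemma cnf_graph_iff: "cnf_graph x \<in> regular_injective_coloring \<longleftrightarrow> satisfiable (k x) (m x) (lit x)"
proof -
  define r where "r = cnf_colors (k x) (m x)"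
  let ?N = "(r + 2) * r" and ?slot = "cnf_slot (k x) (m x) (lit x) r"
  have r: "3 \<le> r" by (simp add: r_def cnf_colors_def)
  then have r0: "0 < r" by simp
  have slot: "?slot b i < ?N" if "b < r" "i < r" for b i using r_def that by (rule cnf_slot_less)
  have inj: "inj_on (?slot b) {..<r}" if "b < r" for b using r_def that by (rule cnf_slot_inj)
  have "cnf_graph x \<in> regular_injective_coloring \<longleftrightarrow>
      0 < 2 * (?N * r) \<and> (\<exists>d\<ge>3. \<exists>f. exact_coloring (2 * (?N * r)) (adjacent r ?N ?slot) d f)"
    unfolding cnf_graph_def Let_def r_def[symmetric]
    by (rule matrix_in_language_iff) (auto simp: adjacent_def)
  also have "\<dots> \<longleftrightarrow> rainbow_colorable r ?N ?slot"
  proof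
    assume "0 < 2 * (?N * r) \<and> (\<exists>d\<ge>3. \<exists>f. exact_coloring (2 * (?N * r)) (adjacent r ?N ?slot) d f)"
    then obtain d f where "exact_coloring (2 * (?N * r)) (adjacent r ?N ?slot) d f" by blast
    then show "rainbow_colorable r ?N ?slot"
      using rainbow_colorable_of_exact_coloring[where slot = ?slot, OF slot inj r0] by blast
  next
    assume rb: "rainbow_colorable r ?N ?slot"
    have "\<exists>f. exact_coloring (2 * (?N * r)) (adjacent r ?N ?slot) r f"
      by (rule exact_coloring_adjacent) (use slot inj r0 rb in auto)
    moreover have "0 < 2 * (?N * r)" using r0 by simp
    ultimately show "0 < 2 * (?N * r) \<and> (\<exists>d\<ge>3. \<exists>f. exact_coloring (2 * (?N * r)) (adjacent r ?N ?slot) d f)"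
      using r by blast
  qed
  also have "\<dots> \<longleftrightarrow> satisfiable (k x) (m x) (lit x)"
    using satisfiable_imp_rainbow[OF r_def] rainbow_imp_satisfiable[OF r_def] by blast
  finally show ?thesis .
qed

end

context tableau
begin

lemma computable_base: "computable (\<lambda>x s. base x)" and computable_horizon: "computable (\<lambda>x s. horizon x)"
  and computable_guess_length: "computable (\<lambda>x s. guess_length x)"
  unfolding base_def horizon_def guess_length_def by (intro computable_intros)+

lemma computable_var_index:
  assumes "computable f" "computable g"
  shows "computable (\<lambda>x s. var x k \<tau> a (f x s) (g x s))"
  unfolding var_def by (intro computable_intros computable_base assms)

lemma computable_schemas:
  assumes "\<sigma> \<in> set schemas"
  shows "computable_schema \<sigma>" "schema_vars \<sigma> \<noteq> []"
proof -
  note defs = start_state_def start_guess_def start_pad_def accepting_def start_head_def start_input_def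
    start_blank_def run_scan_def run_act_def run_state_def run_write_def run_move_def run_keep_def
  note intros = computable_intros computable_var computable_var_index computable_base computable_horizon
    computable_guess_length checkable_one_at
  have "computable_schema \<sigma> \<and> schema_vars \<sigma> \<noteq> []"
    using assms unfolding schemas_def computable_schema_def schema_vars_def
    by (auto simp: defs input_cell_def guess_cell_def simp del: of_bool_or_iff intro!: intros)
  then show "computable_schema \<sigma>" "schema_vars \<sigma> \<noteq> []" by blast+
qed

end

lemma regular_injective_coloring_NP_hard: "NP_hard regular_injective_coloring"
  unfolding NP_hard_def
proof
  fix A assume "A \<in> class_NP"
  then obtain L p where L: "L \<in> class_P"
    and A: "\<And>x. x \<in> A \<longleftrightarrow> (\<exists>u. length u \<le> poly p (length x) \<and> pair_word x u \<in> L)"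
    unfolding class_NP_def by blast
  then obtain M q where M: "wf_tm M" "computes_in_time M (\<lambda>y. [y \<in> L]) (poly q)"
    unfolding class_P_def polytime_def by blast
  \<comment> \<open>The horizon is the time bound for the longest admissible pair word, of length
    \<open>2 * length x + 2\<close> plus the certificate bound; by monotonicity it also covers
    shorter certificates.\<close>
  interpret tableau M "q \<circ>\<^sub>p ([:2, 2:] + p)" p by unfold_locales (rule M(1))
  let ?k = "var_count schemas base" and ?m = "clause_count schemas base" and ?lit = "literal schemas base"
  have k: "computable (\<lambda>x s. ?k x)"
    using computable_schemas(1) computable_base by (rule computable_var_count)
  have m: "computable (\<lambda>x s. ?m x)"
    using computable_base by (rule computable_clause_count)
  have lit: "checkable (\<lambda>x s. ?lit x (f x s) (g x s))" if "computable f" "computable g" for f g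
    using computable_schemas(1) computable_base that by (rule checkable_literal)
  have "x \<in> A \<longleftrightarrow> cnf_graph ?k ?m ?lit x \<in> regular_injective_coloring" for x
  proof -
    have "poly q (length (pair_word x u)) \<le> horizon x" if "length u \<le> guess_length x" for u
      using that unfolding horizon_def guess_length_def poly_pcompose
      by (intro poly_nat_mono) (simp add: length_pair_word)
    then have "(\<exists>\<alpha>. models \<alpha> x) \<longleftrightarrow> x \<in> A"
      using models_iff[OF M(2), of x] unfolding A guess_length_def by blast
    moreover have "satisfiable (?k x) (?m x) (?lit x) \<longleftrightarrow> (\<exists>\<alpha>. models \<alpha> x)"
      unfolding models_def by (rule satisfiable_schemas_iff) (rule computable_schemas(2))
    ultimately show ?thesis using cnf_graph_iff[where lit = ?lit, OF k m lit] by blast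
  qed
  moreover have "polytime (cnf_graph ?k ?m ?lit)"
    by (rule polytime_cnf_graph[where lit = ?lit, OF k m lit])
  ultimately show "polytime_reducible A regular_injective_coloring"
    unfolding polytime_reducible_def by (intro exI[of _ "cnf_graph ?k ?m ?lit"] conjI allI)
qed

theorem theorem2: "NP_complete regular_injective_coloring"
  unfolding NP_complete_def using regular_injective_coloring_in_NP regular_injective_coloring_NP_hard by blast

end
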